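(* Let $X \subset \mathbb{P}^{n+2}$ be a nonsingular intersection of two quadric hypersurfaces with $n\geq3$. Let $\mu^X: X^o \to \mathcal{M}^{\rm PQ}_n$ be the moduli map of second fundamental forms on $X$. Then $\mathcal{P}_x=\mathrm{Ker}(\mathrm{d}_x\mu^X)\subset T_x(X)$ at $x\in X^{\rm reg}$ is a three-dimensional vector subspace poised by the second fundamental form $II_{X,x}$.
   Context: Everything is over $\mathbb{C}$. Let $W$ be a complex vector space of dimension $n\ge3$. A pencil of quadrics on $W$ is a line $\Phi$ in $\mathbb{P}(\mathrm{Sym}^2(W^* ))$. It is nonsingular if its general elements are nondegenerate and it contains exactly $n$ distinct degenerate elements. $\mathrm{PGL}(W)$ acts on pencils by pull-back; $\mathcal{M}^{\rm PQ}_n$ is the orbit space of nonsingular pencils (a Zariski open subset of the GIT quotient, independent of the choice of $W$). Poised subspaces: let $\Phi$ be a nonsingular pencil on $W$ and let $\varphi_1,\varphi_2$ be linearly independent nondegenerate quadratic forms spanning $\Phi$ (a good pair). There is a basis $\{\mathbf w_1,\dots,\mathbf w_n\}$ of $W$ with $\varphi_1(\sum z_i\mathbf w_i)=\sum\alpha_iz_i^2$, $\varphi_2(\sum z_i\mathbf w_i)=\sum z_i^2$, $\alpha_i\in\mathbb{C}$ distinct. Let $\alpha:W\to W$ be the linear map $\sum z_i\mathbf w_i\mapsto\sum\alpha_iz_i\mathbf w_i$. A subspace $P\in\mathrm{Gr}(3,W)$ is poised by $\Phi$ if $P$ is the span of $\mathbf u,\alpha(\mathbf u),\alpha^2(\mathbf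 u)$ for some $\mathbf u=\sum u_i\mathbf w_i$ with all $u_i\ne0$; this notion does not depend on the choice of good pair. Let $X\subset\mathbb{P}^{n+2}=\mathbb{P}(V)$ be a nonsingular intersection of two quadric hypersurfaces (so $\dim X=n$), with pencil $\Phi_X$ of quadratic forms vanishing on $X$. One can choose linearly independent nondegenerate forms $\varphi_1,\varphi_2$ spanning $\Phi_X$ and a basis $\mathbf e_1,\dots,\mathbf e_{n+3}$ of $V$ with $\varphi_1(\sum z_i\mathbf e_i)=\sum\lambda_iz_i^2$, $\varphi_2(\sum z_i\mathbf e_i)=\sum z_i^2$, where $\lambda_1,\dots,\lambda_{n+3}$ are distinct nonzero complex numbers; fix such a choice. For $x\in X$ let $\widehat{x}\subset V$ be its line, $x^\perp\subset V$ the set of vectors orthogonal to $\widehat{x}$ for the bilinear forms of both $\varphi_1,\varphi_2$, and $W_x$ a complement of $\widehat{x}$ in $x^\perp$, identified with $T_x(X)$. The second fundamental form $II_{X,x}$ is the linear system of quadrics on $T_x(X)$ generated by $\varphi_1|_{W_x},\varphi_2|_{W_x}$. Let $X^o\subset X$ be the Zariski open subset where $II_{X,x}$ is a nonsingular pencil; the moduli map is $\mu^X:X^o\to\mathcal{M}^{\rm PQ}_n$, $x\mapsto[II_{X,x}]$. $X^{\rm reg}\subset X$ is the set of points $x=[x_1:\cdots:x_{n+3}]$ such that: (i) all $x_i\ne0$; (ii) $II_{X,x}$ is a nonsingular pencil; (iii) the identity is the only projective automorphism of $II_{X,x}\cong\mathbb{P}^1$ preserving its set of $n$ degenerate elements;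 (iv) the quadratic forms induced by $\varphi_1,\varphi_2$ on $T_x(X)$ are nondegenerate. *)

theory Defs
  imports "HOL-Analysis.Analysis" "HOL-Library.Function_Algebras" "HOL-Library.Numeral_Type"
begin

section \<open>Quadratic forms\<close>

definition form_scale :: "complex \<Rightarrow> ('a \<Rightarrow> complex) \<Rightarrow> 'a \<Rightarrow> complex" where
  "form_scale c \<phi> = (\<lambda>z. c * \<phi> z)"

interpretation form: vector_space "form_scale :: complex \<Rightarrow> ('a \<Rightarrow> complex) \<Rightarrow> 'a \<Rightarrow> complex"
  by unfold_locales (auto simp: form_scale_def fun_eq_iff algebra_simps)

type_synonym 'k form = "complex ^ 'k \<Rightarrow> complex"

definition quadratic_form :: "'k::finite form \<Rightarrow> bool" where
  "quadratic_form \<phi> \<longleftrightarrow>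
     (\<exists>a :: 'k \<Rightarrow> 'k \<Rightarrow> complex. \<forall>z. \<phi> z = (\<Sum>i\<in>UNIV. \<Sum>j\<in>UNIV. a i j * z $ i * z $ j))"

definition polar :: "'k::finite form \<Rightarrow> complex ^ 'k \<Rightarrow> complex ^ 'k \<Rightarrow> complex" where
  "polar \<phi> u v = (\<phi> (u + v) - \<phi> u - \<phi> v) / 2"

definition nondegenerate :: "'k::finite form \<Rightarrow> bool" where
  "nondegenerate \<phi> \<longleftrightarrow> (\<forall>u. (\<forall>v. polar \<phi> u v = 0) \<longrightarrow> u = 0)"

definition is_basis :: "('k \<Rightarrow> complex ^ 'k::finite) \<Rightarrow> bool" where
  "is_basis w \<longleftrightarrow> inj w \<and> vec.independent (range w) \<and> vec.span (range w) = UNIV"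

definition combination :: "('k \<Rightarrow> complex ^ 'k::finite) \<Rightarrow> complex ^ 'k \<Rightarrow> complex ^ 'k" where
  "combination w z = (\<Sum>i\<in>UNIV. z $ i *s w i)"


section \<open>Pencils of quadrics\<close>

text \<open>A line in the projectivized space of quadratic forms is given by the corresponding
  two-dimensional linear space of forms, and an element of the line by a one-dimensional
  linear subspace of it.\<close>

definition pencil :: "'k::finite form set \<Rightarrow> bool" where
  "pencil \<Phi> \<longleftrightarrow> form.subspace \<Phi> \<and> form.dim \<Phi> = 2 \<and> (\<forall>\<phi>\<in>\<Phi>. quadratic_form \<phi>)"

definition elements :: "'k::finite form set \<Rightarrow> 'k form set set" where
  "elements \<Phi> = {form.span {\<phi>} | \<phi>. \<phi> \<in> \<Phi> \<and> \<phi> \<noteq> 0}"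

definition degenerate_elements :: "'k::finite form set \<Rightarrow> 'k form set set" where
  "degenerate_elements \<Phi> = {form.span {\<phi>} | \<phi>. \<phi> \<in> \<Phi> \<and> \<phi> \<noteq> 0 \<and> \<not> nondegenerate \<phi>}"

text \<open>Degeneracy is a Zariski closed condition on the projective line, so ``the general
  elements are nondegenerate'' means that only finitely many are degenerate.\<close>

definition nonsingular_pencil :: "'k::finite form set \<Rightarrow> bool" where
  "nonsingular_pencil \<Phi> \<longleftrightarrow>
     pencil \<Phi> \<and> finite (degenerate_elements \<Phi>) \<and> card (degenerate_elements \<Phi>) = CARD('k)"

text \<open>A projective automorphism of the projective line \<^term>\<open>elements \<Phi>\<close> is the map induced
  by a linear automorphism of \<^term>\<open>\<Phi>\<close>; a linear map defined on \<^term>\<open>\<Phi>\<close> only is taken to be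
  extended linearly to all functions.\<close>

definition only_trivial_automorphism :: "'k::finite form set \<Rightarrow> bool" where
  "only_trivial_automorphism \<Phi> \<longleftrightarrow>
     (\<forall>g. Vector_Spaces.linear form_scale form_scale g \<and> bij_betw g \<Phi> \<Phi> \<and>
          (\<lambda>l. g ` l) ` degenerate_elements \<Phi> = degenerate_elements \<Phi>
        \<longrightarrow> (\<forall>l\<in>elements \<Phi>. g ` l = l))"

definition pullback :: "(complex ^ 'j \<Rightarrow> complex ^ 'k) \<Rightarrow> 'k form set \<Rightarrow> 'j form set" where
  "pullback g \<Phi> = (\<lambda>\<phi>. \<phi> \<circ> g) ` \<Phi>"

definition good_pair :: "'k::finite form set \<Rightarrow> 'k form \<Rightarrow> 'k form \<Rightarrow> bool" where
  "good_pair \<Phi> \<phi>1 \<phi>2 \<longleftrightarrow>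
     nondegenerate \<phi>1 \<and> nondegenerate \<phi>2 \<and> \<phi>1 \<noteq> \<phi>2 \<and> form.independent {\<phi>1, \<phi>2} \<and>
     form.span {\<phi>1, \<phi>2} = \<Phi>"

definition poised :: "'k::finite form set \<Rightarrow> (complex ^ 'k) set \<Rightarrow> bool" where
  "poised \<Phi> P \<longleftrightarrow> vec.subspace P \<and> vec.dim P = 3 \<and>
     (\<exists>\<phi>1 \<phi>2 w \<alpha> A u.
        good_pair \<Phi> \<phi>1 \<phi>2 \<and> is_basis w \<and> inj \<alpha> \<and>
        (\<forall>z. \<phi>1 (combination w z) = (\<Sum>i\<in>UNIV. \<alpha> i * (z $ i)\<^sup>2)) \<and>
        (\<forall>z. \<phi>2 (combination w z) = (\<Sum>i\<in>UNIV. (z $ i)\<^sup>2)) \<and>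
        (\<forall>z. A (combination w z) = combination w (\<chi> i. \<alpha> i * z $ i)) \<and>
        (\<forall>i. u $ i \<noteq> 0) \<and>
        P = vec.span {combination w u, A (combination w u), A (A (combination w u))})"


section \<open>The moduli space of nonsingular pencils\<close>

text \<open>Scalar maps fix every pencil, so the orbits of the projective linear group are those of
  the general linear group.\<close>

definition orbit :: "'n::finite form set \<Rightarrow> 'n form set set" where
  "orbit \<Phi> = {pullback g \<Phi> | g. Vector_Spaces.linear (*s) (*s) g \<and> bij g}"

definition moduli_PQ :: "'n::finite form set set set" where
  "moduli_PQ = {orbit \<Phi> | \<Phi>. nonsingular_pencil \<Phi>}"

text \<open>Nonsingular pencils are stable, so the open part \<^term>\<open>moduli_PQ\<close> of the GIT quotient is
  a geometric quotient: a set of orbits is open iff the set of pencils in these orbits is open,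
  and the regular functions on it are the invariant regular functions upstairs.
  The Grassmannian of pencils is in turn the quotient, by change of basis, of the Zariski open
  set of linearly independent pairs of quadratic forms. Hence open sets and regular functions
  are described below on pairs of quadratic forms spanning a pencil. The polynomial functions
  on pairs are generated by the matrix entries of the two symmetric bilinear forms.\<close>

inductive polynomial_on_pairs :: "('n::finite form \<times> 'n form \<Rightarrow> complex) \<Rightarrow> bool" where
  const: "polynomial_on_pairs (\<lambda>_. c)"
| entry_fst: "polynomial_on_pairs (\<lambda>q. polar (fst q) (axis i 1) (axis j 1))"
| entry_snd: "polynomial_on_pairs (\<lambda>q. polar (snd q) (axis i 1) (axis j 1))"
| add: "polynomial_on_pairs f \<Longrightarrow> polynomial_on_pairs g \<Longrightarrow> polynomial_on_pairs (\<lambda>q. f q + g q)"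
| mult: "polynomial_on_pairs f \<Longrightarrow> polynomial_on_pairs g \<Longrightarrow> polynomial_on_pairs (\<lambda>q. f q * g q)"

definition quadratic_pairs :: "('n::finite form \<times> 'n form) set" where
  "quadratic_pairs = {(\<phi>, \<psi>). quadratic_form \<phi> \<and> quadratic_form \<psi>}"

definition zariski_open_pairs :: "('n::finite form \<times> 'n form) set \<Rightarrow> bool" where
  "zariski_open_pairs S \<longleftrightarrow> S \<subseteq> quadratic_pairs \<and>
     (\<forall>p\<in>S. \<exists>h. polynomial_on_pairs h \<and> h p \<noteq> 0 \<and> {q \<in> quadratic_pairs. h q \<noteq> 0} \<subseteq> S)"

definition class_of_pair :: "'n::finite form \<times> 'n form \<Rightarrow> 'n form set set" where
  "class_of_pair q = orbit (form.span {fst q, snd q})"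

definition pairs_over :: "'n::finite form set set set \<Rightarrow> ('n form \<times> 'n form) set" where
  "pairs_over U = {q. nonsingular_pencil (form.span {fst q, snd q}) \<and> class_of_pair q \<in> U}"

definition moduli_open :: "'n::finite form set set set \<Rightarrow> bool" where
  "moduli_open U \<longleftrightarrow> U \<subseteq> moduli_PQ \<and> zariski_open_pairs (pairs_over U)"

definition regular_on :: "'n::finite form set set set \<Rightarrow> ('n form set set \<Rightarrow> complex) \<Rightarrow> bool" where
  "regular_on U F \<longleftrightarrow>
     (\<forall>p\<in>pairs_over U. \<exists>f h. polynomial_on_pairs f \<and> polynomial_on_pairs h \<and> h p \<noteq> 0 \<and>
        (\<forall>q\<in>pairs_over U. h q \<noteq> 0 \<longrightarrow> F (class_of_pair q) = f q / h q))"

text \<open>Representatives of the germs in the local ring at the point \<open>m\<close>.\<close>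

definition regular_germs :: "'n::finite form set set \<Rightarrow> ('n form set set \<Rightarrow> complex) set" where
  "regular_germs m = {F. \<exists>U. moduli_open U \<and> m \<in> U \<and> regular_on U F}"


section \<open>Intersections of two quadrics and their second fundamental forms\<close>

text \<open>With \<^typ>\<open>'n\<close> an index type of cardinality \<open>n\<close>, the sum type \<^typ>\<open>'n + 3\<close> has
  cardinality \<open>n + 3\<close>, so \<open>V\<close> is \<^typ>\<open>complex ^ ('n + 3)\<close>. Points of the projective space
  \<open>P(V)\<close> are the lines in \<open>V\<close>.\<close>

type_synonym 'k point = "(complex ^ 'k) set"

definition zero_locus :: "'k::finite form \<Rightarrow> 'k form \<Rightarrow> 'k point set" where
  "zero_locus q1 q2 = {vec.span {z} | z. z \<noteq> 0 \<and> q1 z = 0 \<and> q2 z = 0}"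

text \<open>Nonsingularity is the Jacobian criterion: the differential of \<open>q\<close> at \<open>z\<close> is
  \<open>2 * polar q z\<close>.\<close>

definition nonsingular_intersection :: "'k::finite point set \<Rightarrow> bool" where
  "nonsingular_intersection X \<longleftrightarrow>
     (\<exists>q1 q2. quadratic_form q1 \<and> quadratic_form q2 \<and> X = zero_locus q1 q2 \<and>
        (\<forall>z. z \<noteq> 0 \<and> q1 z = 0 \<and> q2 z = 0 \<longrightarrow>
           (\<forall>a b. (\<forall>v. a * polar q1 z v + b * polar q2 z v = 0) \<longrightarrow> a = 0 \<and> b = 0)))"

definition forms_vanishing :: "'k::finite point set \<Rightarrow> 'k form set" where
  "forms_vanishing X = {\<phi>. quadratic_form \<phi> \<and> (\<forall>p\<in>X. \<forall>z\<in>p. \<phi> z = 0)}"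

definition diagonalization ::
  "'k::finite point set \<Rightarrow> 'k form \<Rightarrow> 'k form \<Rightarrow> ('k \<Rightarrow> complex ^ 'k) \<Rightarrow> ('k \<Rightarrow> complex) \<Rightarrow> bool" where
  "diagonalization X \<phi>1 \<phi>2 e lam \<longleftrightarrow>
     good_pair (forms_vanishing X) \<phi>1 \<phi>2 \<and> is_basis e \<and> inj lam \<and> (\<forall>i. lam i \<noteq> 0) \<and>
     (\<forall>z. \<phi>1 (combination e z) = (\<Sum>i\<in>UNIV. lam i * (z $ i)\<^sup>2)) \<and>
     (\<forall>z. \<phi>2 (combination e z) = (\<Sum>i\<in>UNIV. (z $ i)\<^sup>2))"

text \<open>Orthogonality for all forms in the pencil is the same as orthogonality for two forms
  spanning it.\<close>

definition orthogonal_space :: "'k::finite point set \<Rightarrow> 'k point \<Rightarrow> (complex ^ 'k) set" where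
  "orthogonal_space X p = {v. \<forall>\<phi>\<in>forms_vanishing X. \<forall>a\<in>p. polar \<phi> a v = 0}"

definition complement_in :: "(complex ^ 'k::finite) set \<Rightarrow> (complex ^ 'k) set \<Rightarrow> (complex ^ 'k) set \<Rightarrow> bool"
  where "complement_in T p W \<longleftrightarrow>
    vec.subspace W \<and> W \<inter> p = {0} \<and> {w + a | w a. w \<in> W \<and> a \<in> p} = T"

text \<open>A complement of the line \<open>p\<close> in its orthogonal space, together with linear coordinates
  on it; in these coordinates the second fundamental form is a pencil on \<^typ>\<open>complex ^ 'n\<close>.\<close>

definition tangent_frame ::
  "('n::finite + 3) point set \<Rightarrow> ('n + 3) point \<Rightarrow> (complex ^ 'n \<Rightarrow> complex ^ ('n + 3)) \<Rightarrow> bool" where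
  "tangent_frame X p \<iota> \<longleftrightarrow> Vector_Spaces.linear (*s) (*s) \<iota> \<and> inj \<iota> \<and>
     complement_in (orthogonal_space X p) p (range \<iota>)"

definition second_fundamental_form ::
  "('n::finite + 3) point set \<Rightarrow> (complex ^ 'n \<Rightarrow> complex ^ ('n + 3)) \<Rightarrow> 'n form set" where
  "second_fundamental_form X \<iota> = pullback \<iota> (forms_vanishing X)"

text \<open>The line \<open>p\<close> is contained in the kernel of every form of the pencil restricted to the
  orthogonal space of \<open>p\<close>. So the orbit below does not depend on the frame, nor do the
  conditions defining \<open>X_open\<close> and \<open>X_reg\<close>.\<close>

definition moduli_map :: "('n::finite + 3) point set \<Rightarrow> ('n + 3) point \<Rightarrow> 'n form set set" where
  "moduli_map X p = orbit (second_fundamental_form X (SOME \<iota>. tangent_frame X p \<iota>))"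

definition X_open :: "('n::finite + 3) point set \<Rightarrow> ('n + 3) point set" where
  "X_open X = {p \<in> X. \<exists>\<iota>. tangent_frame X p \<iota> \<and> nonsingular_pencil (second_fundamental_form X \<iota>)}"

definition X_reg :: "('n::finite + 3) point set \<Rightarrow> ('n + 3) form \<Rightarrow> ('n + 3) form \<Rightarrow>
    ('n + 3 \<Rightarrow> complex ^ ('n + 3)) \<Rightarrow> ('n + 3) point set" where
  "X_reg X \<phi>1 \<phi>2 e = {p \<in> X.
     (\<exists>z. p = vec.span {combination e z} \<and> (\<forall>i. z $ i \<noteq> 0)) \<and>
     (\<exists>\<iota>. tangent_frame X p \<iota> \<and>
        nonsingular_pencil (second_fundamental_form X \<iota>) \<and>
        only_trivial_automorphism (second_fundamental_form X \<iota>) \<and>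
        nondegenerate (\<phi>1 \<circ> \<iota>) \<and> nondegenerate (\<phi>2 \<circ> \<iota>))}"


section \<open>The differential of the moduli map\<close>

text \<open>Once a vector \<open>x\<close> spanning the point is fixed, a vector \<open>v\<close> of a complement of the line
  of \<open>x\<close> in its orthogonal space represents the velocity of the curves \<open>[x + t v + \<dots>]\<close> on the
  variety.\<close>

definition tangent_curve :: "('n::finite + 3) point set \<Rightarrow> complex ^ ('n + 3) \<Rightarrow> complex ^ ('n + 3) \<Rightarrow>
    (complex \<Rightarrow> complex ^ ('n + 3)) \<Rightarrow> bool" where
  "tangent_curve X x v \<gamma> \<longleftrightarrow> \<gamma> 0 = x \<and>
     (\<exists>r>0. (\<forall>t\<in>ball 0 r. vec.span {\<gamma> t} \<in> X_open X) \<and>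
            (\<forall>i. (\<lambda>t. \<gamma> t $ i) holomorphic_on ball 0 r)) \<and>
     (\<forall>i. ((\<lambda>t. \<gamma> t $ i) has_field_derivative v $ i) (at 0))"

text \<open>Tangent vectors of the moduli space are derivations of the local ring. The relation below
  says that the differential of the moduli map sends \<open>v\<close> to the derivation \<open>D\<close>.\<close>

definition has_moduli_differential :: "('n::finite + 3) point set \<Rightarrow> complex ^ ('n + 3) \<Rightarrow>
    complex ^ ('n + 3) \<Rightarrow> (('n form set set \<Rightarrow> complex) \<Rightarrow> complex) \<Rightarrow> bool" where
  "has_moduli_differential X x v D \<longleftrightarrow>
     (\<forall>F\<in>regular_germs (moduli_map X (vec.span {x})). \<forall>\<gamma>. tangent_curve X x v \<gamma> \<longrightarrow>
        ((\<lambda>t. F (moduli_map X (vec.span {\<gamma> t}))) has_field_derivative D F) (at 0))"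

definition ker_moduli_differential ::
  "('n::finite + 3) point set \<Rightarrow> complex ^ ('n + 3) \<Rightarrow> (complex ^ ('n + 3)) set \<Rightarrow> (complex ^ ('n + 3)) set"
  where "ker_moduli_differential X x W = {v \<in> W. has_moduli_differential X x v (\<lambda>_. 0)}"

end

theory Submission
  imports Defs "HOL-Computational_Algebra.Fundamental_Theorem_Algebra"
begin

text \<open>Take coordinates that diagonalise the two quadrics, and let the point have coordinates \<open>z\<^sub>i\<close>, all
nonzero. The form \<open>\<phi>\<^sub>1 - s \<phi>\<^sub>2\<close> degenerates on the orthogonal space modulo the point exactly when \<open>s\<close> is
a zero of the secular function \<open>\<Sum> z\<^sub>i\<^sup>2 / (\<lambda>\<^sub>i - s)\<close>, and its kernel is then spanned by the vector with
coordinates \<open>z\<^sub>i / (\<lambda>\<^sub>i - s)\<close> (\<open>secular_roots_of_nonsingular\<close>). The \<open>n\<close> zeros \<open>s\<^sub>k\<close> thus give \<open>n\<close> vectors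
\<open>w\<^sub>k\<close>, which are orthogonal for both forms. After normalisation they turn the second fundamental form
into the pencil of \<open>\<Sum> s\<^sub>k c\<^sub>k\<^sup>2\<close> and \<open>\<Sum> c\<^sub>k\<^sup>2\<close>, so that the moduli point is the unordered set of the
\<open>s\<^sub>k\<close> up to Moebius transformations.

Differentiating the secular equation along a curve with velocity \<open>\<Sum> d\<^sub>k w\<^sub>k\<close> (modulo the point) gives
the velocity \<open>- 2 d\<^sub>k\<close> for \<open>s\<^sub>k\<close> (\<open>secular_roots_curve\<close>). The infinitesimal Moebius transformations are
the fields \<open>a + b s + c s\<^sup>2\<close>. Hence the kernel should consist of the vectors with
\<open>d\<^sub>k = a + b s\<^sub>k + c s\<^sub>k\<^sup>2\<close>. These are spanned by \<open>u\<close>, \<open>\<alpha> u\<close> and \<open>\<alpha>\<^sup>2 u\<close>, where \<open>u = \<Sum> w\<^sub>k\<close> and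
\<open>\<alpha> w\<^sub>k = s\<^sub>k w\<^sub>k\<close>. The coordinates of \<open>u\<close> in the normalised basis are the square roots of the values
\<open>\<phi>\<^sub>2 w\<^sub>k\<close>, which are nonzero, and this is what poised means.

It remains to compare derivations of the local ring with Moebius fields (\<open>moduli_differential_zero_iff\<close>).
A regular germ pulls back to a rational function of the roots that is constant along Moebius
transformations, so its derivative along a Moebius field vanishes (\<open>regular_germ_derivative_moebius\<close>).
Conversely, a velocity that is not a Moebius field changes some cross ratio to first order. As no
nontrivial permutation of the roots is induced by a Moebius transformation, cross ratios also tell the
roots from their nontrivial permutations. A product of the given cross ratio, made zero at the point,
with squares of functions that vanish at these permutations can therefore be summed over all
permutations without changing its derivative up to a nonzero factor
(\<open>regular_function_detecting_velocity\<close>). The sum is a symmetric rational function of the roots. By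
Newton's identities it is a rational function of the coefficients of \<open>det (\<psi>\<^sub>1 - s \<psi>\<^sub>2)\<close>, hence a regular
function on the moduli space (\<open>symmetric_invariant_regular\<close>).\<close>

section \<open>Quadratic forms and their Gram matrices\<close>

abbreviation clinear :: "(complex ^ 'a \<Rightarrow> complex ^ 'b) \<Rightarrow> bool" where
  "clinear f \<equiv> Vector_Spaces.linear (*s) (*s) f"

lemma clinear_iff:
  "clinear f \<longleftrightarrow> (\<forall>u v. f (u + v) = f u + f v) \<and> (\<forall>c u. f (c *s u) = c *s f u)"
  by (auto simp: Vector_Spaces.linear_iff vec.vector_space_axioms)

lemma clinear_add: "clinear f \<Longrightarrow> f (u + v) = f u + f v"
  and clinear_scale: "clinear f \<Longrightarrow> f (c *s u) = c *s f u"
  by (simp_all add: clinear_iff)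

lemma clinear_zero: "clinear f \<Longrightarrow> f 0 = 0"
  using clinear_scale[of f 0 0] by simp

lemma clinear_diff: "clinear f \<Longrightarrow> f (u - v) = f u - f v"
  by (metis clinear_add add_diff_cancel_right' diff_add_cancel)

lemma clinear_sum: "clinear f \<Longrightarrow> f (\<Sum>i\<in>A. g i) = (\<Sum>i\<in>A. f (g i))"
  by (induction A rule: infinite_finite_induct) (auto simp: clinear_zero clinear_add)

lemma clinear_compose: "clinear f \<Longrightarrow> clinear g \<Longrightarrow> clinear (g \<circ> f)"
  by (simp add: clinear_iff)

lemma clinear_inv: "clinear f \<Longrightarrow> bij f \<Longrightarrow> clinear (inv f)"
  by (smt (verit) clinear_iff bij_inv_eq_iff)

lemma form_scale_apply [simp]: "form_scale c \<phi> z = c * \<phi> z"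
  by (simp add: form_scale_def)

lemma form_span_pair:
  "form.span {\<phi>, \<psi>} = {form_scale a \<phi> + form_scale b \<psi> | a b. True}"
  by (auto simp: form.span_insert form.span_singleton fun_eq_iff) 
    (metis add_diff_cancel_left' diff_add_cancel eq_diff_eq)+

lemma form_span_single: "form.span {\<phi>} = {form_scale a \<phi> | a. True}"
  by (auto simp: form.span_singleton)

lemma polar_plus: "polar (\<phi> + \<psi>) u v = polar \<phi> u v + polar \<psi> u v"
  by (simp add: polar_def field_simps)

lemma polar_scale: "polar (form_scale c \<phi>) u v = c * polar \<phi> u v"
  by (simp add: polar_def field_simps)

lemma polar_minus: "polar (\<phi> - \<psi>) u v = polar \<phi> u v - polar \<psi> u v"
  by (simp add: polar_def field_simps)

lemma polar_compose: "clinear g \<Longrightarrow> polar (\<phi> \<circ> g) u v = polar \<phi> (g u) (g v)"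
  by (simp add: polar_def clinear_add)

lemma polar_commute: "polar \<phi> u v = polar \<phi> v u"
  by (simp add: polar_def add.commute)

text \<open>Symmetrising the coefficients gives the polar form and the quadratic form the same matrix.\<close>

lemma quadratic_polar:
  assumes "quadratic_form \<phi>"
  obtains a where "\<And>u v. polar \<phi> u v = (\<Sum>i\<in>UNIV. \<Sum>j\<in>UNIV. a i j * u $ i * v $ j)"
    and "\<And>z. \<phi> z = (\<Sum>i\<in>UNIV. \<Sum>j\<in>UNIV. a i j * z $ i * z $ j)"
proof -
  obtain a where a: "\<And>z. \<phi> z = (\<Sum>i\<in>UNIV. \<Sum>j\<in>UNIV. a i j * z $ i * z $ j)"
    using assms by (auto simp: quadratic_form_def)
  have sw: "(\<Sum>i\<in>UNIV. \<Sum>j\<in>UNIV. a i j * v $ i * u $ j) = (\<Sum>i\<in>UNIV. \<Sum>j\<in>UNIV. a j i * u $ i * v $ j)" for u v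
    by (subst sum.swap) (simp add: mult_ac)
  show ?thesis
  proof (rule that[of "\<lambda>i j. (a i j + a j i) / 2"])
    show "polar \<phi> u v = (\<Sum>i\<in>UNIV. \<Sum>j\<in>UNIV. (a i j + a j i) / 2 * u $ i * v $ j)" for u v
    proof -
      have "2 * polar \<phi> u v = (\<Sum>i\<in>UNIV. \<Sum>j\<in>UNIV. a i j * u $ i * v $ j) + (\<Sum>i\<in>UNIV. \<Sum>j\<in>UNIV. a i j * v $ i * u $ j)"
        by (simp add: polar_def a algebra_simps sum.distrib)
      also have "\<dots> = (\<Sum>i\<in>UNIV. \<Sum>j\<in>UNIV. (a i j + a j i) * u $ i * v $ j)"
        unfolding sw[where u=u and v=v] by (simp add: sum.distrib algebra_simps)
      also have "\<dots> = 2 * (\<Sum>i\<in>UNIV. \<Sum>j\<in>UNIV. (a i j + a j i) / 2 * u $ i * v $ j)"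
        by (simp add: sum_distrib_left)
      finally show ?thesis by simp
    qed
    show "\<phi> z = (\<Sum>i\<in>UNIV. \<Sum>j\<in>UNIV. (a i j + a j i) / 2 * z $ i * z $ j)" for z
    proof -
      have "2 * \<phi> z = (\<Sum>i\<in>UNIV. \<Sum>j\<in>UNIV. a i j * z $ i * z $ j) + (\<Sum>i\<in>UNIV. \<Sum>j\<in>UNIV. a i j * z $ i * z $ j)"
        by (simp add: a)
      also have "\<dots> = (\<Sum>i\<in>UNIV. \<Sum>j\<in>UNIV. (a i j + a j i) * z $ i * z $ j)"
        by (subst (2) sw) (simp add: sum.distrib algebra_simps)
      also have "\<dots> = 2 * (\<Sum>i\<in>UNIV. \<Sum>j\<in>UNIV. (a i j + a j i) / 2 * z $ i * z $ j)"
        by (simp add: sum_distrib_left)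
      finally show ?thesis by simp
    qed
  qed
qed

context
  fixes \<phi> :: "'k::finite form"
  assumes quad: "quadratic_form \<phi>"
begin

lemma polar_add_left: "polar \<phi> (u + u') v = polar \<phi> u v + polar \<phi> u' v"
  using quad by (rule quadratic_polar) (simp add: algebra_simps sum.distrib)

lemma polar_scale_left: "polar \<phi> (c *s u) v = c * polar \<phi> u v"
  using quad by (rule quadratic_polar) (simp add: algebra_simps sum_distrib_left)

lemma polar_add_right: "polar \<phi> v (u + u') = polar \<phi> v u + polar \<phi> v u'"
  by (simp add: polar_commute[of _ v] polar_add_left)

lemma polar_scale_right: "polar \<phi> v (c *s u) = c * polar \<phi> v u"
  by (simp add: polar_commute[of _ v] polar_scale_left)

lemma polar_zero_left: "polar \<phi> 0 v = 0"
  using polar_scale_left[of 0 0 v] by simp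

lemma polar_sum_left: "polar \<phi> (\<Sum>i\<in>A. g i) v = (\<Sum>i\<in>A. polar \<phi> (g i) v)"
  by (induction A rule: infinite_finite_induct) (auto simp: polar_zero_left polar_add_left)

lemma polar_sum_right: "polar \<phi> v (\<Sum>i\<in>A. g i) = (\<Sum>i\<in>A. polar \<phi> v (g i))"
  by (simp add: polar_commute[of _ v] polar_sum_left)

lemma polar_self: "polar \<phi> u u = \<phi> u"
  using quad by (rule quadratic_polar) simp

end

definition gram :: "'k::finite form \<Rightarrow> complex ^ 'k ^ 'k" where
  "gram \<phi> = (\<chi> i j. polar \<phi> (axis i 1) (axis j 1))"

lemma vec_axis_expansion: "(u :: complex ^ 'k::finite) = (\<Sum>i\<in>UNIV. u $ i *s axis i 1)"
  by (simp add: vec_eq_iff axis_def if_distrib cong: if_cong)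

lemma polar_gram:
  assumes "quadratic_form \<phi>"
  shows "polar \<phi> u v = (\<Sum>i\<in>UNIV. u $ i * (gram \<phi> *v v) $ i)"
proof -
  have "polar \<phi> u v = polar \<phi> (\<Sum>i\<in>UNIV. u $ i *s axis i 1) (\<Sum>j\<in>UNIV. v $ j *s axis j 1)"
    by (simp only: vec_axis_expansion[symmetric])
  also have "\<dots> = (\<Sum>i\<in>UNIV. u $ i * (\<Sum>j\<in>UNIV. polar \<phi> (axis i 1) (axis j 1) * v $ j))"
    unfolding polar_sum_left[OF assms] unfolding polar_sum_right[OF assms]
    using assms by (simp add: polar_scale_left polar_scale_right sum_distrib_left mult_ac)
  finally show ?thesis by (simp add: gram_def matrix_vector_mult_def)
qed

lemma nondegenerate_iff_det:
  assumes "quadratic_form \<phi>"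
  shows "nondegenerate \<phi> \<longleftrightarrow> det (gram \<phi>) \<noteq> 0"
proof -
  have "(\<forall>v. polar \<phi> u v = 0) \<longleftrightarrow> gram \<phi> *v u = 0" for u
  proof
    assume *: "\<forall>v. polar \<phi> u v = 0"
    have "(gram \<phi> *v u) $ i = 0" for i
    proof -
      have "(gram \<phi> *v u) $ i = polar \<phi> (axis i 1) u"
        unfolding polar_gram[OF assms] by (simp add: axis_def if_distrib if_distribR cong: if_cong)
      then show ?thesis using * by (simp add: polar_commute[of _ _ u])
    qed
    then show "gram \<phi> *v u = 0" by (simp add: vec_eq_iff)
  qed (simp add: polar_commute[of _ u] polar_gram[OF assms])
  then have "nondegenerate \<phi> \<longleftrightarrow> (\<forall>u. gram \<phi> *v u = 0 \<longrightarrow> u = 0)"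
    by (simp add: nondegenerate_def)
  then show ?thesis
    by (metis matrix_left_invertible_ker invertible_det_nz invertible_left_inverse)
qed

lemma quadratic_form_sum_scale:
  assumes "quadratic_form \<phi>" "quadratic_form \<psi>"
  shows "quadratic_form (form_scale a \<phi> + form_scale b \<psi>)"
proof -
  obtain p q where "\<And>z. \<phi> z = (\<Sum>i\<in>UNIV. \<Sum>j\<in>UNIV. p i j * z $ i * z $ j)"
    "\<And>z. \<psi> z = (\<Sum>i\<in>UNIV. \<Sum>j\<in>UNIV. q i j * z $ i * z $ j)"
    using assms unfolding quadratic_form_def by blast
  then show ?thesis unfolding quadratic_form_def
    by (intro exI[of _ "\<lambda>i j. a * p i j + b * q i j"])
      (simp add: sum_distrib_left sum.distrib[symmetric] algebra_simps)
qed

lemma quadratic_form_diag: "quadratic_form (\<lambda>z. \<Sum>i\<in>UNIV. c i * (z $ i)\<^sup>2)"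
  unfolding quadratic_form_def
  by (intro exI[of _ "\<lambda>i j. if i = j then c i else 0"])
    (simp add: if_distrib power2_eq_square mult.assoc if_distribR cong: if_cong)

lemma quadratic_form_compose:
  fixes g :: "complex ^ 'j::finite \<Rightarrow> complex ^ 'k::finite"
  assumes q: "quadratic_form \<phi>" and g: "clinear g"
  shows "quadratic_form (\<phi> \<circ> g)"
proof -
  have "(\<phi> \<circ> g) z = (\<Sum>i\<in>UNIV. \<Sum>j\<in>UNIV. polar \<phi> (g (axis i 1)) (g (axis j 1)) * z $ i * z $ j)" for z
  proof -
    have "(\<phi> \<circ> g) z = polar \<phi> (g z) (g z)" using q by (simp add: polar_self)
    also have "g z = (\<Sum>i\<in>UNIV. z $ i *s g (axis i 1))"
      using g by (subst vec_axis_expansion) (simp add: clinear_sum clinear_scale)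
    finally show ?thesis
      unfolding polar_sum_left[OF q] unfolding polar_sum_right[OF q] using q
      by (simp add: polar_scale_left polar_scale_right sum_distrib_left mult_ac)
  qed
  then show ?thesis unfolding quadratic_form_def
    by (intro exI[of _ "\<lambda>i j. polar \<phi> (g (axis i 1)) (g (axis j 1))"]) blast
qed

lemma nondegenerate_compose:
  assumes "nondegenerate \<phi>" "clinear g" "bij g"
  shows "nondegenerate (\<phi> \<circ> g)"
proof -
  have "u = 0" if "\<forall>v. polar (\<phi> \<circ> g) u v = 0" for u
  proof -
    have "polar \<phi> (g u) v = 0" for v
      using that assms by (metis polar_compose bij_inv_eq_iff)
    then have "g u = 0" using assms(1) by (simp add: nondegenerate_def)
    then show ?thesis using assms by (metis clinear_zero bij_is_inj injD)
  qed
  then show ?thesis by (simp add: nondegenerate_def)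
qed

lemma nondegenerate_scale: "c \<noteq> 0 \<Longrightarrow> nondegenerate (form_scale c \<phi>) \<longleftrightarrow> nondegenerate \<phi>"
  by (simp add: nondegenerate_def polar_scale)

lemma gram_combination: "gram (\<psi>1 - form_scale s \<psi>2) $ i $ j = gram \<psi>1 $ i $ j - s * gram \<psi>2 $ i $ j"
  by (simp add: gram_def polar_minus polar_scale)

section \<open>Pencils and their roots\<close>

text \<open>The determinant is taken over the polynomial ring, so that the coefficients of the characteristic
polynomial are visibly polynomials in the entries of the two Gram matrices.\<close>

definition pencil_poly :: "'k::finite form \<Rightarrow> 'k form \<Rightarrow> complex poly" where
  "pencil_poly \<psi>1 \<psi>2 = det (\<chi> i j. [:gram \<psi>1 $ i $ j, - gram \<psi>2 $ i $ j:])"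

lemma poly_pencil_poly: "poly (pencil_poly \<psi>1 \<psi>2) s = det (gram (\<psi>1 - form_scale s \<psi>2))"
  by (simp add: pencil_poly_def det_def poly_sum poly_prod gram_combination)

lemma prod_linear_poly:
  assumes "finite A"
  shows "degree (\<Prod>i\<in>A. [:a i, b i:]) \<le> card A \<and> coeff (\<Prod>i\<in>A. [:a i, b i:]) (card A) = (\<Prod>i\<in>A. b i)"
  using assms
proof (induction A)
  case (insert x A)
  let ?p = "\<Prod>i\<in>A. [:a i, b i:]"
  have 1: "coeff ([:a x, b x:] * ?p) (1 + card A) = b x * coeff ?p (card A)"
    using insert by (simp add: mult.commute coeff_eq_0)
  have 2: "degree ([:a x, b x:] * ?p) \<le> 1 + card A"
    by (rule order.trans[OF degree_mult_le add_mono]) (use insert in auto)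
  show ?case using 1 2 insert by (simp del: mult_pCons_left)
qed auto

lemma degree_pencil_poly: "degree (pencil_poly \<psi>1 (\<psi>2 :: 'k::finite form)) \<le> CARD('k)"
  unfolding pencil_poly_def det_def
proof (intro degree_sum_le finite_permutations finite)
  fix p :: "'k \<Rightarrow> 'k"
  let ?q = "\<Prod>i\<in>UNIV. (\<chi> i j. [:gram \<psi>1 $ i $ j, - gram \<psi>2 $ i $ j:]) $ i $ p i"
  have "degree (of_int (sign p) * ?q) \<le> degree ?q"
    by (cases "sign p" rule: int_cases) (simp_all add: sign_def split: if_splits)
  also have "\<dots> \<le> CARD('k)" using prod_linear_poly[of UNIV "\<lambda>i. gram \<psi>1 $ i $ p i"] by simp
  finally show "degree (of_int (sign p) * ?q) \<le> CARD('k)" .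
qed

lemma coeff_pencil_poly:
  "coeff (pencil_poly \<psi>1 (\<psi>2 :: 'k::finite form)) CARD('k) = (-1) ^ CARD('k) * det (gram \<psi>2)"
proof -
  have "coeff (of_int (sign p) * (\<Prod>i\<in>UNIV. [:gram \<psi>1 $ i $ p i, - gram \<psi>2 $ i $ p i:])) CARD('k)
     = (-1) ^ CARD('k) * (of_int (sign p) * (\<Prod>i\<in>UNIV. gram \<psi>2 $ i $ p i))" for p :: "'k \<Rightarrow> 'k"
    using prod_linear_poly[of UNIV "\<lambda>i. gram \<psi>1 $ i $ p i" "\<lambda>i. - gram \<psi>2 $ i $ p i"]
    by (simp add: sign_def prod_uminus)
  then show ?thesis
    by (simp add: pencil_poly_def det_def coeff_sum sum_distrib_left)
qed

lemma solve_linear: "a \<noteq> 0 \<Longrightarrow> a * x + b * y = 0 \<Longrightarrow> x = - b / a * y" for x :: complex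
  by (simp add: field_simps eq_neg_iff_add_eq_0)

definition independent_pair :: "('a \<Rightarrow> complex) \<Rightarrow> ('a \<Rightarrow> complex) \<Rightarrow> bool" where
  "independent_pair \<phi> \<psi> \<longleftrightarrow> (\<forall>a b. form_scale a \<phi> + form_scale b \<psi> = 0 \<longrightarrow> a = 0 \<and> b = 0)"

lemma independent_pair_iff:
  "independent_pair \<phi> \<psi> \<longleftrightarrow> \<phi> \<noteq> \<psi> \<and> form.independent {\<phi>, \<psi>}"
    (is "_ \<longleftrightarrow> ?L")
proof
  assume L: ?L
  show "independent_pair \<phi> \<psi>"
    unfolding independent_pair_def
  proof (intro allI impI)
    fix a b assume *: "form_scale a \<phi> + form_scale b \<psi> = 0"
    from L have psi: "\<psi> \<noteq> 0" and notin: "\<phi> \<notin> form.span {\<psi>}"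
    by (auto simp: form.independent_insert dest: form.dependent_zero)
    have "a = 0"
    proof (rule ccontr)
      assume "a \<noteq> 0"
      have "\<phi> z = form_scale (- b / a) \<psi> z" for z
        using fun_cong[OF *, of z] solve_linear[OF \<open>a \<noteq> 0\<close>] by simp
      then have "\<phi> = form_scale (- b / a) \<psi>" by (rule ext)
      then show False using notin unfolding form_span_single by blast
    qed
    with * psi show "a = 0 \<and> b = 0" by (auto simp: fun_eq_iff)
  qed
next
  assume "independent_pair \<phi> \<psi>"
  note R = this[unfolded independent_pair_def]
  have "\<psi> \<noteq> 0" using R[rule_format, of 0 1] by (auto simp: fun_eq_iff)
  moreover have "\<phi> \<noteq> form_scale c \<psi>" for c
    using R[rule_format, of 1 "- c"] by (auto simp: fun_eq_iff)
  moreover from this[of 1] have "\<phi> \<noteq> \<psi>" by (auto simp: fun_eq_iff)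
  ultimately show ?L
    by (auto simp: form.independent_insert form_span_single form.dependent_single)
qed

lemma independent_pair_of_dim:
  assumes "form.dim (form.span {\<phi>, \<psi>}) = 2"
  shows "independent_pair \<phi> \<psi>"
proof -
  have d: "form.dim {\<phi>, \<psi>} = 2" using assms by (simp add: form.dim_span)
  have ne: "\<phi> \<noteq> \<psi>"
  proof
    assume "\<phi> = \<psi>"
    then show False using d form.dim_le_card[of "{\<psi>}" "{\<psi>}"] by (simp add: form.span_superset)
  qed
  obtain B where B: "B \<subseteq> {\<phi>, \<psi>}" "form.independent B" "card B = 2"
    using form.basis_exists[of "{\<phi>, \<psi>}"] d by metis
  moreover have "B = {\<phi>, \<psi>}"
    using B ne by (intro card_subset_eq) auto
  ultimately show ?thesis using ne by (simp add: independent_pair_iff)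
qed

lemma span_single_scale:
  assumes "z \<noteq> 0"
  shows "form.span {form_scale z \<phi>} = form.span {\<phi>}"
proof -
  have 1: "form_scale a \<phi> = form_scale (a / z) (form_scale z \<phi>)" for a
    using assms by (auto simp: fun_eq_iff)
  have 2: "form_scale a (form_scale z \<phi>) = form_scale (a * z) \<phi>" for a
    by (auto simp: fun_eq_iff)
  show ?thesis
  proof
    show "form.span {form_scale z \<phi>} \<subseteq> form.span {\<phi>}"
      unfolding form_span_single 2 by blast
    show "form.span {\<phi>} \<subseteq> form.span {form_scale z \<phi>}"
      unfolding form_span_single using 1 by blast
  qed
qed

lemma quadratic_form_difference:
  "quadratic_form \<phi> \<Longrightarrow> quadratic_form \<psi> \<Longrightarrow> quadratic_form (\<phi> - form_scale t \<psi>)"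
  using quadratic_form_sum_scale[of \<phi> \<psi> 1 "- t"]
  by (simp add: plus_fun_def fun_diff_def form_scale_def)

lemma nondegenerate_nonzero: "nondegenerate \<phi> \<Longrightarrow> \<phi> \<noteq> (0 :: 'k::finite form)"
  using axis_eq_0_iff[of "undefined :: 'k" "1 :: complex"]
  by (auto simp: nondegenerate_def polar_def)

lemma nondegenerate_difference_iff:
  assumes "quadratic_form \<psi>1" "quadratic_form \<psi>2"
  shows "nondegenerate (\<psi>1 - form_scale t \<psi>2) \<longleftrightarrow> poly (pencil_poly \<psi>1 \<psi>2) t \<noteq> 0"
  by (simp add: nondegenerate_iff_det quadratic_form_difference assms poly_pencil_poly)

text \<open>The map \<open>s\<close> lists the degenerate elements in the affine chart of the pencil whose point at infinity
is \<open>\<psi>2\<close>.\<close>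

definition has_roots :: "'k::finite form \<Rightarrow> 'k form \<Rightarrow> ('k \<Rightarrow> complex) \<Rightarrow> bool" where
  "has_roots \<psi>1 \<psi>2 s \<longleftrightarrow> quadratic_form \<psi>1 \<and> quadratic_form \<psi>2 \<and> nondegenerate \<psi>2 \<and> inj s \<and>
     (\<forall>k. \<not> nondegenerate (\<psi>1 - form_scale (s k) \<psi>2))"

text \<open>The roots of a pencil depend on the chart, hence are defined only up to a Moebius transformation.\<close>

definition pencil_roots :: "'k::finite form set \<Rightarrow> ('k \<Rightarrow> complex) \<Rightarrow> bool" where
  "pencil_roots \<Phi> s \<longleftrightarrow> (\<exists>\<psi>1 \<psi>2. has_roots \<psi>1 \<psi>2 s \<and> \<Phi> = form.span {\<psi>1, \<psi>2})"

lemma pencil_poly_nonzero: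
  assumes "quadratic_form \<psi>2" "nondegenerate \<psi>2"
  shows "coeff (pencil_poly \<psi>1 (\<psi>2 :: 'k::finite form)) CARD('k) \<noteq> 0" "pencil_poly \<psi>1 \<psi>2 \<noteq> 0"
proof -
  show "coeff (pencil_poly \<psi>1 \<psi>2) CARD('k) \<noteq> 0"
    using assms by (simp add: coeff_pencil_poly nondegenerate_iff_det)
  then show "pencil_poly \<psi>1 \<psi>2 \<noteq> 0" by auto
qed

text \<open>The characteristic polynomial has degree at most the dimension, so the listed roots are all of them.\<close>

lemma degenerate_member_iff:
  assumes "has_roots \<psi>1 (\<psi>2 :: 'k::finite form) s"
  shows "nondegenerate (\<psi>1 - form_scale t \<psi>2) \<longleftrightarrow> t \<notin> range s"
proof -
  let ?Z = "{t. poly (pencil_poly \<psi>1 \<psi>2) t = 0}"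
  have q: "quadratic_form \<psi>1" "quadratic_form \<psi>2" and nd: "nondegenerate \<psi>2" and "inj s"
    using assms by (auto simp: has_roots_def)
  note ne = pencil_poly_nonzero(2)[OF q(2) nd]
  have sub: "range s \<subseteq> ?Z"
    using assms nondegenerate_difference_iff[OF q] by (auto simp: has_roots_def)
  have "card ?Z \<le> CARD('k)"
    using card_poly_roots_bound[OF ne[of \<psi>1]] degree_pencil_poly[of \<psi>1 \<psi>2] by linarith
  also have "CARD('k) = card (range s)" using \<open>inj s\<close> by (simp add: card_image)
  finally have "range s = ?Z"
    using sub poly_roots_finite[OF ne[of \<psi>1]] by (intro card_seteq) auto
  then show ?thesis using nondegenerate_difference_iff[OF q] by auto
qed

lemma has_roots_independent:
  assumes r: "has_roots \<psi>1 (\<psi>2 :: 'k::finite form) s" and n: "CARD('k) \<ge> 2"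
  shows "independent_pair \<psi>1 \<psi>2"
  unfolding independent_pair_def
proof (intro allI impI)
  fix a b assume 0: "form_scale a \<psi>1 + form_scale b \<psi>2 = 0"
  have nd: "nondegenerate \<psi>2" and "inj s" using r by (auto simp: has_roots_def)
  have "a = 0"
  proof (rule ccontr)
    assume a: "a \<noteq> 0"
    have "s k = - b / a" for k
    proof (rule ccontr)
      assume *: "s k \<noteq> - b / a"
      have "\<psi>1 - form_scale (s k) \<psi>2 = form_scale (- b / a - s k) \<psi>2"
        using fun_cong[OF 0] solve_linear[OF a] by (auto simp: fun_eq_iff left_diff_distrib)
      then have "nondegenerate (\<psi>1 - form_scale (s k) \<psi>2)"
        using * nd by (metis nondegenerate_scale right_minus_eq)
      then show False using r by (simp add: has_roots_def)
    qed
    then have "card (range s) \<le> 1" by (metis card_1_singleton_iff le_refl One_nat_def range_constant ext)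
    then show False using n \<open>inj s\<close> by (simp add: card_image)
  qed
  then show "a = 0 \<and> b = 0" using 0 nondegenerate_nonzero[OF nd] by (auto simp: fun_eq_iff)
qed

lemma span_single_difference_eq_iff:
  assumes ind: "independent_pair \<psi>1 \<psi>2"
  shows "form.span {\<psi>1 - form_scale t \<psi>2} = form.span {\<psi>1 - form_scale t' \<psi>2} \<longleftrightarrow> t = t'"
proof
  assume "form.span {\<psi>1 - form_scale t \<psi>2} = form.span {\<psi>1 - form_scale t' \<psi>2}"
  then have "\<psi>1 - form_scale t \<psi>2 \<in> form.span {\<psi>1 - form_scale t' \<psi>2}"
    by (metis form.span_base singletonI)
  then obtain c where c: "\<psi>1 - form_scale t \<psi>2 = form_scale c (\<psi>1 - form_scale t' \<psi>2)"
    by (auto simp: form_span_single)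
  have "form_scale (1 - c) \<psi>1 + form_scale (c * t' - t) \<psi>2 = 0"
    using fun_cong[OF c] by (auto simp: fun_eq_iff algebra_simps)
  then have "1 - c = 0 \<and> c * t' - t = 0" using ind unfolding independent_pair_def by blast
  then show "t = t'" by auto
qed simp

lemma degenerate_elements_span:
  assumes ind: "independent_pair \<psi>1 \<psi>2"
    and nd: "nondegenerate \<psi>2"
  shows "degenerate_elements (form.span {\<psi>1, \<psi>2}) =
    (\<lambda>t. form.span {\<psi>1 - form_scale t \<psi>2}) ` {t. \<not> nondegenerate (\<psi>1 - form_scale t \<psi>2)}"
    (is "?L = ?R")
proof
  show "?L \<subseteq> ?R"
  proof
    fix l assume "l \<in> ?L"
    then obtain a b where l: "l = form.span {form_scale a \<psi>1 + form_scale b \<psi>2}"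
      and ne: "form_scale a \<psi>1 + form_scale b \<psi>2 \<noteq> 0"
      and dg: "\<not> nondegenerate (form_scale a \<psi>1 + form_scale b \<psi>2)"
      by (auto simp: degenerate_elements_def form_span_pair)
    have a: "a \<noteq> 0"
    proof
      assume a: "a = 0"
      then have "form_scale a \<psi>1 + form_scale b \<psi>2 = form_scale b \<psi>2" by (auto simp: fun_eq_iff)
      moreover have "b \<noteq> 0" using ne a by (auto simp: fun_eq_iff)
      ultimately show False using dg nd by (metis nondegenerate_scale)
    qed
    let ?d = "\<psi>1 - form_scale (- b / a) \<psi>2"
    have eq: "form_scale a \<psi>1 + form_scale b \<psi>2 = form_scale a ?d"
      using a by (auto simp: fun_eq_iff field_simps)
    have "\<not> nondegenerate ?d" using dg a by (simp add: eq nondegenerate_scale)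
    moreover have "l = form.span {?d}"
      unfolding l eq using a by (rule span_single_scale)
    ultimately show "l \<in> ?R" by blast
  qed
  show "?R \<subseteq> ?L"
  proof
    fix l assume "l \<in> ?R"
    then obtain t where t: "l = form.span {\<psi>1 - form_scale t \<psi>2}"
      "\<not> nondegenerate (\<psi>1 - form_scale t \<psi>2)" by blast
    have eq: "\<psi>1 - form_scale t \<psi>2 = form_scale 1 \<psi>1 + form_scale (- t) \<psi>2"
      by (auto simp: fun_eq_iff)
    then have "\<psi>1 - form_scale t \<psi>2 \<in> form.span {\<psi>1, \<psi>2}" unfolding form_span_pair by blast
    moreover have "\<psi>1 - form_scale t \<psi>2 \<noteq> 0"
      using ind unfolding eq independent_pair_def by (metis one_neq_zero)
    ultimately show "l \<in> ?L" using t by (auto simp: degenerate_elements_def)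
  qed
qed

lemma degenerate_elements_has_roots:
  assumes r: "has_roots \<psi>1 (\<psi>2 :: 'k::finite form) s" and n: "CARD('k) \<ge> 2"
  shows "degenerate_elements (form.span {\<psi>1, \<psi>2}) =
    range (\<lambda>k. form.span {\<psi>1 - form_scale (s k) \<psi>2})"
proof -
  have "nondegenerate \<psi>2" using r by (simp add: has_roots_def)
  from degenerate_elements_span[OF has_roots_independent[OF r n] this]
  show ?thesis by (simp add: degenerate_member_iff[OF r] image_image)
qed

lemma has_roots_nonsingular:
  assumes r: "has_roots \<psi>1 (\<psi>2 :: 'k::finite form) s" and n: "CARD('k) \<ge> 2"
  shows "nonsingular_pencil (form.span {\<psi>1, \<psi>2})"
proof -
  note ind = has_roots_independent[OF r n]
  have q: "quadratic_form \<psi>1" "quadratic_form \<psi>2" and "inj s"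
    using r by (auto simp: has_roots_def)
  have "inj (\<lambda>k. form.span {\<psi>1 - form_scale (s k) \<psi>2})"
    using span_single_difference_eq_iff[OF ind] \<open>inj s\<close> by (simp add: inj_def)
  then have "card (degenerate_elements (form.span {\<psi>1, \<psi>2})) = CARD('k)"
    using degenerate_elements_has_roots[OF r n] by (simp add: card_image)
  moreover have "form.dim (form.span {\<psi>1, \<psi>2}) = 2"
    using ind by (auto simp: independent_pair_iff form.dim_span form.dim_eq_card_independent)
  moreover have "quadratic_form \<phi>" if "\<phi> \<in> form.span {\<psi>1, \<psi>2}" for \<phi>
    using that q quadratic_form_sum_scale unfolding form_span_pair by blast
  ultimately show ?thesis
    using degenerate_elements_has_roots[OF r n]
    by (simp add: nonsingular_pencil_def pencil_def)
qed

text \<open>In the chart of a nondegenerate form every degenerate element is a finite point. So the count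
of degenerate elements becomes a count of roots.\<close>

lemma nonsingular_has_roots:
  assumes ns: "nonsingular_pencil (form.span {\<psi>1, \<psi>2 :: 'k::finite form})" and nd: "nondegenerate \<psi>2"
  obtains s where "has_roots \<psi>1 \<psi>2 s"
proof -
  let ?Z = "{t. \<not> nondegenerate (\<psi>1 - form_scale t \<psi>2)}"
  have q: "quadratic_form \<psi>1" "quadratic_form \<psi>2"
    using ns by (auto simp: nonsingular_pencil_def pencil_def form.span_base)
  have ind: "independent_pair \<psi>1 \<psi>2"
    using ns independent_pair_of_dim[of \<psi>1 \<psi>2]
    by (auto simp: nonsingular_pencil_def pencil_def)
  have "inj_on (\<lambda>t. form.span {\<psi>1 - form_scale t \<psi>2}) ?Z"
    using span_single_difference_eq_iff[OF ind] by (simp add: inj_on_def)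
  then have "card ?Z = CARD('k)"
    using ns degenerate_elements_span[OF ind nd] by (simp add: nonsingular_pencil_def card_image)
  moreover from this have "finite ?Z" using card.infinite by fastforce
  ultimately obtain s where "bij_betw s (UNIV :: 'k set) ?Z"
    using finite_same_card_bij[of "UNIV :: 'k set" ?Z] by auto
  then have "has_roots \<psi>1 \<psi>2 s" using q nd by (auto simp: has_roots_def bij_betw_def)
  then show ?thesis by (rule that)
qed

section \<open>Orbits\<close>

lemma pullback_span: "pullback g (form.span {\<psi>1, \<psi>2}) = form.span {\<psi>1 \<circ> g, \<psi>2 \<circ> g}"
proof -
  have "(form_scale a \<psi>1 + form_scale b \<psi>2) \<circ> g = form_scale a (\<psi>1 \<circ> g) + form_scale b (\<psi>2 \<circ> g)" for a b
    by (auto simp: fun_eq_iff)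
  then show ?thesis
    unfolding pullback_def form_span_pair by (auto simp: image_iff) metis+
qed

lemma pullback_compose: "pullback g (pullback h \<Phi>) = pullback (h \<circ> g) \<Phi>"
  by (auto simp: pullback_def image_image comp_assoc)

lemma orbit_pullback:
  assumes g: "clinear g" "bij g"
  shows "orbit (pullback g \<Phi>) = orbit \<Phi>"
proof -
  have "pullback h (pullback g \<Phi>) \<in> orbit \<Phi>" if "clinear h" "bij h" for h
    using that g unfolding orbit_def pullback_compose
    by (auto intro!: exI[of _ "g \<circ> h"] clinear_compose bij_comp)
  moreover have "pullback h \<Phi> \<in> orbit (pullback g \<Phi>)" if "clinear h" "bij h" for h
  proof -
    have "h = g \<circ> (inv g \<circ> h)" using g by (auto simp: fun_eq_iff bij_is_surj surj_f_inv_f)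
    then have "pullback h \<Phi> = pullback (inv g \<circ> h) (pullback g \<Phi>)"
      by (metis pullback_compose)
    then show ?thesis using that g unfolding orbit_def
      by (auto intro!: exI[of _ "inv g \<circ> h"] clinear_compose clinear_inv bij_comp bij_imp_bij_inv)
  qed
  ultimately show ?thesis unfolding orbit_def by auto
qed

lemma orbit_refl: "\<Phi> \<in> orbit \<Phi>"
  unfolding orbit_def by (auto intro!: exI[of _ id] simp: pullback_def clinear_iff)

lemma has_roots_compose:
  fixes g :: "complex ^ 'k::finite \<Rightarrow> complex ^ 'k"
  assumes r: "has_roots \<psi>1 \<psi>2 s" and g: "clinear g" "bij g"
  shows "has_roots (\<psi>1 \<circ> g) (\<psi>2 \<circ> g) s"
proof -
  have eq: "(\<psi>1 \<circ> g) - form_scale t (\<psi>2 \<circ> g) = (\<psi>1 - form_scale t \<psi>2) \<circ> g" for t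
    by (auto simp: fun_eq_iff)
  have "\<not> nondegenerate ((\<psi>1 - form_scale (s k) \<psi>2) \<circ> g)" for k
  proof
    assume "nondegenerate ((\<psi>1 - form_scale (s k) \<psi>2) \<circ> g)"
    then have "nondegenerate (((\<psi>1 - form_scale (s k) \<psi>2) \<circ> g) \<circ> inv g)"
      by (rule nondegenerate_compose) (use g in \<open>simp_all add: clinear_inv bij_imp_bij_inv\<close>)
    moreover have "g \<circ> inv g = id" using g bij_is_surj surj_iff by blast
    ultimately show False using r by (simp add: has_roots_def comp_assoc)
  qed
  then show ?thesis
    using r g by (auto simp: has_roots_def eq intro: quadratic_form_compose nondegenerate_compose)
qed

definition moebius_equivalent :: "('k \<Rightarrow> complex) \<Rightarrow> ('k \<Rightarrow> complex) \<Rightarrow> bool" where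
  "moebius_equivalent s s' \<longleftrightarrow> (\<exists>a b c d \<pi>. a * d - b * c \<noteq> 0 \<and> bij \<pi> \<and>
     (\<forall>k. c * s (\<pi> k) + d \<noteq> 0 \<and> s' k = (a * s (\<pi> k) + b) / (c * s (\<pi> k) + d)))"

text \<open>Two charts of the same projective line differ by a Moebius transformation, and the sets of
degenerate elements coincide. The permutation accounts for the two enumerations.\<close>

lemma moebius_equivalent_same_pencil:
  assumes r: "has_roots \<psi>1 (\<psi>2 :: 'k::finite form) s" and r': "has_roots \<chi>1 \<chi>2 s'"
    and sp: "form.span {\<chi>1, \<chi>2} = form.span {\<psi>1, \<psi>2}" and n: "CARD('k) \<ge> 2"
  shows "moebius_equivalent s s'"
proof -
  have "\<chi>1 \<in> form.span {\<psi>1, \<psi>2}" "\<chi>2 \<in> form.span {\<psi>1, \<psi>2}"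
    using sp by (auto intro: form.span_base simp flip: sp)
  then obtain a b c d where chi: "\<chi>1 = form_scale a \<psi>1 + form_scale b \<psi>2"
      "\<chi>2 = form_scale c \<psi>1 + form_scale d \<psi>2"
    unfolding form_span_pair by blast
  have nd: "nondegenerate \<psi>2" "nondegenerate \<chi>2" and "inj s'"
    using r r' by (auto simp: has_roots_def)
  have det: "a * d - b * c \<noteq> 0"
  proof
    assume 0: "a * d - b * c = 0"
    have "form_scale d \<chi>1 + form_scale (- b) \<chi>2 = form_scale (a * d - b * c) \<psi>1"
      "form_scale c \<chi>1 + form_scale (- a) \<chi>2 = form_scale (- (a * d - b * c)) \<psi>2"
      by (auto simp: chi fun_eq_iff algebra_simps)
    then have "form_scale d \<chi>1 + form_scale (- b) \<chi>2 = 0" "form_scale c \<chi>1 + form_scale (- a) \<chi>2 = 0"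
      unfolding 0 by (auto simp: fun_eq_iff)
    then have "d = 0 \<and> - b = 0" "c = 0 \<and> - a = 0"
      using has_roots_independent[OF r' n] unfolding independent_pair_def by blast+
    then have "\<chi>2 = 0" by (simp add: chi fun_eq_iff)
    then show False using nondegenerate_nonzero nd by blast
  qed
  \<comment> \<open>A degenerate form of the second chart, rewritten in the first chart.\<close>
  have key: "\<exists>j. c * s j + d \<noteq> 0 \<and> s' k = (a * s j + b) / (c * s j + d)" for k
  proof -
    have dg: "\<not> nondegenerate (\<chi>1 - form_scale (s' k) \<chi>2)" using r' by (simp add: has_roots_def)
    have eq: "\<chi>1 - form_scale (s' k) \<chi>2 = form_scale (a - s' k * c) \<psi>1 + form_scale (b - s' k * d) \<psi>2"
      by (auto simp: chi fun_eq_iff algebra_simps)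
    have ne: "a - s' k * c \<noteq> 0"
    proof
      assume 0: "a - s' k * c = 0"
      then have "\<chi>1 - form_scale (s' k) \<chi>2 = form_scale (b - s' k * d) \<psi>2"
        unfolding eq by (auto simp: fun_eq_iff)
      then have "b - s' k * d = 0" using dg nd nondegenerate_scale by metis
      then show False using det 0 by (simp add: algebra_simps)
    qed
    let ?t = "- (b - s' k * d) / (a - s' k * c)"
    have "\<chi>1 - form_scale (s' k) \<chi>2 = form_scale (a - s' k * c) (\<psi>1 - form_scale ?t \<psi>2)"
    proof -
      have "(a - s' k * c) * ?t = - (b - s' k * d)" using ne by simp
      then have "(a - s' k * c) * (?t * z) = - ((b - s' k * d) * z)" for z
        by (metis mult.assoc mult_minus_left)
      then show ?thesis
        unfolding eq fun_eq_iff plus_fun_apply minus_apply form_scale_apply right_diff_distrib[of "a - s' k * c"]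
        by simp
    qed
    then have "\<not> nondegenerate (\<psi>1 - form_scale ?t \<psi>2)"
      using dg ne nondegenerate_scale by metis
    then obtain j where j: "s j = ?t" using degenerate_member_iff[OF r] by auto
    then have 1: "s j * (a - s' k * c) = s' k * d - b" using ne by (simp add: field_simps)
    then have 2: "s' k * (c * s j + d) = a * s j + b" by (simp add: algebra_simps)
    have "c * s j + d \<noteq> 0"
    proof
      assume 0: "c * s j + d = 0"
      then have "a * s j + b = 0" using 2 by simp
      then have "c * (a * s j + b) - a * (c * s j + d) = 0" using 0 by simp
      then show False using det by (simp add: algebra_simps)
    qed
    then show ?thesis using 2 by (auto simp: field_simps)
  qed
  then obtain \<pi> where \<pi>: "\<And>k. c * s (\<pi> k) + d \<noteq> 0 \<and> s' k = (a * s (\<pi> k) + b) / (c * s (\<pi> k) + d)"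
    by metis
  have "inj \<pi>"
  proof (rule injI)
    fix k k' assume "\<pi> k = \<pi> k'"
    then have "s' k = s' k'" using \<pi>[of k] \<pi>[of k'] by simp
    then show "k = k'" using \<open>inj s'\<close> by (simp add: inj_eq)
  qed
  then have "bij \<pi>" by (simp add: finite_UNIV_inj_surj bij_def)
  then show ?thesis using det \<pi> unfolding moebius_equivalent_def by blast
qed

lemma moebius_equivalent_same_orbit:
  assumes "pencil_roots \<Phi> (s :: 'k::finite \<Rightarrow> complex)" "pencil_roots \<Phi>' s'" "orbit \<Phi> = orbit \<Phi>'" "CARD('k) \<ge> 2"
  shows "moebius_equivalent s s'"
proof -
  obtain \<psi>1 \<psi>2 \<chi>1 \<chi>2 where r: "has_roots \<psi>1 \<psi>2 s" "\<Phi> = form.span {\<psi>1, \<psi>2}"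
    and r': "has_roots \<chi>1 \<chi>2 s'" "\<Phi>' = form.span {\<chi>1, \<chi>2}"
    using assms by (auto simp: pencil_roots_def)
  have "\<Phi>' \<in> orbit \<Phi>" using assms orbit_refl by blast
  then obtain g where g: "clinear g" "bij g" "\<Phi>' = pullback g \<Phi>" by (auto simp: orbit_def)
  then have "form.span {\<chi>1, \<chi>2} = form.span {\<psi>1 \<circ> g, \<psi>2 \<circ> g}" using r r' pullback_span by metis
  then show ?thesis
    using moebius_equivalent_same_pencil has_roots_compose[OF r(1) g(1,2)] r' assms by blast
qed

lemma linear_image_span_single:
  assumes "Vector_Spaces.linear form_scale form_scale g"
  shows "g ` form.span {\<phi>} = form.span {g \<phi>}"
  using assms by (auto simp: form_span_single Vector_Spaces.linear_iff image_iff) metis+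

text \<open>A Moebius transformation permuting the roots is induced by a linear automorphism of the pencil
which permutes the degenerate elements. The hypothesis makes this automorphism trivial on all
elements, so that it fixes every root.\<close>

lemma only_trivial_automorphism_roots:
  assumes triv: "only_trivial_automorphism (form.span {\<psi>1, \<psi>2 :: 'k::finite form})"
    and r: "has_roots \<psi>1 \<psi>2 s" and n: "CARD('k) \<ge> 2"
    and det: "a * d - b * c \<noteq> 0" and bij: "bij \<pi>"
    and m: "\<And>k. c * s k + d \<noteq> 0 \<and> s (\<pi> k) = (a * s k + b) / (c * s k + d)"
  shows "\<pi> = id"
proof -
  note ind = has_roots_independent[OF r n]
  have ne: "\<psi>1 \<noteq> \<psi>2" and indep: "form.independent {\<psi>1, \<psi>2}"
    using ind by (auto simp: independent_pair_iff)
  interpret pair: vector_space_pair "form_scale :: complex \<Rightarrow> 'k form \<Rightarrow> 'k form" "form_scale :: complex \<Rightarrow> 'k form \<Rightarrow> 'k form" ..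
  \<comment> \<open>The matrix is the one for which \<open>g (\<psi>1 - t \<psi>2)\<close> is proportional to \<open>\<psi>1 - t' \<psi>2\<close> with
  \<open>t' = (a t + b) / (c t + d)\<close>.\<close>
  obtain g where lin: "Vector_Spaces.linear form_scale form_scale g"
    and g: "g \<psi>1 = form_scale d \<psi>1 + form_scale (- b) \<psi>2" "g \<psi>2 = form_scale (- c) \<psi>1 + form_scale a \<psi>2"
    using pair.linear_independent_extend[OF indep, of "\<lambda>\<phi>. if \<phi> = \<psi>1 then form_scale d \<psi>1 + form_scale (- b) \<psi>2
      else form_scale (- c) \<psi>1 + form_scale a \<psi>2"] ne by auto
  have gc: "g (form_scale p \<psi>1 + form_scale q \<psi>2) =
     form_scale (p * d - q * c) \<psi>1 + form_scale (q * a - p * b) \<psi>2" for p q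
    using lin by (simp add: Vector_Spaces.linear_iff g) (auto simp: fun_eq_iff algebra_simps)
  have surj: "\<exists>p' q'. p = p' * d - q' * c \<and> q = q' * a - p' * b" for p q
  proof -
    have "(p * a + q * c) * d - (q * d + p * b) * c = p * (a * d - b * c)"
      "(q * d + p * b) * a - (p * a + q * c) * b = q * (a * d - b * c)" by (simp_all add: algebra_simps)
    then have "p = (p * a + q * c) / (a * d - b * c) * d - (q * d + p * b) / (a * d - b * c) * c \<and>
        q = (q * d + p * b) / (a * d - b * c) * a - (p * a + q * c) / (a * d - b * c) * b"
      using det by (simp flip: diff_divide_distrib)
    then show ?thesis by blast
  qed
  have bijg: "bij_betw g (form.span {\<psi>1, \<psi>2}) (form.span {\<psi>1, \<psi>2})"
  proof (rule bij_betw_imageI)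
    have "u = 0" if u: "u \<in> form.span {\<psi>1, \<psi>2}" "g u = 0" for u
    proof -
      obtain p q where pq: "u = form_scale p \<psi>1 + form_scale q \<psi>2"
        using u unfolding form_span_pair by blast
      then have "p * d - q * c = 0 \<and> q * a - p * b = 0"
        using u ind gc unfolding independent_pair_def by metis
      then have "p * d - q * c = 0" "q * a - p * b = 0" by auto
      then have "a * (p * d - q * c) + c * (q * a - p * b) = 0" "b * (p * d - q * c) + d * (q * a - p * b) = 0"
        by simp_all
      then have "p * (a * d - b * c) = 0" "q * (a * d - b * c) = 0" by (simp_all add: algebra_simps)
      then show ?thesis using det by (simp add: pq fun_eq_iff)
    qed
    then show "inj_on g (form.span {\<psi>1, \<psi>2})"
      using pair.linear_inj_on_iff_eq_0[OF lin form.subspace_span] by blast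
    show "g ` form.span {\<psi>1, \<psi>2} = form.span {\<psi>1, \<psi>2}"
    proof
      show "g ` form.span {\<psi>1, \<psi>2} \<subseteq> form.span {\<psi>1, \<psi>2}"
        unfolding form_span_pair using gc by blast
      show "form.span {\<psi>1, \<psi>2} \<subseteq> g ` form.span {\<psi>1, \<psi>2}"
      proof
        fix u assume "u \<in> form.span {\<psi>1, \<psi>2}"
        then obtain p q where pq: "u = form_scale p \<psi>1 + form_scale q \<psi>2"
          unfolding form_span_pair by blast
        then obtain p' q' where "p = p' * d - q' * c \<and> q = q' * a - p' * b" using surj by blast
        then have "u = g (form_scale p' \<psi>1 + form_scale q' \<psi>2)" using pq gc by simp
        then show "u \<in> g ` form.span {\<psi>1, \<psi>2}" unfolding form_span_pair by blast
      qed
    qed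
  qed
  have img: "g ` form.span {\<psi>1 - form_scale (s k) \<psi>2} = form.span {\<psi>1 - form_scale (s (\<pi> k)) \<psi>2}" for k
  proof -
    have "\<psi>1 - form_scale (s k) \<psi>2 = form_scale 1 \<psi>1 + form_scale (- s k) \<psi>2" by (auto simp: fun_eq_iff)
    then have "g (\<psi>1 - form_scale (s k) \<psi>2) = form_scale (d + s k * c) \<psi>1 + form_scale (- s k * a - b) \<psi>2"
      using gc[of 1 "- s k"] by simp
    also have "\<dots> = form_scale (c * s k + d) (\<psi>1 - form_scale (s (\<pi> k)) \<psi>2)"
      using m[of k] by (auto simp: fun_eq_iff field_simps)
    finally have e: "g (\<psi>1 - form_scale (s k) \<psi>2) = \<dots>" .
    then show ?thesis using m[of k] by (simp add: linear_image_span_single[OF lin] span_single_scale)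
  qed
  have "(\<lambda>l. g ` l) ` degenerate_elements (form.span {\<psi>1, \<psi>2}) = degenerate_elements (form.span {\<psi>1, \<psi>2})"
  proof -
    have "range (\<lambda>k. form.span {\<psi>1 - form_scale (s (\<pi> k)) \<psi>2}) =
        (\<lambda>k. form.span {\<psi>1 - form_scale (s k) \<psi>2}) ` range \<pi>"
      by (rule image_image[symmetric])
    then show ?thesis
      unfolding degenerate_elements_has_roots[OF r n] image_image img bij_is_surj[OF bij] .
  qed
  then have fixed: "\<forall>l\<in>elements (form.span {\<psi>1, \<psi>2}). g ` l = l"
    using triv lin bijg by (simp add: only_trivial_automorphism_def)
  have "s (\<pi> k) = s k" for k
  proof -
    have "form.span {\<psi>1 - form_scale (s k) \<psi>2} \<in> degenerate_elements (form.span {\<psi>1, \<psi>2})"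
      by (simp add: degenerate_elements_has_roots[OF r n])
    then have "form.span {\<psi>1 - form_scale (s k) \<psi>2} \<in> elements (form.span {\<psi>1, \<psi>2})"
      by (auto simp: degenerate_elements_def elements_def)
    then have "form.span {\<psi>1 - form_scale (s (\<pi> k)) \<psi>2} = form.span {\<psi>1 - form_scale (s k) \<psi>2}"
      using fixed img by metis
    then show ?thesis using span_single_difference_eq_iff[OF ind] by blast
  qed
  then show ?thesis using r by (auto simp: has_roots_def inj_eq fun_eq_iff)
qed

section \<open>Diagonal pencils\<close>

definition diag_form :: "('k \<Rightarrow> complex) \<Rightarrow> 'k::finite form" where
  "diag_form c = (\<lambda>z. \<Sum>k\<in>UNIV. c k * (z $ k)\<^sup>2)"

lemma quadratic_form_diag_form: "quadratic_form (diag_form c)"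
  unfolding diag_form_def by (rule quadratic_form_diag)

lemma polar_diag_form: "polar (diag_form c) u v = (\<Sum>k\<in>UNIV. c k * u $ k * v $ k)"
proof -
  have "2 * polar (diag_form c) u v = (\<Sum>k\<in>UNIV. 2 * (c k * u $ k * v $ k))"
    unfolding polar_def diag_form_def
    by (simp add: power2_eq_square algebra_simps sum.distrib flip: sum_subtractf)
  then show ?thesis by (simp add: sum_distrib_left[symmetric])
qed

lemma nondegenerate_diag_form: "nondegenerate (diag_form c) \<longleftrightarrow> (\<forall>k. c k \<noteq> 0)"
proof
  assume nd: "nondegenerate (diag_form c)"
  show "\<forall>k. c k \<noteq> 0"
  proof (intro allI notI)
    fix k assume "c k = 0"
    then have "polar (diag_form c) (axis k 1) v = 0" for v
      by (simp add: polar_diag_form axis_def if_distrib if_distribR cong: if_cong)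
    then have "axis k (1::complex) = (0 :: complex ^ 'a)" using nd unfolding nondegenerate_def by blast
    then show False by (simp add: axis_eq_0_iff)
  qed
next
  assume c: "\<forall>k. c k \<noteq> 0"
  have "u = 0" if "\<forall>v. polar (diag_form c) u v = 0" for u
  proof -
    have "c k * u $ k = 0" for k
      using that[rule_format, of "axis k 1"]
      by (simp add: polar_diag_form axis_def if_distrib if_distribR cong: if_cong)
    then show ?thesis using c by (simp add: vec_eq_iff)
  qed
  then show "nondegenerate (diag_form c)" by (simp add: nondegenerate_def)
qed

lemma diag_form_combination:
  "form_scale a (diag_form c) + form_scale b (diag_form d) = diag_form (\<lambda>k. a * c k + b * d k)"
  by (simp add: fun_eq_iff diag_form_def algebra_simps sum_distrib_left sum.distrib)

lemma diag_form_difference: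
  "diag_form c - form_scale t (diag_form d) = diag_form (\<lambda>k. c k - t * d k)"
  by (simp add: fun_eq_iff diag_form_def algebra_simps sum_distrib_left sum_subtractf)

lemma has_roots_diag: "inj s \<Longrightarrow> has_roots (diag_form s) (diag_form (\<lambda>_. 1)) s"
  unfolding has_roots_def diag_form_difference nondegenerate_diag_form
  by (auto simp: quadratic_form_diag_form)

abbreviation diag_pencil :: "('k \<Rightarrow> complex) \<Rightarrow> 'k::finite form set" where
  "diag_pencil s \<equiv> form.span {diag_form s, diag_form (\<lambda>_. 1)}"

lemma pencil_roots_diag: "inj s \<Longrightarrow> pencil_roots (diag_pencil s) s"
  using has_roots_diag by (auto simp: pencil_roots_def)

text \<open>Rescaling the \<open>k\<close>-th coordinate by a square root of \<open>c s\<^sub>k + d\<close> clears the denominators. The two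
forms then become \<open>a \<psi>\<^sub>1 + b \<psi>\<^sub>2\<close> and \<open>c \<psi>\<^sub>1 + d \<psi>\<^sub>2\<close>, another basis of the same pencil.\<close>

lemma orbit_diag_moebius:
  fixes s :: "'k::finite \<Rightarrow> complex"
  assumes det: "a * d - b * c \<noteq> 0" and ne: "\<And>k. c * s k + d \<noteq> 0"
  shows "orbit (diag_pencil (\<lambda>k. (a * s k + b) / (c * s k + d))) = orbit (diag_pencil s)"
proof -
  let ?g = "\<lambda>z :: complex ^ 'k. \<chi> k. csqrt (c * s k + d) * z $ k"
  have lin: "clinear ?g" by (simp add: clinear_iff vec_eq_iff algebra_simps)
  have cancel: "(c * s k + d) * ((a * s k + b) / (c * s k + d)) = a * s k + b"
    "(c * s k + d) * 1 = c * s k + d" for k using ne[of k] by simp_all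
  have "csqrt (c * s k + d) \<noteq> 0" for k using ne by simp
  then have "bij ?g"
    by (intro o_bij[of "\<lambda>z :: complex ^ 'k. \<chi> k. z $ k / csqrt (c * s k + d)"])
      (simp_all add: fun_eq_iff vec_eq_iff)
  have comp: "diag_form q \<circ> ?g = diag_form (\<lambda>k. (c * s k + d) * q k)" for q
    by (simp add: diag_form_def fun_eq_iff power_mult_distrib mult_ac)
  have "form.span {diag_form (\<lambda>k. a * s k + b), diag_form (\<lambda>k. c * s k + d)} = diag_pencil s" (is "?L = ?R")
  proof
    show "?L \<subseteq> ?R"
    proof
      fix u assume "u \<in> ?L"
      then obtain p q where u: "u = diag_form (\<lambda>k. p * (a * s k + b) + q * (c * s k + d))"
        unfolding form_span_pair diag_form_combination by blast
      have "u = diag_form (\<lambda>k. (p * a + q * c) * s k + (p * b + q * d) * 1)"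
        unfolding u by (simp add: algebra_simps)
      then show "u \<in> ?R" unfolding form_span_pair diag_form_combination by blast
    qed
    show "?R \<subseteq> ?L"
    proof
      fix u assume "u \<in> ?R"
      then obtain p q where u: "u = diag_form (\<lambda>k. p * s k + q * 1)"
        unfolding form_span_pair diag_form_combination by blast
      let ?D = "a * d - b * c"
      have "(p * d - q * c) / ?D * (a * s k + b) + (q * a - p * b) / ?D * (c * s k + d) = p * s k + q" for k
      proof -
        have "(p * d - q * c) * (a * s k + b) + (q * a - p * b) * (c * s k + d) = (p * s k + q) * ?D"
          by (simp add: algebra_simps)
        then show ?thesis using det by (simp add: divide_simps)
      qed
      then have "u = diag_form (\<lambda>k. (p * d - q * c) / ?D * (a * s k + b) + (q * a - p * b) / ?D * (c * s k + d))"
        unfolding u by simp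
      then show "u \<in> ?L" unfolding form_span_pair diag_form_combination by blast
    qed
  qed
  then have eq: "pullback ?g (diag_pencil (\<lambda>k. (a * s k + b) / (c * s k + d))) = diag_pencil s"
    unfolding pullback_span comp cancel .
  show ?thesis
    using orbit_pullback[OF lin \<open>bij ?g\<close>, of "diag_pencil (\<lambda>k. (a * s k + b) / (c * s k + d))"]
    unfolding eq by (rule sym)
qed

section \<open>Symmetric functions of the roots\<close>

inductive poly_fun :: "(('k::finite \<Rightarrow> complex) \<Rightarrow> complex) \<Rightarrow> bool" where
  poly_fun_const: "poly_fun (\<lambda>_. c)"
| poly_fun_coord: "poly_fun (\<lambda>s. s k)"
| poly_fun_add: "poly_fun f \<Longrightarrow> poly_fun g \<Longrightarrow> poly_fun (\<lambda>s. f s + g s)"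
| poly_fun_mult: "poly_fun f \<Longrightarrow> poly_fun g \<Longrightarrow> poly_fun (\<lambda>s. f s * g s)"

lemma poly_fun_diff:
  assumes "poly_fun f" "poly_fun g" shows "poly_fun (\<lambda>s. f s - g s)"
proof -
  have "poly_fun (\<lambda>s. f s + (-1) * g s)" by (intro poly_fun.intros assms)
  then show ?thesis by simp
qed

lemma poly_fun_prod: "(\<And>i. i \<in> I \<Longrightarrow> poly_fun (f i)) \<Longrightarrow> poly_fun (\<lambda>s. \<Prod>i\<in>I. f i s)"
  by (induction I rule: infinite_finite_induct) (auto intro: poly_fun.intros)

lemma poly_fun_power: "poly_fun f \<Longrightarrow> poly_fun (\<lambda>s. f s ^ m)"
  by (induction m) (auto intro: poly_fun.intros)

text \<open>A description of the polynomial functions that allows induction over monomials.\<close>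

inductive mono_span :: "(('k::finite \<Rightarrow> complex) \<Rightarrow> complex) \<Rightarrow> bool" where
  mono_span_0: "mono_span (\<lambda>_. 0)"
| mono_span_step: "mono_span f \<Longrightarrow> mono_span (\<lambda>s. c * (\<Prod>k\<in>UNIV. s k ^ e k) + f s)"

lemma mono_span_monomial: "mono_span (\<lambda>s. c * (\<Prod>k\<in>UNIV. s k ^ e k))"
  using mono_span_step[OF mono_span_0, of c e] by simp

lemma mono_span_add: "mono_span f \<Longrightarrow> mono_span g \<Longrightarrow> mono_span (\<lambda>s. f s + g s)"
  by (induction rule: mono_span.induct) (auto simp: add.assoc intro: mono_span.intros)

lemma mono_span_monomial_mult: "mono_span f \<Longrightarrow> mono_span (\<lambda>s. c * (\<Prod>k\<in>UNIV. s k ^ e k) * f s)"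
proof (induction rule: mono_span.induct)
  case (mono_span_step f d e')
  have "mono_span (\<lambda>s. (c * d) * (\<Prod>k\<in>UNIV. s k ^ (e k + e' k)) + c * (\<Prod>k\<in>UNIV. s k ^ e k) * f s)"
    by (intro mono_span.mono_span_step mono_span_step)
  then show ?case by (simp add: power_add prod.distrib algebra_simps)
qed (simp add: mono_span_0)

lemma mono_span_mult: "mono_span f \<Longrightarrow> mono_span g \<Longrightarrow> mono_span (\<lambda>s. f s * g s)"
  by (induction rule: mono_span.induct)
    (auto simp: distrib_right intro: mono_span_0 mono_span_add mono_span_monomial_mult)

lemma poly_fun_mono_span: "poly_fun f \<Longrightarrow> mono_span f"
proof (induction rule: poly_fun.induct)
  case (poly_fun_const c)
  show ?case using mono_span_monomial[of c "\<lambda>_. 0"] by simp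
next
  case (poly_fun_coord k)
  have "(\<Prod>j\<in>UNIV. s j ^ (if j = k then 1 else 0)) = s k" for s :: "'a \<Rightarrow> complex"
    by (simp add: if_distrib cong: if_cong)
  then show ?case using mono_span_monomial[of 1 "\<lambda>j. if j = k then 1 else 0"] by simp
qed (auto intro: mono_span_add mono_span_mult)

definition power_sum :: "nat \<Rightarrow> ('k::finite \<Rightarrow> complex) \<Rightarrow> complex" where
  "power_sum m s = (\<Sum>k\<in>UNIV. s k ^ m)"

text \<open>Functions generated by power sums: over the complex numbers these are all symmetric polynomials.\<close>

inductive sym_fun :: "(('k::finite \<Rightarrow> complex) \<Rightarrow> complex) \<Rightarrow> bool" where
  sym_fun_const: "sym_fun (\<lambda>_. c)"
| sym_fun_power_sum: "sym_fun (power_sum m)"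
| sym_fun_add: "sym_fun f \<Longrightarrow> sym_fun g \<Longrightarrow> sym_fun (\<lambda>s. f s + g s)"
| sym_fun_mult: "sym_fun f \<Longrightarrow> sym_fun g \<Longrightarrow> sym_fun (\<lambda>s. f s * g s)"

lemma sym_fun_prod: "(\<And>i. i \<in> I \<Longrightarrow> sym_fun (f i)) \<Longrightarrow> sym_fun (\<lambda>s. \<Prod>i\<in>I. f i s)"
  by (induction I rule: infinite_finite_induct) (auto intro: sym_fun.intros)

text \<open>Summing over all maps, not only over permutations, makes the sum of a monomial factor into power
sums. The superfluous maps are removed later by a factor that vanishes on them.\<close>

lemma sum_over_maps_sym_fun:
  assumes "poly_fun (f :: ('k::finite \<Rightarrow> complex) \<Rightarrow> complex)"
  shows "sym_fun (\<lambda>s. \<Sum>m\<in>(UNIV :: ('k \<Rightarrow> 'k) set). f (s \<circ> m))"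
  using poly_fun_mono_span[OF assms]
proof (induction rule: mono_span.induct)
  case mono_span_0
  show ?case using sym_fun_const[of 0] by simp
next
  case (mono_span_step f c e)
  have "(\<Sum>m\<in>UNIV. \<Prod>k\<in>UNIV. s (m k) ^ e k) = (\<Prod>k\<in>UNIV. power_sum (e k) s)" for s :: "'k \<Rightarrow> complex"
    using prod_sum_PiE[of "UNIV :: 'k set" "\<lambda>_. UNIV :: 'k set" "\<lambda>k j. s j ^ e k"]
    by (simp add: power_sum_def PiE_UNIV_domain)
  then have "(\<lambda>s. \<Sum>m\<in>(UNIV :: ('k \<Rightarrow> 'k) set). c * (\<Prod>k\<in>UNIV. (s \<circ> m) k ^ e k) + f (s \<circ> m)) =
    (\<lambda>s. c * (\<Prod>k\<in>UNIV. power_sum (e k) s) + (\<Sum>m\<in>UNIV. f (s \<circ> m)))"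
    by (simp add: sum.distrib flip: sum_distrib_left)
  moreover have "sym_fun \<dots>"
    by (intro sym_fun_add sym_fun_mult sym_fun_const sym_fun_prod sym_fun_power_sum mono_span_step)
  ultimately show ?case by (simp only:)
qed

text \<open>Synthetic division by a linear factor, as a telescoping sum.\<close>

lemma coeff_linear_quotient:
  fixes r :: "complex poly"
  assumes "degree r < n"
  shows "coeff r j = (\<Sum>i<n. coeff ([:- c, 1:] * r) (j + 1 + i) * c ^ i)"
proof -
  have "(\<Sum>i<n. coeff ([:- c, 1:] * r) (j + 1 + i) * c ^ i) =
     (\<Sum>i<n. coeff r (j + i) * c ^ i - coeff r (j + Suc i) * c ^ Suc i)"
    by (intro sum.cong) (auto simp: algebra_simps)
  also have "\<dots> = coeff r (j + 0) * c ^ 0 - coeff r (j + n) * c ^ n"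
    by (rule sum_lessThan_telescope')
  also have "coeff r (j + n) = 0" using assms by (intro coeff_eq_0) auto
  finally show ?thesis by simp
qed

abbreviation root_poly :: "('k::finite \<Rightarrow> complex) \<Rightarrow> complex poly" where
  "root_poly s \<equiv> (\<Prod>k\<in>UNIV. [:- s k, 1:])"

lemma degree_prod_linear: "finite A \<Longrightarrow> degree (\<Prod>k\<in>A. [:- s k, 1 :: complex:]) = card A"
  by (subst degree_prod_sum_eq) auto

text \<open>Compare coefficients in \<open>p' = \<Sum>\<^sub>k p / (X - s\<^sub>k)\<close>, where the quotients on the right are known by
synthetic division.\<close>

lemma newton_identity_small:
  fixes s :: "'k::finite \<Rightarrow> complex"
  assumes "m < CARD('k)"
  shows "power_sum m s = of_nat (CARD('k) - m) * coeff (root_poly s) (CARD('k) - m)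
    - (\<Sum>i<m. coeff (root_poly s) (CARD('k) - m + i) * power_sum i s)"
proof -
  let ?n = "CARD('k)" and ?p = "root_poly s"
  have dp: "degree ?p = ?n" by (simp add: degree_prod_linear)
  have lead: "coeff ?p ?n = 1" using prod_linear_poly[of UNIV "\<lambda>k. - s k" "\<lambda>_. 1"] by simp
  define j where "j = ?n - m - 1"
  have j: "j + 1 = ?n - m" using assms by (simp add: j_def)
  have "of_nat (?n - m) * coeff ?p (?n - m) = coeff (pderiv ?p) j"
    by (simp add: coeff_pderiv flip: j)
  also have "\<dots> = (\<Sum>k\<in>UNIV. coeff (\<Prod>l\<in>UNIV - {k}. [:- s l, 1:]) j)"
    by (simp add: pderiv_prod pderiv_pCons coeff_sum)
  also have "\<dots> = (\<Sum>k\<in>UNIV. \<Sum>i<?n. coeff ?p (j + 1 + i) * s k ^ i)"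
  proof (intro sum.cong refl)
    fix k
    have "degree (\<Prod>l\<in>UNIV - {k}. [:- s l, 1:]) < ?n"
      by (subst degree_prod_linear) (auto simp: card_Diff_singleton card_gt_0_iff)
    from coeff_linear_quotient[OF this, of j "s k"]
    show "coeff (\<Prod>l\<in>UNIV - {k}. [:- s l, 1:]) j = (\<Sum>i<?n. coeff ?p (j + 1 + i) * s k ^ i)"
      by (simp add: prod.remove[of UNIV k] del: mult_pCons_left)
  qed
  also have "\<dots> = (\<Sum>i<?n. coeff ?p (?n - m + i) * power_sum i s)"
    by (subst sum.swap) (simp only: power_sum_def sum_distrib_left j)
  also have "\<dots> = (\<Sum>i<Suc m. coeff ?p (?n - m + i) * power_sum i s)"
    using assms dp by (intro sum.mono_neutral_right) (auto intro!: coeff_eq_0)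
  also have "\<dots> = (\<Sum>i<m. coeff ?p (?n - m + i) * power_sum i s) + power_sum m s"
    using assms lead by simp
  finally show ?thesis by simp
qed

text \<open>Sum the equations \<open>s\<^sub>k ^ (m - n) * p s\<^sub>k = 0\<close>.\<close>

lemma newton_identity_large:
  fixes s :: "'k::finite \<Rightarrow> complex"
  assumes "m \<ge> CARD('k)"
  shows "power_sum m s = - (\<Sum>l<CARD('k). coeff (root_poly s) l * power_sum (m - CARD('k) + l) s)"
proof -
  let ?n = "CARD('k)" and ?p = "root_poly s"
  have dp: "degree ?p = ?n" by (simp add: degree_prod_linear)
  have lead: "coeff ?p ?n = 1" using prod_linear_poly[of UNIV "\<lambda>k. - s k" "\<lambda>_. 1"] by simp
  have 0: "s k ^ (m - ?n) * poly ?p (s k) = 0" for k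
    by (simp add: poly_prod prod_zero_iff) (metis add.left_inverse)
  have "0 = (\<Sum>k\<in>UNIV. s k ^ (m - ?n) * poly ?p (s k))" unfolding 0 by simp
  also have "\<dots> = (\<Sum>k\<in>UNIV. \<Sum>l\<le>?n. coeff ?p l * s k ^ (m - ?n + l))"
    by (simp add: poly_altdef dp sum_distrib_left power_add mult_ac)
  also have "\<dots> = (\<Sum>l\<le>?n. coeff ?p l * power_sum (m - ?n + l) s)"
    by (subst sum.swap) (simp add: power_sum_def sum_distrib_left)
  also have "\<dots> = (\<Sum>l<?n. coeff ?p l * power_sum (m - ?n + l) s) + power_sum m s"
    using assms lead by (simp flip: lessThan_Suc_atMost)
  finally show ?thesis by (simp add: eq_neg_iff_add_eq_0 add.commute)
qed

section \<open>Polynomials on pairs\<close>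

lemma polynomial_on_pairs_sum:
  "(\<And>i. i \<in> I \<Longrightarrow> polynomial_on_pairs (f i)) \<Longrightarrow> polynomial_on_pairs (\<lambda>q. \<Sum>i\<in>I. f i q)"
  by (induction I rule: infinite_finite_induct) (auto intro: polynomial_on_pairs.intros)

lemma polynomial_on_pairs_power: "polynomial_on_pairs f \<Longrightarrow> polynomial_on_pairs (\<lambda>q. f q ^ m)"
  by (induction m) (auto intro: polynomial_on_pairs.intros)

lemma polynomial_on_pairs_uminus:
  assumes "polynomial_on_pairs f" shows "polynomial_on_pairs (\<lambda>q. - f q)"
proof -
  have "polynomial_on_pairs (\<lambda>q. (-1) * f q)" by (intro polynomial_on_pairs.intros assms)
  then show ?thesis by simp
qed

definition coeffs_polynomial :: "('n::finite form \<times> 'n form \<Rightarrow> complex poly) \<Rightarrow> bool" where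
  "coeffs_polynomial P \<longleftrightarrow> (\<forall>j. polynomial_on_pairs (\<lambda>q. coeff (P q) j))"

lemma coeffs_polynomial_mult:
  "coeffs_polynomial P \<Longrightarrow> coeffs_polynomial Q \<Longrightarrow> coeffs_polynomial (\<lambda>q. P q * Q q)"
  by (auto simp: coeffs_polynomial_def coeff_mult intro!: polynomial_on_pairs_sum polynomial_on_pairs.intros)

lemma coeffs_polynomial_const: "coeffs_polynomial (\<lambda>_. p)"
  by (auto simp: coeffs_polynomial_def intro: polynomial_on_pairs.intros)

lemma coeffs_polynomial_sum:
  "(\<And>i. i \<in> I \<Longrightarrow> coeffs_polynomial (P i)) \<Longrightarrow> coeffs_polynomial (\<lambda>q. \<Sum>i\<in>I. P i q)"
  by (auto simp: coeffs_polynomial_def coeff_sum intro!: polynomial_on_pairs_sum)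

lemma coeffs_polynomial_prod:
  "(\<And>i. i \<in> I \<Longrightarrow> coeffs_polynomial (P i)) \<Longrightarrow> coeffs_polynomial (\<lambda>q. \<Prod>i\<in>I. P i q)"
  by (induction I rule: infinite_finite_induct) (auto intro: coeffs_polynomial_mult coeffs_polynomial_const)

lemma coeffs_polynomial_linear:
  assumes "polynomial_on_pairs f" "polynomial_on_pairs g"
  shows "coeffs_polynomial (\<lambda>q. [:f q, g q:])"
  unfolding coeffs_polynomial_def
proof
  fix j
  show "polynomial_on_pairs (\<lambda>q. coeff [:f q, g q:] j)"
    using assms by (cases j; cases "j - 1") (auto simp: coeff_pCons intro: polynomial_on_pairs.intros)
qed

text \<open>The second form of a pair spanning a nonsingular pencil may be degenerate. The shift \<open>\<tau>\<close> is chosen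
so that \<open>fst q + \<tau> snd q\<close> is nondegenerate at a given pair, hence also on a Zariski neighbourhood of it.\<close>

definition char_poly :: "complex \<Rightarrow> 'n::finite form \<times> 'n form \<Rightarrow> complex poly" where
  "char_poly \<tau> q = pencil_poly (snd q) (fst q + form_scale \<tau> (snd q))"

definition char_lead :: "complex \<Rightarrow> 'n::finite form \<times> 'n form \<Rightarrow> complex" where
  "char_lead \<tau> q = coeff (char_poly \<tau> q) CARD('n)"

lemma coeffs_polynomial_char_poly: "coeffs_polynomial (char_poly \<tau>)"
proof -
  have f: "polynomial_on_pairs (\<lambda>q. gram (snd q) $ i $ j)"
    and "polynomial_on_pairs (\<lambda>q. gram (fst q + form_scale \<tau> (snd q)) $ i $ j)" for i j
    by (auto simp: gram_def polar_plus polar_scale intro!: polynomial_on_pairs.intros)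
  then have g: "polynomial_on_pairs (\<lambda>q. - gram (fst q + form_scale \<tau> (snd q)) $ i $ j)" for i j
    by (intro polynomial_on_pairs_uminus)
  have *: "char_poly \<tau> = (\<lambda>q. \<Sum>p\<in>{p. p permutes UNIV}. of_int (sign p) *
     (\<Prod>i\<in>UNIV. [:gram (snd q) $ i $ p i, - gram (fst q + form_scale \<tau> (snd q)) $ i $ p i:]))"
    by (simp add: fun_eq_iff char_poly_def pencil_poly_def det_def)
  show ?thesis unfolding *
    by (intro coeffs_polynomial_sum coeffs_polynomial_mult coeffs_polynomial_const
        coeffs_polynomial_prod coeffs_polynomial_linear f g)
qed

lemma polynomial_on_pairs_char_lead: "polynomial_on_pairs (char_lead \<tau>)"
  using coeffs_polynomial_char_poly unfolding coeffs_polynomial_def char_lead_def[abs_def] by blast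

text \<open>All roots of the characteristic polynomial, listed with multiplicity.\<close>

definition char_roots :: "complex \<Rightarrow> 'n::finite form \<times> 'n form \<Rightarrow> ('n \<Rightarrow> complex) \<Rightarrow> bool" where
  "char_roots \<tau> q s \<longleftrightarrow> char_lead \<tau> q \<noteq> 0 \<and> char_poly \<tau> q = smult (char_lead \<tau> q) (root_poly s)"

text \<open>Functions of a pair and its roots that are regular in the pair on the open set of pairs where the leading coefficient of
the characteristic polynomial does not vanish.\<close>

definition rational_in_pair :: "complex \<Rightarrow> ('n::finite form \<times> 'n form \<Rightarrow> ('n \<Rightarrow> complex) \<Rightarrow> complex) \<Rightarrow> bool" where
  "rational_in_pair \<tau> f \<longleftrightarrow> (\<exists>R K. polynomial_on_pairs R \<and>
     (\<forall>q s. char_roots \<tau> q s \<longrightarrow> f q s = R q / char_lead \<tau> q ^ K))"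

lemma rational_in_pair_const: "rational_in_pair \<tau> (\<lambda>_ _. c)"
  unfolding rational_in_pair_def by (rule exI[of _ "\<lambda>_. c"], rule exI[of _ 0]) (auto intro: polynomial_on_pairs.intros)

lemma rational_in_pair_cong:
  "(\<And>q s. char_roots \<tau> q s \<Longrightarrow> f q s = g q s) \<Longrightarrow> rational_in_pair \<tau> f \<Longrightarrow> rational_in_pair \<tau> g"
  unfolding rational_in_pair_def by (metis (no_types, lifting))

lemma rational_in_pair_add:
  assumes "rational_in_pair \<tau> f" "rational_in_pair \<tau> g"
  shows "rational_in_pair \<tau> (\<lambda>q s. f q s + g q s)"
proof -
  obtain R K R' K' where R: "polynomial_on_pairs R" "polynomial_on_pairs R'"
    and eq: "\<And>q s. char_roots \<tau> q s \<Longrightarrow> f q s = R q / char_lead \<tau> q ^ K"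
      "\<And>q s. char_roots \<tau> q s \<Longrightarrow> g q s = R' q / char_lead \<tau> q ^ K'"
    using assms unfolding rational_in_pair_def by metis
  have "f q s + g q s = (R q * char_lead \<tau> q ^ K' + R' q * char_lead \<tau> q ^ K) / char_lead \<tau> q ^ (K + K')"
    if "char_roots \<tau> q s" for q s
  proof -
    have "char_lead \<tau> q \<noteq> 0" using that by (simp add: char_roots_def)
    then show ?thesis using eq[OF that] by (simp add: power_add field_simps)
  qed
  moreover have "polynomial_on_pairs (\<lambda>q. R q * char_lead \<tau> q ^ K' + R' q * char_lead \<tau> q ^ K)"
    by (intro polynomial_on_pairs.intros polynomial_on_pairs_power polynomial_on_pairs_char_lead R)
  ultimately show ?thesis unfolding rational_in_pair_def by blast
qed

lemma rational_in_pair_mult: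
  assumes "rational_in_pair \<tau> f" "rational_in_pair \<tau> g"
  shows "rational_in_pair \<tau> (\<lambda>q s. f q s * g q s)"
proof -
  obtain R K R' K' where R: "polynomial_on_pairs R" "polynomial_on_pairs R'"
    and eq: "\<And>q s. char_roots \<tau> q s \<Longrightarrow> f q s = R q / char_lead \<tau> q ^ K"
      "\<And>q s. char_roots \<tau> q s \<Longrightarrow> g q s = R' q / char_lead \<tau> q ^ K'"
    using assms unfolding rational_in_pair_def by metis
  have "f q s * g q s = (R q * R' q) / char_lead \<tau> q ^ (K + K')" if "char_roots \<tau> q s" for q s
    using eq[OF that] by (simp add: power_add)
  moreover have "polynomial_on_pairs (\<lambda>q. R q * R' q)"
    by (intro polynomial_on_pairs.intros R)
  ultimately show ?thesis unfolding rational_in_pair_def by blast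
qed

lemma rational_in_pair_uminus:
  "rational_in_pair \<tau> f \<Longrightarrow> rational_in_pair \<tau> (\<lambda>q s. - f q s)"
  using rational_in_pair_mult[OF rational_in_pair_const[of \<tau> "-1"]] by fastforce

lemma rational_in_pair_sum:
  "(\<And>i. i \<in> I \<Longrightarrow> rational_in_pair \<tau> (f i)) \<Longrightarrow> rational_in_pair \<tau> (\<lambda>q s. \<Sum>i\<in>I. f i q s)"
  by (induction I rule: infinite_finite_induct) (auto intro: rational_in_pair_const rational_in_pair_add)

lemma rational_in_pair_coeff: "rational_in_pair \<tau> (\<lambda>q s. coeff (root_poly s) j)"
proof -
  have "coeff (root_poly s) j = coeff (char_poly \<tau> q) j / char_lead \<tau> q ^ 1" if "char_roots \<tau> q s" for q s
    using that by (auto simp: char_roots_def)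
  then show ?thesis
    using coeffs_polynomial_char_poly[of \<tau>] unfolding rational_in_pair_def coeffs_polynomial_def by blast
qed

text \<open>Newton's identities express a power sum by earlier power sums and coefficients of the monic
polynomial with these roots.\<close>

lemma rational_in_pair_power_sum: "rational_in_pair \<tau> (\<lambda>q s :: 'n::finite \<Rightarrow> complex. power_sum m s)"
proof (induction m rule: less_induct)
  case (less m)
  show ?case
  proof (cases "m < CARD('n)")
    case True
    have "rational_in_pair \<tau> (\<lambda>q s :: 'n \<Rightarrow> complex.
      of_nat (CARD('n) - m) * coeff (root_poly s) (CARD('n) - m)
    + - (\<Sum>i<m. coeff (root_poly s) (CARD('n) - m + i) * power_sum i s))"
      by (intro rational_in_pair_add rational_in_pair_mult rational_in_pair_const rational_in_pair_coeff
          rational_in_pair_uminus rational_in_pair_sum less) auto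
    then show ?thesis
      by (rule rational_in_pair_cong[rotated]) (simp add: newton_identity_small[OF True])
  next
    case False
    have "rational_in_pair \<tau> (\<lambda>q s :: 'n \<Rightarrow> complex.
      - (\<Sum>l<CARD('n). coeff (root_poly s) l * power_sum (m - CARD('n) + l) s))"
      using False
      by (intro rational_in_pair_add rational_in_pair_mult rational_in_pair_const rational_in_pair_coeff
          rational_in_pair_uminus rational_in_pair_sum less) auto
    then show ?thesis
      by (rule rational_in_pair_cong[rotated]) (use False in \<open>simp add: newton_identity_large[of m]\<close>)
  qed
qed

lemma rational_in_pair_sym_fun: "sym_fun f \<Longrightarrow> rational_in_pair \<tau> (\<lambda>q. f)"
  by (induction rule: sym_fun.induct)
    (auto intro: rational_in_pair_const rational_in_pair_add rational_in_pair_mult rational_in_pair_power_sum)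

lemma poly_eq_smult_root_poly:
  fixes p :: "complex poly" and s :: "'k::finite \<Rightarrow> complex"
  assumes "degree p \<le> CARD('k)" "inj s" "\<And>k. poly p (s k) = 0"
  shows "p = smult (coeff p CARD('k)) (root_poly s)"
proof (rule ccontr)
  let ?r = "p - smult (coeff p CARD('k)) (root_poly s)"
  assume "p \<noteq> smult (coeff p CARD('k)) (root_poly s)"
  then have ne: "?r \<noteq> 0" by simp
  have lead: "coeff (root_poly s) CARD('k) = 1" using prod_linear_poly[of UNIV "\<lambda>k. - s k" "\<lambda>_. 1"] by simp
  have deg: "degree ?r \<le> CARD('k)"
    using assms(1) by (intro degree_diff_le) (auto intro!: order.trans[OF degree_smult_le] simp: degree_prod_linear)
  have "coeff ?r CARD('k) = 0" using lead by simp
  then have "degree ?r \<noteq> CARD('k)" using ne by (metis leading_coeff_0_iff)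
  then have lt: "degree ?r < CARD('k)" using deg by simp
  have "poly ?r (s k) = 0" for k
    using assms(3) by (auto simp: poly_prod prod_zero_iff intro!: exI[of _ k])
  then have "range s \<subseteq> {t. poly ?r t = 0}" by auto
  then have "card (range s) \<le> degree ?r"
    using card_mono[OF poly_roots_finite[OF ne]] card_poly_roots_bound[OF ne] le_trans by blast
  then show False using lt assms(2) by (simp add: card_image)
qed

lemma quadratic_pairs_iff: "q \<in> quadratic_pairs \<longleftrightarrow> quadratic_form (fst q) \<and> quadratic_form (snd q)"
  by (cases q) (simp add: quadratic_pairs_def)

lemma quadratic_form_shift:
  "quadratic_form \<phi> \<Longrightarrow> quadratic_form \<psi> \<Longrightarrow> quadratic_form (\<phi> + form_scale \<tau> \<psi>)"
  using quadratic_form_sum_scale[of \<phi> \<psi> 1 \<tau>] by (simp add: plus_fun_def form_scale_def)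

lemma char_lead_nonzero_iff:
  assumes "(q :: 'n::finite form \<times> 'n form) \<in> quadratic_pairs"
  shows "char_lead \<tau> q \<noteq> 0 \<longleftrightarrow> nondegenerate (fst q + form_scale \<tau> (snd q))"
  using assms unfolding char_lead_def char_poly_def coeff_pencil_poly
  by (simp add: quadratic_pairs_iff quadratic_form_shift nondegenerate_iff_det)

lemma has_roots_iff_char_roots:
  assumes q: "(q :: 'n::finite form \<times> 'n form) \<in> quadratic_pairs"
  shows "has_roots (snd q) (fst q + form_scale \<tau> (snd q)) s \<longleftrightarrow> char_roots \<tau> q s \<and> inj s"
proof
  assume r: "has_roots (snd q) (fst q + form_scale \<tau> (snd q)) s"
  have "poly (char_poly \<tau> q) (s k) = 0" for k
    using r nondegenerate_difference_iff unfolding has_roots_def char_poly_def by blast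
  moreover have "degree (char_poly \<tau> q) \<le> CARD('n)" by (simp add: char_poly_def degree_pencil_poly)
  moreover have "inj s" "nondegenerate (fst q + form_scale \<tau> (snd q))" using r by (auto simp: has_roots_def)
  ultimately show "char_roots \<tau> q s \<and> inj s"
    using poly_eq_smult_root_poly[of "char_poly \<tau> q" s] char_lead_nonzero_iff[OF q]
    by (auto simp: char_roots_def char_lead_def)
next
  assume c: "char_roots \<tau> q s \<and> inj s"
  have "poly (char_poly \<tau> q) (s k) = 0" for k
    using c by (auto simp: char_roots_def poly_prod prod_zero_iff intro!: exI[of _ k])
  moreover have "quadratic_form (snd q)" "quadratic_form (fst q + form_scale \<tau> (snd q))"
    using q by (auto simp: quadratic_pairs_iff quadratic_form_shift)
  ultimately show "has_roots (snd q) (fst q + form_scale \<tau> (snd q)) s"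
    using c char_lead_nonzero_iff[OF q] nondegenerate_difference_iff[of "snd q"]
    unfolding has_roots_def char_poly_def by (auto simp: char_roots_def)
qed

lemma char_roots_exist:
  assumes "char_lead \<tau> (q :: 'n::finite form \<times> 'n form) \<noteq> 0"
  obtains s where "char_roots \<tau> q s"
proof -
  let ?p = "char_poly \<tau> q"
  have ne: "?p \<noteq> 0" using assms by (auto simp: char_lead_def)
  have deg: "degree ?p = CARD('n)"
    using assms le_degree[of ?p "CARD('n)"] degree_pencil_poly[of "snd q"] unfolding char_lead_def char_poly_def
    by (intro antisym) auto
  obtain A where A: "size A = degree ?p" "?p = smult (lead_coeff ?p) (\<Prod>x\<in>#A. [:-x, 1:])"
    using alg_closed_imp_factorization[OF ne] by blast
  obtain xs where xs: "mset xs = A" using ex_mset by blast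
  obtain f where f: "bij_betw f (UNIV :: 'n set) {..<length xs}"
    using finite_same_card_bij[of "UNIV :: 'n set" "{..<length xs}"] A xs deg
    by (metis card_lessThan finite finite_lessThan size_mset)
  have "root_poly (\<lambda>k. xs ! f k) = (\<Prod>i<length xs. [:- (xs ! i), 1:])"
    using prod.reindex_bij_betw[OF f, of "\<lambda>i. [:- (xs ! i), 1:]"] by simp
  also have "\<dots> = (\<Prod>x\<leftarrow>xs. [:-x, 1:])" by (simp add: prod.list_conv_set_nth atLeast0LessThan)
  also have "\<dots> = (\<Prod>x\<in>#A. [:-x, 1:])" unfolding xs[symmetric] by (metis mset_map prod_mset_prod_list)
  finally have "char_roots \<tau> q (\<lambda>k. xs ! f k)"
    using A deg assms by (simp add: char_roots_def char_lead_def)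
  then show ?thesis by (rule that)
qed

section \<open>Symmetrisation over permutations\<close>

text \<open>The product over ordered pairs is, up to sign, the discriminant, and thus invariant under
permutations.\<close>

definition vandermonde :: "('k::finite \<Rightarrow> complex) \<Rightarrow> complex" where
  "vandermonde s = (\<Prod>(i, j)\<in>{(i, j). i \<noteq> j}. s i - s j)"

lemma finite_pairs: "finite {(i :: 'k::finite, j). i \<noteq> j}"
  by (rule finite_subset[OF subset_UNIV]) simp

lemma vandermonde_eq_0_iff: "vandermonde s = 0 \<longleftrightarrow> \<not> inj s"
  unfolding vandermonde_def by (auto simp: prod_zero_iff[OF finite_pairs] inj_def)

lemma vandermonde_perm:
  assumes "bij \<sigma>" shows "vandermonde (s \<circ> \<sigma>) = vandermonde s"
proof -
  have "bij_betw (map_prod \<sigma> \<sigma>) {(i, j). i \<noteq> j} {(i, j). i \<noteq> j}"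
  proof (rule bij_betwI[where g = "map_prod (inv \<sigma>) (inv \<sigma>)"])
  qed (use assms in \<open>auto simp: bij_def inj_eq surj_f_inv_f inv_f_f dest: inj_imp_surj_inv\<close>,
    metis surj_f_inv_f)
  from prod.reindex_bij_betw[OF this, of "\<lambda>(i, j). s i - s j"]
  show ?thesis by (simp add: vandermonde_def case_prod_beta)
qed

lemma poly_fun_vandermonde: "poly_fun vandermonde"
proof -
  have "poly_fun (\<lambda>s. \<Prod>p\<in>{(i, j). i \<noteq> j}. s (fst p) - s (snd p))"
    by (intro poly_fun_prod poly_fun_diff poly_fun.intros)
  then show ?thesis by (simp add: vandermonde_def[abs_def] case_prod_beta)
qed

text \<open>Rational functions whose poles lie where two roots collide.\<close>

definition rat_fun :: "(('k::finite \<Rightarrow> complex) \<Rightarrow> complex) \<Rightarrow> bool" where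
  "rat_fun g \<longleftrightarrow> (\<exists>A K. poly_fun A \<and> (\<forall>s. inj s \<longrightarrow> g s = A s / vandermonde s ^ K))"

lemma rat_fun_poly: "poly_fun f \<Longrightarrow> rat_fun f"
  unfolding rat_fun_def by (rule exI[of _ f], rule exI[of _ 0]) auto

lemma rat_fun_add:
  assumes "rat_fun f" "rat_fun g" shows "rat_fun (\<lambda>s. f s + g s)"
proof -
  obtain A K A' K' where A: "poly_fun A" "poly_fun A'"
    and eq: "\<And>s. inj s \<Longrightarrow> f s = A s / vandermonde s ^ K" "\<And>s. inj s \<Longrightarrow> g s = A' s / vandermonde s ^ K'"
    using assms unfolding rat_fun_def by metis
  have "f s + g s = (A s * vandermonde s ^ K' + A' s * vandermonde s ^ K) / vandermonde s ^ (K + K')"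
    if "inj s" for s
  proof -
    have "vandermonde s \<noteq> 0" using that by (simp add: vandermonde_eq_0_iff)
    then show ?thesis using eq[OF that] by (simp add: power_add field_simps)
  qed
  moreover have "poly_fun (\<lambda>s. A s * vandermonde s ^ K' + A' s * vandermonde s ^ K)"
    by (intro poly_fun.intros poly_fun_power poly_fun_vandermonde A)
  ultimately show ?thesis unfolding rat_fun_def by blast
qed

lemma rat_fun_mult:
  assumes "rat_fun f" "rat_fun g" shows "rat_fun (\<lambda>s. f s * g s)"
proof -
  obtain A K A' K' where A: "poly_fun A" "poly_fun A'"
    and eq: "\<And>s. inj s \<Longrightarrow> f s = A s / vandermonde s ^ K" "\<And>s. inj s \<Longrightarrow> g s = A' s / vandermonde s ^ K'"
    using assms unfolding rat_fun_def by metis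
  have "f s * g s = (A s * A' s) / vandermonde s ^ (K + K')" if "inj s" for s
    using eq[OF that] by (simp add: power_add)
  moreover have "poly_fun (\<lambda>s. A s * A' s)" by (intro poly_fun.intros A)
  ultimately show ?thesis unfolding rat_fun_def by blast
qed

lemma rat_fun_prod: "(\<And>i. i \<in> I \<Longrightarrow> rat_fun (f i)) \<Longrightarrow> rat_fun (\<lambda>s. \<Prod>i\<in>I. f i s)"
  by (induction I rule: infinite_finite_induct) (auto intro: rat_fun_mult rat_fun_poly poly_fun.intros)

lemma rat_fun_inverse_difference:
  assumes "i \<noteq> j" shows "rat_fun (\<lambda>s. 1 / (s i - s j))"
proof -
  let ?P = "{(i, j). i \<noteq> j} - {(i, j)}"
  have "1 / (s i - s j) = (\<Prod>p\<in>?P. s (fst p) - s (snd p)) / vandermonde s ^ 1" if "inj s" for s :: "'a \<Rightarrow> complex"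
  proof -
    have v: "vandermonde s = (s i - s j) * (\<Prod>p\<in>?P. s (fst p) - s (snd p))"
      unfolding vandermonde_def using assms
      by (subst prod.remove[OF finite_pairs, of "(i, j)"]) (auto simp: case_prod_beta)
    have "vandermonde s \<noteq> 0" using that by (simp add: vandermonde_eq_0_iff)
    then show ?thesis by (simp add: v)
  qed
  moreover have "poly_fun (\<lambda>s. \<Prod>p\<in>?P. s (fst p) - s (snd p))"
    by (intro poly_fun_prod poly_fun_diff poly_fun.intros)
  ultimately show ?thesis unfolding rat_fun_def by blast
qed

text \<open>The factor \<open>vandermonde\<close> kills the maps that are not injective.\<close>

lemma sum_over_bij:
  fixes s :: "'k::finite \<Rightarrow> complex" and f :: "('k \<Rightarrow> complex) \<Rightarrow> complex"
  shows "(\<Sum>m\<in>UNIV. f (s \<circ> m) * vandermonde (s \<circ> m)) = (\<Sum>\<sigma>\<in>{\<sigma>. bij \<sigma>}. f (s \<circ> \<sigma>)) * vandermonde s"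
proof -
  have "(\<Sum>m\<in>UNIV. f (s \<circ> m) * vandermonde (s \<circ> m)) = (\<Sum>\<sigma>\<in>{\<sigma>. bij \<sigma>}. f (s \<circ> \<sigma>) * vandermonde (s \<circ> \<sigma>))"
  proof (rule sum.mono_neutral_right)
    show "\<forall>m\<in>UNIV - {\<sigma>. bij \<sigma>}. f (s \<circ> m) * vandermonde (s \<circ> m) = 0"
    proof
      fix m :: "'k \<Rightarrow> 'k" assume "m \<in> UNIV - {\<sigma>. bij \<sigma>}"
      then have "\<not> inj m" by (auto simp: bij_def finite_UNIV_inj_surj)
      then have "\<not> inj (s \<circ> m)" using inj_on_imageI2 by blast
      then show "f (s \<circ> m) * vandermonde (s \<circ> m) = 0" by (simp add: vandermonde_eq_0_iff)
    qed
  qed auto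
  then show ?thesis by (simp add: vandermonde_perm sum_distrib_right)
qed

text \<open>This polynomial is, up to nonzero factors, the discriminant of the characteristic polynomial. It
cuts out the pairs with fewer than the maximal number of degenerate elements.\<close>

lemma discriminant_polynomial:
  obtains R where "polynomial_on_pairs R"
    "\<And>q s :: 'n::finite \<Rightarrow> complex. char_roots \<tau> q s \<Longrightarrow> R q \<noteq> 0 \<longleftrightarrow> inj s"
proof -
  have "poly_fun (\<lambda>s :: 'n \<Rightarrow> complex. 1 * vandermonde s)" by (intro poly_fun.intros poly_fun_vandermonde)
  from rational_in_pair_sym_fun[OF sum_over_maps_sym_fun[OF this], of \<tau>]
  obtain R K where R: "polynomial_on_pairs R"
    "\<And>q s :: 'n \<Rightarrow> complex. char_roots \<tau> q s \<Longrightarrow>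
       (\<Sum>m\<in>(UNIV :: ('n \<Rightarrow> 'n) set). 1 * vandermonde (s \<circ> m)) = R q / char_lead \<tau> q ^ K"
    unfolding rational_in_pair_def by blast
  have "R q \<noteq> 0 \<longleftrightarrow> inj s" if c: "char_roots \<tau> q s" for q and s :: "'n \<Rightarrow> complex"
  proof -
    have "R q / char_lead \<tau> q ^ K = of_nat (card {\<sigma> :: 'n \<Rightarrow> 'n. bij \<sigma>}) * vandermonde s"
      using R(2)[OF c] sum_over_bij[of "\<lambda>_. 1" s] by simp
    moreover have "card {\<sigma> :: 'n \<Rightarrow> 'n. bij \<sigma>} \<noteq> 0"
      by (auto simp: card_eq_0_iff intro!: exI[of _ id])
    moreover have "char_lead \<tau> q \<noteq> 0" using c by (simp add: char_roots_def)
    ultimately show ?thesis using vandermonde_eq_0_iff[of s] by auto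
  qed
  then show ?thesis using R(1) that by blast
qed

text \<open>With a common denominator \<open>vandermonde ^ K\<close>, symmetrising the numerator suffices, and this
denominator is itself a symmetrisation.\<close>

lemma symmetrisation_rational:
  assumes "rat_fun (g :: ('n::finite \<Rightarrow> complex) \<Rightarrow> complex)"
  obtains f h where "polynomial_on_pairs f" "polynomial_on_pairs h"
    "\<And>q (s :: 'n \<Rightarrow> complex). char_roots \<tau> q s \<Longrightarrow> inj s \<Longrightarrow> h q \<noteq> 0 \<and> (\<Sum>\<sigma>\<in>{\<sigma>. bij \<sigma>}. g (s \<circ> \<sigma>)) = f q / h q"
proof -
  obtain A K where A: "poly_fun A" and g: "\<And>s. inj s \<Longrightarrow> g s = A s / vandermonde s ^ K"
    using assms unfolding rat_fun_def by blast
  define f1 where "f1 = (\<lambda>s :: 'n \<Rightarrow> complex. A s * vandermonde s)"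
  define f2 where "f2 = (\<lambda>s :: 'n \<Rightarrow> complex. 1 * vandermonde s)"
  have "poly_fun f1" "poly_fun f2" unfolding f1_def f2_def by (intro poly_fun.intros poly_fun_vandermonde A)+
  note p = this
  from rational_in_pair_sym_fun[OF sum_over_maps_sym_fun[OF p(1)], of \<tau>]
  obtain R1 K1 where R1: "polynomial_on_pairs R1" 
    "\<And>q s. char_roots \<tau> q s \<Longrightarrow> (\<Sum>m\<in>(UNIV :: ('n \<Rightarrow> 'n) set). f1 (s \<circ> m)) = R1 q / char_lead \<tau> q ^ K1"
    unfolding rational_in_pair_def by blast
  from rational_in_pair_sym_fun[OF sum_over_maps_sym_fun[OF p(2)], of \<tau>]
  obtain R2 K2 where R2: "polynomial_on_pairs R2" 
    "\<And>q s. char_roots \<tau> q s \<Longrightarrow> (\<Sum>m\<in>(UNIV :: ('n \<Rightarrow> 'n) set). f2 (s \<circ> m)) = R2 q / char_lead \<tau> q ^ K2"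
    unfolding rational_in_pair_def by blast
  define N where "N = (of_nat (card {\<sigma> :: 'n \<Rightarrow> 'n. bij \<sigma>}) :: complex)"
  have N: "N \<noteq> 0" unfolding N_def by (auto simp: card_eq_0_iff intro!: exI[of _ id])
  let ?f = "\<lambda>q. N ^ Suc K * (R1 q * char_lead \<tau> q ^ (K2 * Suc K))"
  let ?h = "\<lambda>q. char_lead \<tau> q ^ K1 * R2 q ^ Suc K"
  have "polynomial_on_pairs ?f" "polynomial_on_pairs ?h"
    by (intro polynomial_on_pairs.intros polynomial_on_pairs_power polynomial_on_pairs_char_lead R1 R2)+
  moreover have "?h q \<noteq> 0 \<and> (\<Sum>\<sigma>\<in>{\<sigma>. bij \<sigma>}. g (s \<circ> \<sigma>)) = ?f q / ?h q"
    if c: "char_roots \<tau> q s" and s: "inj s" for q s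
  proof -
    let ?v = "vandermonde s" and ?c = "char_lead \<tau> q"
    have v: "?v \<noteq> 0" using s by (simp add: vandermonde_eq_0_iff)
    have cc: "?c \<noteq> 0" using c by (simp add: char_roots_def)
    have e2: "N * ?v = R2 q / ?c ^ K2"
      using R2(2)[OF c] sum_over_bij[of "\<lambda>_. 1" s] by (simp add: f2_def N_def)
    have "(\<Sum>\<sigma>\<in>{\<sigma>. bij \<sigma>}. g (s \<circ> \<sigma>)) = (\<Sum>\<sigma>\<in>{\<sigma>. bij \<sigma>}. A (s \<circ> \<sigma>)) / ?v ^ K"
      unfolding sum_divide_distrib using s
      by (intro sum.cong) (auto simp: g inj_compose bij_is_inj vandermonde_perm)
    also have "(\<Sum>\<sigma>\<in>{\<sigma>. bij \<sigma>}. A (s \<circ> \<sigma>)) = R1 q / ?c ^ K1 / ?v"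
      using R1(2)[OF c] sum_over_bij[of A s] unfolding f1_def nonzero_eq_divide_eq[OF v] by simp
    finally have e1: "(\<Sum>\<sigma>\<in>{\<sigma>. bij \<sigma>}. g (s \<circ> \<sigma>)) = R1 q / (?c ^ K1 * ?v ^ Suc K)" by (simp only: power_Suc divide_divide_eq_left mult_ac)
    have r2: "R2 q = N * ?v * ?c ^ K2" using e2 cc by simp
    have "?f q / ?h q = R1 q / (?c ^ K1 * ?v ^ Suc K)"
      unfolding r2 power_mult_distrib power_mult[symmetric] using N v cc by (simp add: field_simps)
    then have "(\<Sum>\<sigma>\<in>{\<sigma>. bij \<sigma>}. g (s \<circ> \<sigma>)) = ?f q / ?h q" using e1 by (simp only:)
    moreover have "?h q \<noteq> 0" using r2 N v cc by simp
    ultimately show ?thesis by blast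
  qed
  ultimately show ?thesis using that[of ?f ?h] by blast
qed

section \<open>Regular functions on the moduli space\<close>

text \<open>Otherwise the elements \<open>\<phi> + \<tau> \<psi>\<close> would be infinitely many degenerate ones.\<close>

lemma exists_nondegenerate_shift:
  assumes ns: "nonsingular_pencil (form.span {\<phi>, \<psi> :: 'n::finite form})"
  obtains \<tau> where "nondegenerate (\<phi> + form_scale \<tau> \<psi>)"
proof (rule ccontr)
  assume "\<not> thesis"
  then have dg: "\<not> nondegenerate (\<phi> + form_scale \<tau> \<psi>)" for \<tau> using that by blast
  have ind: "independent_pair \<phi> \<psi>"
    using ns independent_pair_of_dim by (auto simp: nonsingular_pencil_def pencil_def)
  let ?l = "\<lambda>t. form.span {\<phi> - form_scale t \<psi>}"
  have "?l t \<in> degenerate_elements (form.span {\<phi>, \<psi>})" for t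
  proof -
    have eq: "\<phi> - form_scale t \<psi> = \<phi> + form_scale (- t) \<psi>"
      "\<phi> - form_scale t \<psi> = form_scale 1 \<phi> + form_scale (- t) \<psi>" by (auto simp: fun_eq_iff)
    then have "\<phi> - form_scale t \<psi> \<in> form.span {\<phi>, \<psi>}" unfolding form_span_pair by blast
    moreover have "\<phi> - form_scale t \<psi> \<noteq> 0"
      using ind unfolding eq(2) independent_pair_def by (metis one_neq_zero)
    moreover have "\<not> nondegenerate (\<phi> - form_scale t \<psi>)" unfolding eq(1) by (rule dg)
    ultimately show ?thesis by (auto simp: degenerate_elements_def)
  qed
  then have "finite (range ?l)"
    using ns by (auto simp: nonsingular_pencil_def intro: finite_subset)
  moreover have "inj ?l" using span_single_difference_eq_iff[OF ind] by (simp add: inj_def)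
  ultimately show False using finite_imageD infinite_UNIV_char_0 by blast
qed

lemma span_shift:
  "form.span {\<psi>, \<phi> + form_scale \<tau> \<psi>} = form.span {\<phi>, \<psi>}"
proof
  have "form_scale a \<psi> + form_scale b (\<phi> + form_scale \<tau> \<psi>) = form_scale b \<phi> + form_scale (a + b * \<tau>) \<psi>" for a b
    by (auto simp: fun_eq_iff algebra_simps)
  then show "form.span {\<psi>, \<phi> + form_scale \<tau> \<psi>} \<subseteq> form.span {\<phi>, \<psi>}"
    unfolding form_span_pair by blast
  have "form_scale a \<phi> + form_scale b \<psi> = form_scale (b - a * \<tau>) \<psi> + form_scale a (\<phi> + form_scale \<tau> \<psi>)" for a b
    by (auto simp: fun_eq_iff algebra_simps)
  then show "form.span {\<phi>, \<psi>} \<subseteq> form.span {\<psi>, \<phi> + form_scale \<tau> \<psi>}"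
    unfolding form_span_pair by blast
qed

lemma pairs_over_moduli_PQ:
  "q \<in> pairs_over moduli_PQ \<longleftrightarrow> nonsingular_pencil (form.span {fst q, snd q})"
  by (auto simp: pairs_over_def moduli_PQ_def class_of_pair_def)

lemma nonsingular_pair_quadratic:
  "nonsingular_pencil (form.span {fst q, snd q}) \<Longrightarrow> q \<in> quadratic_pairs"
  by (auto simp: nonsingular_pencil_def pencil_def quadratic_pairs_iff form.span_base)

lemma nonsingular_pair_char_roots:
  assumes ns: "nonsingular_pencil (form.span {fst q, snd (q :: 'n::finite form \<times> 'n form)})"
    and c: "char_lead \<tau> q \<noteq> 0"
  obtains s where "char_roots \<tau> q s" "inj s" "pencil_roots (form.span {fst q, snd q}) s"
proof -
  note q = nonsingular_pair_quadratic[OF ns]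
  have nd: "nondegenerate (fst q + form_scale \<tau> (snd q))" using c char_lead_nonzero_iff[OF q] by blast
  then obtain s where s: "has_roots (snd q) (fst q + form_scale \<tau> (snd q)) s"
    using ns nonsingular_has_roots by (metis span_shift)
  then show ?thesis
    using has_roots_iff_char_roots[OF q] that span_shift unfolding pencil_roots_def by metis
qed

text \<open>Near a given pair, nonsingularity holds where the leading coefficient and the discriminant of the
characteristic polynomial are nonzero.\<close>

lemma moduli_open_moduli_PQ:
  assumes n: "CARD('n::finite) \<ge> 2"
  shows "moduli_open (moduli_PQ :: 'n form set set set)"
proof -
  have "\<exists>h. polynomial_on_pairs h \<and> h p \<noteq> 0 \<and> {q \<in> quadratic_pairs. h q \<noteq> 0} \<subseteq> pairs_over moduli_PQ"
    if p: "p \<in> pairs_over (moduli_PQ :: 'n form set set set)" for p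
  proof -
    have ns: "nonsingular_pencil (form.span {fst p, snd p})" using p by (simp add: pairs_over_moduli_PQ)
    obtain \<tau> where \<tau>: "nondegenerate (fst p + form_scale \<tau> (snd p))"
      using exists_nondegenerate_shift[OF ns] .
    obtain R where R: "polynomial_on_pairs R"
      "\<And>q s :: 'n \<Rightarrow> complex. char_roots \<tau> q s \<Longrightarrow> R q \<noteq> 0 \<longleftrightarrow> inj s"
      using discriminant_polynomial[of \<tau>] by metis
    let ?h = "\<lambda>q. char_lead \<tau> q * R q"
    have "polynomial_on_pairs ?h" by (intro polynomial_on_pairs.intros polynomial_on_pairs_char_lead R)
    moreover have "?h p \<noteq> 0"
    proof -
      have c: "char_lead \<tau> p \<noteq> 0" using \<tau> char_lead_nonzero_iff nonsingular_pair_quadratic[OF ns] by blast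
      obtain s where "char_roots \<tau> p s" "inj s" using nonsingular_pair_char_roots[OF ns c] by blast
      then show ?thesis using R(2) c by simp
    qed
    moreover have "q \<in> pairs_over moduli_PQ" if q: "q \<in> quadratic_pairs" and h: "?h q \<noteq> 0" for q
    proof -
      obtain s where s: "char_roots \<tau> q s" using h char_roots_exist by (metis mult_eq_0_iff)
      then have "inj s" using h R(2) by auto
      then have "has_roots (snd q) (fst q + form_scale \<tau> (snd q)) s"
        using has_roots_iff_char_roots[OF q] s by blast
      from has_roots_nonsingular[OF this n] show ?thesis
        unfolding span_shift pairs_over_moduli_PQ .
    qed
    ultimately show ?thesis by blast
  qed
  then show ?thesis
    using nonsingular_pair_quadratic unfolding moduli_open_def zariski_open_pairs_def
    by (auto simp: pairs_over_moduli_PQ)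
qed

text \<open>A symmetric Moebius invariant function of the roots depends only on the class of the pencil, by
\<open>moebius_equivalent_same_orbit\<close>. Locally it is a quotient of polynomials in the pair, by
\<open>symmetrisation_rational\<close>, so that it is regular on the whole moduli space.\<close>

lemma symmetric_invariant_regular:
  fixes g :: "('n::finite \<Rightarrow> complex) \<Rightarrow> complex"
  assumes n: "CARD('n) \<ge> 2" and g: "rat_fun g"
    and inv: "\<And>s a b c d. inj s \<Longrightarrow> a * d - b * c \<noteq> 0 \<Longrightarrow> (\<And>k. c * s k + d \<noteq> 0) \<Longrightarrow>
      g (\<lambda>k. (a * s k + b) / (c * s k + d)) = g s"
  obtains F where "\<And>m. m \<in> moduli_PQ \<Longrightarrow> F \<in> regular_germs m"
    "\<And>\<Phi> s. pencil_roots \<Phi> s \<Longrightarrow> F (orbit \<Phi>) = (\<Sum>\<sigma>\<in>{\<sigma> :: 'n \<Rightarrow> 'n. bij \<sigma>}. g (s \<circ> \<sigma>))"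
proof -
  define G where "G = (\<lambda>s :: 'n \<Rightarrow> complex. \<Sum>\<sigma>\<in>{\<sigma> :: 'n \<Rightarrow> 'n. bij \<sigma>}. g (s \<circ> \<sigma>))"
  have Geq: "G s' = G s" if equiv: "moebius_equivalent s s'" and injs: "inj s" for s s'
  proof -
    obtain a b c d \<pi> where "a * d - b * c \<noteq> 0 \<and> bij \<pi> \<and>
        (\<forall>k. c * s (\<pi> k) + d \<noteq> 0 \<and> s' k = (a * s (\<pi> k) + b) / (c * s (\<pi> k) + d))"
      using equiv unfolding moebius_equivalent_def by (elim exE)
    then have m: "a * d - b * c \<noteq> 0" "bij \<pi>"
      "\<And>k. c * s (\<pi> k) + d \<noteq> 0" "\<And>k. s' k = (a * s (\<pi> k) + b) / (c * s (\<pi> k) + d)" by blast+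
    have "G s' = (\<Sum>\<sigma>\<in>{\<sigma>. bij \<sigma>}. g (s \<circ> (\<pi> \<circ> \<sigma>)))"
      unfolding G_def
    proof (intro sum.cong refl)
      fix \<sigma> :: "'n \<Rightarrow> 'n" assume "\<sigma> \<in> {\<sigma>. bij \<sigma>}"
      then have "inj (s \<circ> (\<pi> \<circ> \<sigma>))" using injs m(2) by (simp add: inj_compose bij_is_inj)
      from inv[OF this m(1), of] m(3,4)
      show "g (s' \<circ> \<sigma>) = g (s \<circ> (\<pi> \<circ> \<sigma>))" by (simp add: comp_def)
    qed
    also have "\<dots> = G s"
      unfolding G_def
    proof (rule sum.reindex_bij_betw[where g = "\<lambda>\<sigma>. g (s \<circ> \<sigma>)"])
      show "bij_betw ((\<circ>) \<pi>) {\<sigma> :: 'n \<Rightarrow> 'n. bij \<sigma>} {\<sigma>. bij \<sigma>}"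
      proof (rule bij_betwI[where g = "(\<circ>) (inv \<pi>)"])
        have "inv \<pi> \<circ> \<pi> = id" "\<pi> \<circ> inv \<pi> = id"
          using m(2) by (auto simp: bij_def inv_o_cancel surj_iff)
        then have *: "inv \<pi> \<circ> (\<pi> \<circ> x) = x" "\<pi> \<circ> (inv \<pi> \<circ> x) = x" for x :: "'n \<Rightarrow> 'n"
          by (metis comp_assoc id_comp)+
        show "inv \<pi> \<circ> (\<pi> \<circ> x) = x" if "x \<in> {\<sigma>. bij \<sigma>}" for x :: "'n \<Rightarrow> 'n" by (rule *)
        show "\<pi> \<circ> (inv \<pi> \<circ> x) = x" if "x \<in> {\<sigma>. bij \<sigma>}" for x :: "'n \<Rightarrow> 'n" by (rule *)
      qed (use m(2) in \<open>auto intro: bij_comp bij_imp_bij_inv\<close>)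
    qed
    finally show ?thesis .
  qed
  define F where "F = (\<lambda>m. G (SOME s. \<exists>\<Phi>. m = orbit \<Phi> \<and> pencil_roots \<Phi> s))"
  have F: "F (orbit \<Phi>) = G s" if "pencil_roots \<Phi> s" for \<Phi> s
  proof -
    have "\<exists>\<Phi>'. orbit \<Phi> = orbit \<Phi>' \<and> pencil_roots \<Phi>' (SOME s. \<exists>\<Phi>'. orbit \<Phi> = orbit \<Phi>' \<and> pencil_roots \<Phi>' s)"
      by (rule someI[of "\<lambda>s. \<exists>\<Phi>'. orbit \<Phi> = orbit \<Phi>' \<and> pencil_roots \<Phi>' s" s]) (use that in blast)
    then have "moebius_equivalent s (SOME s. \<exists>\<Phi>'. orbit \<Phi> = orbit \<Phi>' \<and> pencil_roots \<Phi>' s)"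
      using moebius_equivalent_same_orbit[OF that _ _ n] by blast
    moreover have "inj s" using that by (auto simp: pencil_roots_def has_roots_def)
    ultimately show ?thesis unfolding F_def by (rule Geq)
  qed
  have "regular_on moduli_PQ F"
    unfolding regular_on_def
  proof
    fix p :: "'n form \<times> 'n form" assume "p \<in> pairs_over moduli_PQ"
    then have ns: "nonsingular_pencil (form.span {fst p, snd p})" by (simp add: pairs_over_moduli_PQ)
    obtain \<tau> where \<tau>: "nondegenerate (fst p + form_scale \<tau> (snd p))"
      using exists_nondegenerate_shift[OF ns] .
    obtain f h where fh: "polynomial_on_pairs f" "polynomial_on_pairs h"
      "\<And>q (s :: 'n \<Rightarrow> complex). char_roots \<tau> q s \<Longrightarrow> inj s \<Longrightarrow> h q \<noteq> 0 \<and> G s = f q / h q"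
      using symmetrisation_rational[OF g, of \<tau>] unfolding G_def by metis
    let ?f = "\<lambda>q. f q * char_lead \<tau> q" and ?h = "\<lambda>q. h q * char_lead \<tau> q"
    have "polynomial_on_pairs ?f" "polynomial_on_pairs ?h"
      by (intro polynomial_on_pairs.intros polynomial_on_pairs_char_lead fh)+
    moreover have "?h p \<noteq> 0"
    proof -
      have c: "char_lead \<tau> p \<noteq> 0" using \<tau> char_lead_nonzero_iff nonsingular_pair_quadratic[OF ns] by blast
      obtain s where "char_roots \<tau> p s" "inj s" using nonsingular_pair_char_roots[OF ns c] by blast
      then show ?thesis using fh(3) c by simp
    qed
    moreover have "F (class_of_pair q) = ?f q / ?h q" if q: "q \<in> pairs_over moduli_PQ" and h: "?h q \<noteq> 0" for q
    proof -
      have nsq: "nonsingular_pencil (form.span {fst q, snd q})" using q by (simp add: pairs_over_moduli_PQ)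
      have c: "char_lead \<tau> q \<noteq> 0" using h by auto
      obtain s where s: "char_roots \<tau> q s" "inj s" "pencil_roots (form.span {fst q, snd q}) s"
        using nonsingular_pair_char_roots[OF nsq c] .
      have "F (class_of_pair q) = G s" using F[OF s(3)] by (simp add: class_of_pair_def)
      also have "\<dots> = f q / h q" using fh(3)[OF s(1,2)] by simp
      finally show ?thesis using c by simp
    qed
    ultimately show "\<exists>f h. polynomial_on_pairs f \<and> polynomial_on_pairs h \<and> h p \<noteq> 0 \<and>
        (\<forall>q\<in>pairs_over moduli_PQ. h q \<noteq> 0 \<longrightarrow> F (class_of_pair q) = f q / h q)" by blast
  qed
  then have "F \<in> regular_germs m" if "m \<in> moduli_PQ" for m
    using that moduli_open_moduli_PQ[OF n] by (auto simp: regular_germs_def)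
  then show ?thesis using that[of F] F by (simp add: G_def)
qed

section \<open>Derivatives of regular germs along curves of diagonal pencils\<close>

lemma eventually_nhds_nonzero_cont:
  fixes f :: "complex \<Rightarrow> complex"
  assumes "isCont f 0" "f 0 \<noteq> 0"
  shows "eventually (\<lambda>t. f t \<noteq> 0) (nhds 0)"
proof -
  have "eventually (\<lambda>t. f t \<noteq> 0) (at 0)"
    using assms unfolding isCont_def by (rule tendsto_imp_eventually_ne)
  then show ?thesis using assms(2) by (simp add: eventually_nhds_conv_at)
qed

lemmas eventually_nhds_nonzero = eventually_nhds_nonzero_cont[OF DERIV_isCont]

text \<open>Only the value and the first derivative at \<open>0\<close> are prescribed: nothing else is known about
the motion of the roots along a curve, and nothing else affects the derivatives of regular germs.\<close>

definition curve_germ :: "('k \<Rightarrow> complex) \<Rightarrow> ('k \<Rightarrow> complex) \<Rightarrow> (complex \<Rightarrow> 'k \<Rightarrow> complex) \<Rightarrow> bool" where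
  "curve_germ s v \<sigma> \<longleftrightarrow> \<sigma> 0 = s \<and> (\<forall>k. ((\<lambda>t. \<sigma> t k) has_field_derivative v k) (at 0))"

abbreviation diag_pair :: "('k \<Rightarrow> complex) \<Rightarrow> 'k::finite form \<times> 'k form" where
  "diag_pair s \<equiv> (diag_form s, diag_form (\<lambda>_. 1))"

lemma polynomial_on_diag_pairs_derivative:
  assumes "polynomial_on_pairs f"
  obtains d where "\<And>\<sigma>. curve_germ s v \<sigma> \<Longrightarrow> ((\<lambda>t. f (diag_pair (\<sigma> t))) has_field_derivative d) (at 0)"
proof -
  have "\<exists>d. \<forall>\<sigma>. curve_germ s v \<sigma> \<longrightarrow> ((\<lambda>t. f (diag_pair (\<sigma> t))) has_field_derivative d) (at 0)"
    using assms
  proof (induction rule: polynomial_on_pairs.induct)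
    case (const c)
    show ?case by (auto intro!: exI[of _ 0])
  next
    case (entry_fst i j)
    have "polar (diag_form u) (axis i 1) (axis j 1) = (if i = j then u i else 0)" for u :: "'a \<Rightarrow> complex"
    proof -
      have "polar (diag_form u) (axis i 1) (axis j 1) = (\<Sum>k\<in>UNIV. if k = i then u i * axis j 1 $ i else 0)"
        unfolding polar_diag_form by (intro sum.cong) (auto simp: axis_def)
      then show ?thesis by (simp add: axis_def)
    qed
    then show ?case
      by (intro exI[of _ "if i = j then v i else 0"]) (auto simp: curve_germ_def)
  next
    case (entry_snd i j)
    show ?case by (intro exI[of _ 0]) (auto simp: curve_germ_def)
  next
    case (add f g)
    then obtain d d' where d: "\<And>\<sigma>. curve_germ s v \<sigma> \<Longrightarrow> ((\<lambda>t. f (diag_pair (\<sigma> t))) has_field_derivative d) (at 0)"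
      "\<And>\<sigma>. curve_germ s v \<sigma> \<Longrightarrow> ((\<lambda>t. g (diag_pair (\<sigma> t))) has_field_derivative d') (at 0)" by blast
    show ?case by (intro exI[of _ "d + d'"] allI impI DERIV_add d)
  next
    case (mult f g)
    then obtain d d' where d: "\<And>\<sigma>. curve_germ s v \<sigma> \<Longrightarrow> ((\<lambda>t. f (diag_pair (\<sigma> t))) has_field_derivative d) (at 0)"
      "\<And>\<sigma>. curve_germ s v \<sigma> \<Longrightarrow> ((\<lambda>t. g (diag_pair (\<sigma> t))) has_field_derivative d') (at 0)" by blast
    show ?case
    proof (intro exI allI impI)
      fix \<sigma> assume c: "curve_germ s v \<sigma>"
      then have "\<sigma> 0 = s" by (simp add: curve_germ_def)
      then show "((\<lambda>t. f (diag_pair (\<sigma> t)) * g (diag_pair (\<sigma> t))) has_field_derivative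
          d * g (diag_pair s) + d' * f (diag_pair s)) (at 0)"
        using DERIV_mult[OF d(1)[OF c] d(2)[OF c]] by simp
    qed
  qed
  then show ?thesis using that by blast
qed

text \<open>Near the given pencil, a germ is a quotient of polynomials evaluated on the diagonal pairs, and the
chain rule applies.\<close>

lemma regular_germ_derivative_depends_on_velocity:
  fixes s :: "'n::finite \<Rightarrow> complex"
  assumes n: "CARD('n) \<ge> 2" and s: "inj s" and F: "F \<in> regular_germs (orbit (diag_pencil s))"
  obtains d where "\<And>\<sigma>. curve_germ s v \<sigma> \<Longrightarrow>
    ((\<lambda>t. F (orbit (diag_pencil (\<sigma> t)))) has_field_derivative d) (at 0)"
proof -
  obtain U where U: "moduli_open U" "orbit (diag_pencil s) \<in> U" "regular_on U F"
    using F by (auto simp: regular_germs_def)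
  have p: "diag_pair s \<in> pairs_over U"
    using U(2) has_roots_nonsingular[OF has_roots_diag[OF s] n] by (simp add: pairs_over_def class_of_pair_def)
  obtain h' where h': "polynomial_on_pairs h'" "h' (diag_pair s) \<noteq> 0"
    "{q \<in> quadratic_pairs. h' q \<noteq> 0} \<subseteq> pairs_over U"
    using U(1) p unfolding moduli_open_def zariski_open_pairs_def by blast
  obtain f h where fh: "polynomial_on_pairs f" "polynomial_on_pairs h" "h (diag_pair s) \<noteq> 0"
    "\<And>q. q \<in> pairs_over U \<Longrightarrow> h q \<noteq> 0 \<Longrightarrow> F (class_of_pair q) = f q / h q"
    using U(3) p unfolding regular_on_def by blast
  obtain df where df: "\<And>\<sigma>. curve_germ s v \<sigma> \<Longrightarrow> ((\<lambda>t. f (diag_pair (\<sigma> t))) has_field_derivative df) (at 0)"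
    using polynomial_on_diag_pairs_derivative[OF fh(1)] by blast
  obtain dh where dh: "\<And>\<sigma>. curve_germ s v \<sigma> \<Longrightarrow> ((\<lambda>t. h (diag_pair (\<sigma> t))) has_field_derivative dh) (at 0)"
    using polynomial_on_diag_pairs_derivative[OF fh(2)] by blast
  obtain dh' where dh': "\<And>\<sigma>. curve_germ s v \<sigma> \<Longrightarrow> ((\<lambda>t. h' (diag_pair (\<sigma> t))) has_field_derivative dh') (at 0)"
    using polynomial_on_diag_pairs_derivative[OF h'(1)] by blast
  let ?d = "(df * h (diag_pair s) - f (diag_pair s) * dh) / (h (diag_pair s) * h (diag_pair s))"
  have "((\<lambda>t. F (orbit (diag_pencil (\<sigma> t)))) has_field_derivative ?d) (at 0)" if c: "curve_germ s v \<sigma>" for \<sigma>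
  proof -
    have s0: "\<sigma> 0 = s" using c by (simp add: curve_germ_def)
    have "eventually (\<lambda>t. h (diag_pair (\<sigma> t)) \<noteq> 0) (nhds 0)" "eventually (\<lambda>t. h' (diag_pair (\<sigma> t)) \<noteq> 0) (nhds 0)"
      using eventually_nhds_nonzero[OF dh[OF c]] eventually_nhds_nonzero[OF dh'[OF c]] fh(3) h'(2) s0 by simp_all
    then have ev: "eventually (\<lambda>t. F (orbit (diag_pencil (\<sigma> t))) = f (diag_pair (\<sigma> t)) / h (diag_pair (\<sigma> t))) (nhds 0)"
    proof eventually_elim
      case (elim t)
      have "diag_pair (\<sigma> t) \<in> pairs_over U"
        using h'(3) elim by (auto simp: quadratic_pairs_def quadratic_form_diag_form)
      from fh(4)[OF this elim(1)] show ?case by (simp add: class_of_pair_def)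
    qed
    have "((\<lambda>t. f (diag_pair (\<sigma> t)) / h (diag_pair (\<sigma> t))) has_field_derivative ?d) (at 0)"
      using DERIV_divide[OF df[OF c] dh[OF c]] fh(3) s0 by simp
    then show ?thesis using DERIV_cong_ev[OF refl ev refl] by blast
  qed
  then show ?thesis by (rule that)
qed

text \<open>The velocity is realised by the curve of Moebius transformations
\<open>s \<mapsto> ((1 + t b) s + t a) / (1 - t c s)\<close> applied to the roots, along which the class of the pencil
is constant. By the preceding lemma the derivative is the same along every curve with this velocity.\<close>

lemma regular_germ_derivative_moebius:
  fixes s :: "'n::finite \<Rightarrow> complex"
  assumes n: "CARD('n) \<ge> 2" and s: "inj s" and F: "F \<in> regular_germs (orbit (diag_pencil s))"
    and c: "curve_germ s (\<lambda>k. a + b * s k + c * (s k)\<^sup>2) \<sigma>"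
  shows "((\<lambda>t. F (orbit (diag_pencil (\<sigma> t)))) has_field_derivative 0) (at 0)"
proof -
  let ?v = "\<lambda>k. a + b * s k + c * (s k)\<^sup>2"
  obtain d where d: "\<And>\<sigma>. curve_germ s ?v \<sigma> \<Longrightarrow>
    ((\<lambda>t. F (orbit (diag_pencil (\<sigma> t)))) has_field_derivative d) (at 0)"
    using regular_germ_derivative_depends_on_velocity[OF n s F] by blast
  define \<mu> where "\<mu> = (\<lambda>t k. ((1 + t * b) * s k + t * a) / ((- t * c) * s k + 1))"
  have cm: "curve_germ s ?v \<mu>"
    unfolding curve_germ_def
  proof (intro conjI allI)
    show "\<mu> 0 = s" by (simp add: \<mu>_def)
    fix k
    show "((\<lambda>t. \<mu> t k) has_field_derivative ?v k) (at 0)"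
      unfolding \<mu>_def by (auto intro!: derivative_eq_intros simp: power2_eq_square algebra_simps)
  qed
  have "eventually (\<lambda>t. (1 + t * b) * 1 - t * a * (- t * c) \<noteq> 0) (nhds 0)"
    by (rule eventually_nhds_nonzero) (auto intro!: derivative_eq_intros)
  moreover have "eventually (\<lambda>t. \<forall>k. (- t * c) * s k + 1 \<noteq> 0) (nhds 0)"
    by (intro eventually_all_finite eventually_nhds_nonzero) (auto intro!: derivative_eq_intros)
  ultimately have ev: "eventually (\<lambda>t. F (orbit (diag_pencil (\<mu> t))) = F (orbit (diag_pencil s))) (nhds 0)"
  proof eventually_elim
    case (elim t)
    then have "- t * c * s k + 1 \<noteq> 0" for k by blast
    from orbit_diag_moebius[OF elim(1) this] show ?case unfolding \<mu>_def by (rule arg_cong)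
  qed
  have "((\<lambda>t. F (orbit (diag_pencil (\<mu> t)))) has_field_derivative 0) (at 0)"
    using DERIV_cong_ev[OF refl ev refl] by simp
  then have "d = 0" using d[OF cm] DERIV_unique by blast
  then show ?thesis using d[OF c] by simp
qed

section \<open>Cross ratios\<close>

lemma curve_germ_eventually_inj:
  fixes s :: "'k::finite \<Rightarrow> complex"
  assumes c: "curve_germ s v \<sigma>" and s: "inj s"
  shows "eventually (\<lambda>t. inj (\<sigma> t)) (nhds 0)"
proof -
  have "eventually (\<lambda>t. i \<noteq> j \<longrightarrow> \<sigma> t i - \<sigma> t j \<noteq> 0) (nhds 0)" for i j
  proof (cases "i = j")
    case False
    have "((\<lambda>t. \<sigma> t i - \<sigma> t j) has_field_derivative v i - v j) (at 0)" "\<sigma> 0 i - \<sigma> 0 j \<noteq> 0"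
      using c s False by (auto simp: curve_germ_def inj_eq intro: DERIV_diff)
    then have "eventually (\<lambda>t. \<sigma> t i - \<sigma> t j \<noteq> 0) (nhds 0)" by (rule eventually_nhds_nonzero)
    then show ?thesis by eventually_elim simp
  qed simp
  then have "eventually (\<lambda>t. \<forall>i j. i \<noteq> j \<longrightarrow> \<sigma> t i - \<sigma> t j \<noteq> 0) (nhds 0)"
    by (intro eventually_all_finite)
  then show ?thesis by eventually_elim (auto simp: inj_def)
qed

locale base_points =
  fixes i1 i2 i3 :: "'n::finite"
  assumes distinct: "i1 \<noteq> i2" "i1 \<noteq> i3" "i2 \<noteq> i3"
begin

text \<open>The cross ratio of \<open>s k\<close> and three base points. The definition covers \<open>k = i3\<close>, where the true value is infinite: there it is
\<open>0\<close> by division by zero, which is Moebius invariant as well.\<close>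

definition cr :: "('n \<Rightarrow> complex) \<Rightarrow> 'n \<Rightarrow> complex" where
  "cr s k = ((s k - s i1) * (s i2 - s i3)) / ((s k - s i3) * (s i2 - s i1))"

lemma cr_i3: "cr s i3 = 0"
  by (simp add: cr_def)

lemma rat_fun_cr: "rat_fun (\<lambda>s. cr s k)"
proof (cases "k = i3")
  case True
  then show ?thesis by (simp add: cr_i3 rat_fun_poly poly_fun_const)
next
  case False
  have "rat_fun (\<lambda>s. ((s k - s i1) * (s i2 - s i3)) * (1 / (s k - s i3) * (1 / (s i2 - s i1))))"
    using False distinct
    by (intro rat_fun_mult rat_fun_poly poly_fun_diff poly_fun_coord rat_fun_inverse_difference) auto
  then show ?thesis by (simp add: cr_def[abs_def])
qed

lemma cr_moebius:
  assumes det: "a * d - b * c \<noteq> 0" and ne: "\<And>k. c * s k + d \<noteq> 0"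
  shows "cr (\<lambda>k. (a * s k + b) / (c * s k + d)) k = cr s k"
proof -
  define r where "r = (\<lambda>i. 1 / (c * s i + d))"
  have r: "r i \<noteq> 0" for i using ne by (simp add: r_def)
  have diff: "(a * s i + b) / (c * s i + d) - (a * s j + b) / (c * s j + d) =
      (a * d - b * c) * r i * r j * (s i - s j)" for i j
    using ne[of i] ne[of j] by (simp add: r_def divide_simps) (simp add: algebra_simps)
  define D where "D = a * d - b * c"
  define e where "e = D * D * r k * r i1 * r i2 * r i3"
  have "e \<noteq> 0" using det r by (simp add: e_def D_def)
  have eqs: "D * r k * r i1 * x * (D * r i2 * r i3 * y) = e * (x * y)"
    "D * r k * r i3 * x * (D * r i2 * r i1 * y) = e * (x * y)" for x y
    by (simp_all add: e_def mult_ac)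
  show ?thesis
    unfolding cr_def diff D_def[symmetric] eqs using \<open>e \<noteq> 0\<close> by (rule mult_divide_mult_cancel_left)
qed

text \<open>Solving the equation between cross ratios for \<open>s' k\<close> gives a Moebius transformation of \<open>s k\<close>.\<close>

lemma cr_determines_moebius:
  assumes s: "inj s" and s': "inj s'" and eq: "\<And>k. cr s' k = cr s k"
  obtains a b c d where "a * d - b * c \<noteq> 0" "\<And>k. c * s k + d \<noteq> 0 \<and> s' k = (a * s k + b) / (c * s k + d)"
proof -
  let ?A = "s i1" and ?B = "s i2" and ?C = "s i3" and ?A' = "s' i1" and ?B' = "s' i2" and ?C' = "s' i3"
  have ne: "?A \<noteq> ?B" "?A \<noteq> ?C" "?B \<noteq> ?C" "?A' \<noteq> ?B'" "?A' \<noteq> ?C'" "?B' \<noteq> ?C'"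
    using s s' distinct by (auto simp: inj_eq)
  \<comment> \<open>These are the factors from cross-multiplying the two cross ratios:
  \<open>p (s k - A) (s' k - C') = m (s k - C) (s' k - A')\<close>.\<close>
  define p where "p = (?B - ?C) * (?B' - ?A')"
  define m where "m = (?B - ?A) * (?B' - ?C')"
  have pm: "p \<noteq> 0" "m \<noteq> 0" using ne by (auto simp: p_def m_def)
  let ?a = "p * ?C' - m * ?A'" and ?b = "- p * ?A * ?C' + m * ?C * ?A'"
    and ?c = "p - m" and ?d = "- p * ?A + m * ?C"
  have "?a * ?d - ?b * ?c = p * m * (?C - ?A) * (?C' - ?A')" by (simp add: algebra_simps)
  then have det: "?a * ?d - ?b * ?c \<noteq> 0" using pm ne by auto
  have key: "s' k * (?c * s k + ?d) = ?a * s k + ?b" for k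
  proof (cases "k = i3")
    case True
    then show ?thesis by (simp add: algebra_simps)
  next
    case False
    then have k: "s k - ?C \<noteq> 0" "s' k - ?C' \<noteq> 0" using s s' by (auto simp: inj_eq)
    have "p * (s k - ?A) * (s' k - ?C') = m * (s k - ?C) * (s' k - ?A')"
      using eq[of k] k ne by (simp add: cr_def p_def m_def divide_simps) (simp add: algebra_simps)
    then show ?thesis by (simp add: algebra_simps)
  qed
  have "?c * s k + ?d \<noteq> 0" for k
  proof
    assume 0: "?c * s k + ?d = 0"
    then have "?a * s k + ?b = 0" using key[of k] by simp
    then have "?c * (?a * s k + ?b) - ?a * (?c * s k + ?d) = 0" using 0 by simp
    then have "?a * ?d - ?b * ?c = 0" by (simp add: algebra_simps)
    then show False using det by contradiction
  qed
  then have "?c * s k + ?d \<noteq> 0 \<and> s' k = (?a * s k + ?b) / (?c * s k + ?d)" for k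
    using key[of k] by (simp add: nonzero_eq_divide_eq)
  then show ?thesis by (rule that[OF det])
qed

text \<open>Written as a logarithmic derivative.\<close>

definition cr_velocity :: "('n \<Rightarrow> complex) \<Rightarrow> ('n \<Rightarrow> complex) \<Rightarrow> 'n \<Rightarrow> complex" where
  "cr_velocity s v k = cr s k * ((v k - v i1) / (s k - s i1) + (v i2 - v i3) / (s i2 - s i3)
     - (v k - v i3) / (s k - s i3) - (v i2 - v i1) / (s i2 - s i1))"

lemma quotient_log_derivative:
  fixes N E n e :: complex
  assumes "N \<noteq> 0" "E \<noteq> 0"
  shows "(n * E - N * e) / (E * E) = N / E * (n / N - e / E)"
  using assms by (simp add: field_simps)

lemma cr_derivative:
  assumes s: "inj s" and c: "curve_germ s v \<sigma>" and k: "k \<noteq> i1" "k \<noteq> i3"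
  shows "((\<lambda>t. cr (\<sigma> t) k) has_field_derivative cr_velocity s v k) (at 0)"
proof -
  have s0: "\<sigma> 0 = s" and d: "((\<lambda>t. \<sigma> t j) has_field_derivative v j) (at 0)" for j
    using c by (auto simp: curve_germ_def)
  have ne: "s k - s i1 \<noteq> 0" "s k - s i3 \<noteq> 0" "s i2 - s i1 \<noteq> 0" "s i2 - s i3 \<noteq> 0"
    using s k distinct by (auto simp: inj_eq)
  let ?n = "(v k - v i1) * (s i2 - s i3) + (v i2 - v i3) * (s k - s i1)"
  let ?e = "(v k - v i3) * (s i2 - s i1) + (v i2 - v i1) * (s k - s i3)"
  let ?N = "(s k - s i1) * (s i2 - s i3)" and ?E = "(s k - s i3) * (s i2 - s i1)"
  have n: "((\<lambda>t. (\<sigma> t k - \<sigma> t i1) * (\<sigma> t i2 - \<sigma> t i3)) has_field_derivative ?n) (at 0)"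
    using DERIV_mult[OF DERIV_diff[OF d[of k] d[of i1]] DERIV_diff[OF d[of i2] d[of i3]]] by (simp add: s0)
  have e: "((\<lambda>t. (\<sigma> t k - \<sigma> t i3) * (\<sigma> t i2 - \<sigma> t i1)) has_field_derivative ?e) (at 0)"
    using DERIV_mult[OF DERIV_diff[OF d[of k] d[of i3]] DERIV_diff[OF d[of i2] d[of i1]]] by (simp add: s0)
  have "((\<lambda>t. cr (\<sigma> t) k) has_field_derivative (?n * ?E - ?N * ?e) / (?E * ?E)) (at 0)"
    unfolding cr_def using DERIV_divide[OF n e] ne by (simp add: s0)
  also have "(?n * ?E - ?N * ?e) / (?E * ?E) = ?N / ?E * (?n / ?N - ?e / ?E)"
    by (rule quotient_log_derivative) (use ne in auto)
  also have "?n / ?N = (v k - v i1) / (s k - s i1) + (v i2 - v i3) / (s i2 - s i3)"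
    using ne by (simp add: add_divide_distrib)
  also have "?e / ?E = (v k - v i3) / (s k - s i3) + (v i2 - v i1) / (s i2 - s i1)"
    using ne by (simp add: add_divide_distrib)
  finally show ?thesis unfolding cr_velocity_def cr_def by (simp only: diff_diff_eq)
qed

lemma cr_differentiable:
  assumes s: "inj s" and c: "curve_germ s v \<sigma>"
  obtains d where "((\<lambda>t. cr (\<sigma> t) k) has_field_derivative d) (at 0)"
proof -
  consider "k = i1" | "k = i3" | "k \<noteq> i1" "k \<noteq> i3" by blast
  then show ?thesis
  proof cases
    case 3
    then show ?thesis using cr_derivative[OF s c] that by blast
  qed (use that[of 0] in \<open>simp_all add: cr_def\<close>)
qed

text \<open>Interpolate the velocities of the three base points by a quadratic polynomial \<open>Q\<close>. The difference
of \<open>v\<close> and \<open>Q\<close> does not move the base points, nor does it change the cross ratios, as \<open>Q\<close> is an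
infinitesimal Moebius transformation. Hence it does not move any other point either.\<close>

lemma moebius_field_of_cr_velocity_zero:
  assumes s: "inj s" and 0: "\<And>k. k \<noteq> i1 \<Longrightarrow> k \<noteq> i3 \<Longrightarrow> cr_velocity s v k = 0"
  obtains a b c where "\<And>k. v k = a + b * s k + c * (s k)\<^sup>2"
proof -
  have ne: "s i2 - s i1 \<noteq> 0" "s i3 - s i1 \<noteq> 0" "s i3 - s i2 \<noteq> 0"
    using s distinct by (auto simp: inj_eq)
  \<comment> \<open>Newton interpolation: \<open>p\<close> and \<open>r\<close> are the divided differences.\<close>
  define p where "p = (v i2 - v i1) / (s i2 - s i1)"
  define r where "r = ((v i3 - v i1) / (s i3 - s i1) - p) / (s i3 - s i2)"
  define Q where "Q = (\<lambda>z. v i1 + p * (z - s i1) + r * (z - s i1) * (z - s i2))"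
  have Q1: "Q (s i1) = v i1" by (simp add: Q_def)
  have Q2: "Q (s i2) = v i2" using ne by (simp add: Q_def p_def)
  have "r * (s i3 - s i2) = (v i3 - v i1) / (s i3 - s i1) - p" using ne by (simp add: r_def)
  then have "(p + r * (s i3 - s i2)) * (s i3 - s i1) = v i3 - v i1" using ne by simp
  then have Q3: "Q (s i3) = v i3" by (simp add: Q_def algebra_simps)
  have quot: "(Q x - Q y) / (x - y) = p + r * (x + y - s i1 - s i2)" if "x \<noteq> y" for x y
  proof -
    have "Q x - Q y = (p + r * (x + y - s i1 - s i2)) * (x - y)" by (simp add: Q_def algebra_simps)
    then show ?thesis using that by simp
  qed
  have vQ: "v k = Q (s k)" for k
  proof (cases "k = i1 \<or> k = i2 \<or> k = i3")
    case True
    then show ?thesis using Q1 Q2 Q3 by auto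
  next
    case False
    then have k: "k \<noteq> i1" "k \<noteq> i3" "k \<noteq> i2" by auto
    have nk: "s k - s i1 \<noteq> 0" "s k - s i3 \<noteq> 0" using s k by (auto simp: inj_eq)
    have "cr s k \<noteq> 0" unfolding cr_def using nk ne by auto
    then have sum0: "(v k - v i1) / (s k - s i1) + (v i2 - v i3) / (s i2 - s i3)
     - (v k - v i3) / (s k - s i3) - (v i2 - v i1) / (s i2 - s i1) = 0"
      using 0[OF k(1,2)] by (simp add: cr_velocity_def)
    have "(Q (s k) - Q (s i1)) / (s k - s i1) + (Q (s i2) - Q (s i3)) / (s i2 - s i3)
     - (Q (s k) - Q (s i3)) / (s k - s i3) - (Q (s i2) - Q (s i1)) / (s i2 - s i1) = 0"
      using nk ne by (subst quot, force)+ (simp add: algebra_simps)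
    then have "(Q (s k) - v i1) / (s k - s i1) + (v i2 - v i3) / (s i2 - s i3)
     - (Q (s k) - v i3) / (s k - s i3) - (v i2 - v i1) / (s i2 - s i1) = 0"
      by (simp only: Q1 Q2 Q3)
    with sum0 have "(v k - Q (s k)) / (s k - s i1) = (v k - Q (s k)) / (s k - s i3)"
      by (simp add: diff_divide_distrib) algebra
    then have "(v k - Q (s k)) * (s k - s i3) = (v k - Q (s k)) * (s k - s i1)"
      using iffD1[OF frac_eq_eq[OF nk]] by blast
    then have "(v k - Q (s k)) * (s i1 - s i3) = 0" by (simp add: algebra_simps)
    then show ?thesis using ne by auto
  qed
  have "Q z = (v i1 - p * s i1 + r * s i1 * s i2) + (p - r * (s i1 + s i2)) * z + r * z\<^sup>2" for z
    by (simp add: Q_def power2_eq_square algebra_simps)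
  from vQ[unfolded this] have "v k = (v i1 - p * s i1 + r * s i1 * s i2) + (p - r * (s i1 + s i2)) * s k + r * (s k)\<^sup>2" for k .
  then show ?thesis by (rule that)
qed

end

text \<open>The trivial automorphism condition on a pencil, in terms of its roots.\<close>

definition moebius_rigid :: "('k \<Rightarrow> complex) \<Rightarrow> bool" where
  "moebius_rigid s \<longleftrightarrow> (\<forall>a d b c \<pi>. a * d - b * c \<noteq> 0 \<and> bij \<pi> \<and>
     (\<forall>k. c * s k + d \<noteq> 0 \<and> s (\<pi> k) = (a * s k + b) / (c * s k + d)) \<longrightarrow> \<pi> = id)"

text \<open>Some cross ratio moves with nonzero speed, but it has to be made symmetric. The permutations of \<open>s\<close>
are pairwise distinct modulo Moebius transformations. So there is a polynomial \<open>g\<close> in cross ratios that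
to first order behaves like the moving one at \<open>s\<close> and vanishes to second order at the nontrivial
permutations of \<open>s\<close>. To first order, its symmetrisation at \<open>s\<close> is \<open>g\<close>.\<close>

lemma regular_function_detecting_velocity:
  fixes s :: "'n::finite \<Rightarrow> complex"
  assumes n: "CARD('n) \<ge> 3" and s: "inj s"
    and rigid: "moebius_rigid s"
    and v: "\<And>a b c. \<not> (\<forall>k. v k = a + b * s k + c * (s k)\<^sup>2)"
  obtains F d where "\<And>m. m \<in> moduli_PQ \<Longrightarrow> F \<in> regular_germs m" "d \<noteq> 0"
    "\<And>\<sigma>. curve_germ s v \<sigma> \<Longrightarrow> ((\<lambda>t. F (orbit (diag_pencil (\<sigma> t)))) has_field_derivative d) (at 0)"
proof -
  obtain S :: "'n set" where "card S = 3" using obtain_subset_with_card_n[OF n] by blast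
  then obtain i1 i2 i3 :: 'n where i: "i1 \<noteq> i2" "i1 \<noteq> i3" "i2 \<noteq> i3" by (auto simp: card_3_iff)
  interpret base_points i1 i2 i3 by unfold_locales (fact i)+
  obtain k0 where k0: "k0 \<noteq> i1" "k0 \<noteq> i3" "cr_velocity s v k0 \<noteq> 0"
    using moebius_field_of_cr_velocity_zero[OF s, of v] v by metis
  let ?\<Pi> = "{\<pi> :: 'n \<Rightarrow> 'n. bij \<pi> \<and> \<pi> \<noteq> id}"
  have "\<exists>k. cr (s \<circ> \<pi>) k \<noteq> cr s k" if "\<pi> \<in> ?\<Pi>" for \<pi>
  proof (rule ccontr)
    assume eq: "\<not> ?thesis"
    have "inj (s \<circ> \<pi>)" using that s by (simp add: inj_compose bij_is_inj)
    moreover have "cr (s \<circ> \<pi>) k = cr s k" for k using eq by blast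
    ultimately obtain a b c d where m: "a * d - b * c \<noteq> 0"
      "\<And>k. c * s k + d \<noteq> 0 \<and> (s \<circ> \<pi>) k = (a * s k + b) / (c * s k + d)"
      by (rule cr_determines_moebius[OF s]) (rule that)
    have "\<pi> = id"
      by (rule rigid[unfolded moebius_rigid_def, rule_format, of a d b c]) (use that m in auto)
    then show False using that by simp
  qed
  \<comment> \<open>The cross ratio at \<open>\<kappa> \<pi>\<close> tells \<open>s \<circ> \<pi>\<close> from \<open>s\<close>.\<close>
  then obtain \<kappa> where \<kappa>: "\<And>\<pi>. \<pi> \<in> ?\<Pi> \<Longrightarrow> cr (s \<circ> \<pi>) (\<kappa> \<pi>) \<noteq> cr s (\<kappa> \<pi>)"
    using bchoice[of ?\<Pi> "\<lambda>\<pi> k. cr (s \<circ> \<pi>) k \<noteq> cr s k"] by blast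
  define g where "g = (\<lambda>u. (cr u k0 - cr s k0) * (\<Prod>\<pi>\<in>?\<Pi>. (cr u (\<kappa> \<pi>) - cr (s \<circ> \<pi>) (\<kappa> \<pi>))\<^sup>2))"
  have rat: "rat_fun (\<lambda>u. cr u k - e)" for k e
    using rat_fun_add[OF rat_fun_cr[of k] rat_fun_poly[OF poly_fun_const[of "- e"]]] by simp
  have ratg: "rat_fun g"
    unfolding g_def power2_eq_square by (intro rat_fun_mult rat_fun_prod rat)
  have inv: "g (\<lambda>k. (a * u k + b) / (c * u k + d)) = g u"
    if "inj u" "a * d - b * c \<noteq> 0" "\<And>k. c * u k + d \<noteq> 0" for u a b c d
    unfolding g_def using cr_moebius[OF that(2,3)] by simp
  have n2: "CARD('n) \<ge> 2" using n by simp
  obtain F where F: "\<And>m. m \<in> moduli_PQ \<Longrightarrow> F \<in> regular_germs m"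
    "\<And>\<Phi> s. pencil_roots \<Phi> s \<Longrightarrow> F (orbit \<Phi>) = (\<Sum>\<sigma>\<in>{\<sigma> :: 'n \<Rightarrow> 'n. bij \<sigma>}. g (s \<circ> \<sigma>))"
    by (rule symmetric_invariant_regular[OF n2 ratg inv]) blast+
  define P where "P = (\<Prod>\<pi>\<in>?\<Pi>. (cr s (\<kappa> \<pi>) - cr (s \<circ> \<pi>) (\<kappa> \<pi>))\<^sup>2)"
  have "(cr s (\<kappa> \<pi>) - cr (s \<circ> \<pi>) (\<kappa> \<pi>))\<^sup>2 \<noteq> 0" if "\<pi> \<in> ?\<Pi>" for \<pi>
    using \<kappa>[OF that] by (metis eq_iff_diff_eq_0 power_eq_0_iff)
  then have P: "P \<noteq> 0" unfolding P_def by (simp add: prod_zero_iff)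
  have "((\<lambda>t. F (orbit (diag_pencil (\<sigma> t)))) has_field_derivative cr_velocity s v k0 * P) (at 0)"
    if c: "curve_germ s v \<sigma>" for \<sigma>
  proof -
    have s0: "\<sigma> 0 = s" using c by (simp add: curve_germ_def)
    have c': "curve_germ (s \<circ> \<pi>) (v \<circ> \<pi>) (\<lambda>t. \<sigma> t \<circ> \<pi>)" for \<pi>
      using c by (auto simp: curve_germ_def)
    have df: "\<exists>d. ((\<lambda>t. cr (\<sigma> t \<circ> \<pi>) k - e) has_field_derivative d) (at 0)" if "bij \<pi>" for \<pi> k e
    proof -
      have "inj (s \<circ> \<pi>)" using that s by (simp add: inj_compose bij_is_inj)
      from cr_differentiable[OF this c'[of \<pi>], of k]
      obtain d where d: "((\<lambda>t. cr (\<sigma> t \<circ> \<pi>) k) has_field_derivative d) (at 0)" .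
      from DERIV_diff[OF d DERIV_const] show ?thesis by blast
    qed
    have dprod: "\<exists>d. ((\<lambda>t. \<Prod>\<pi>\<in>A. (cr (\<sigma> t \<circ> \<rho>) (\<kappa> \<pi>) - cr (s \<circ> \<pi>) (\<kappa> \<pi>))\<^sup>2) has_field_derivative d) (at 0)"
      if \<rho>: "bij \<rho>" for \<rho> and A :: "('n \<Rightarrow> 'n) set"
    proof (induction A rule: infinite_finite_induct)
      case (insert \<pi> A)
      obtain d where d: "((\<lambda>t. \<Prod>\<pi>\<in>A. (cr (\<sigma> t \<circ> \<rho>) (\<kappa> \<pi>) - cr (s \<circ> \<pi>) (\<kappa> \<pi>))\<^sup>2) has_field_derivative d) (at 0)"
        using insert by blast
      obtain d' where d': "((\<lambda>t. cr (\<sigma> t \<circ> \<rho>) (\<kappa> \<pi>) - cr (s \<circ> \<pi>) (\<kappa> \<pi>)) has_field_derivative d') (at 0)"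
        using df[OF \<rho>] by blast
      show ?case
        unfolding prod.insert[OF insert(1,2)] power2_eq_square
        using DERIV_mult[OF DERIV_mult[OF d' d'] d[unfolded power2_eq_square]] by (rule exI)
    qed (auto intro!: exI[of _ 0])
    have "((\<lambda>t. g (\<sigma> t \<circ> id)) has_field_derivative cr_velocity s v k0 * P) (at 0)"
    proof -
      obtain d where d: "((\<lambda>t. \<Prod>\<pi>\<in>?\<Pi>. (cr (\<sigma> t \<circ> id) (\<kappa> \<pi>) - cr (s \<circ> \<pi>) (\<kappa> \<pi>))\<^sup>2) has_field_derivative d) (at 0)"
        using dprod[OF bij_id] by blast
      have "((\<lambda>t. cr (\<sigma> t) k0 - cr s k0) has_field_derivative cr_velocity s v k0 - 0) (at 0)"
        by (intro DERIV_diff DERIV_const cr_derivative[OF s c k0(1,2)])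
      from DERIV_mult[OF this d] show ?thesis
        unfolding g_def by (simp add: s0 P_def)
    qed
    moreover have "((\<lambda>t. g (\<sigma> t \<circ> \<rho>)) has_field_derivative 0) (at 0)" if \<rho>: "\<rho> \<in> ?\<Pi>" for \<rho>
    proof -
      have b: "bij \<rho>" using \<rho> by simp
      let ?L = "\<lambda>t. cr (\<sigma> t \<circ> \<rho>) (\<kappa> \<rho>) - cr (s \<circ> \<rho>) (\<kappa> \<rho>)"
      obtain d1 where d1: "((\<lambda>t. cr (\<sigma> t \<circ> \<rho>) k0 - cr s k0) has_field_derivative d1) (at 0)" using df[OF b] by blast
      obtain d2 where d2: "(?L has_field_derivative d2) (at 0)" using df[OF b] by blast
      obtain d3 where d3: "((\<lambda>t. \<Prod>\<pi>\<in>?\<Pi> - {\<rho>}. (cr (\<sigma> t \<circ> \<rho>) (\<kappa> \<pi>) - cr (s \<circ> \<pi>) (\<kappa> \<pi>))\<^sup>2) has_field_derivative d3) (at 0)"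
        using dprod[OF b] by blast
      have "(\<lambda>t. g (\<sigma> t \<circ> \<rho>)) = (\<lambda>t. ((cr (\<sigma> t \<circ> \<rho>) k0 - cr s k0) *
          (\<Prod>\<pi>\<in>?\<Pi> - {\<rho>}. (cr (\<sigma> t \<circ> \<rho>) (\<kappa> \<pi>) - cr (s \<circ> \<pi>) (\<kappa> \<pi>))\<^sup>2)) * (?L t * ?L t))"
      proof
        fix t
        have "(\<Prod>\<pi>\<in>?\<Pi>. (cr (\<sigma> t \<circ> \<rho>) (\<kappa> \<pi>) - cr (s \<circ> \<pi>) (\<kappa> \<pi>))\<^sup>2) =
          (?L t)\<^sup>2 * (\<Prod>\<pi>\<in>?\<Pi> - {\<rho>}. (cr (\<sigma> t \<circ> \<rho>) (\<kappa> \<pi>) - cr (s \<circ> \<pi>) (\<kappa> \<pi>))\<^sup>2)"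
          by (rule prod.remove[OF finite \<rho>])
        then show "g (\<sigma> t \<circ> \<rho>) = ((cr (\<sigma> t \<circ> \<rho>) k0 - cr s k0) *
          (\<Prod>\<pi>\<in>?\<Pi> - {\<rho>}. (cr (\<sigma> t \<circ> \<rho>) (\<kappa> \<pi>) - cr (s \<circ> \<pi>) (\<kappa> \<pi>))\<^sup>2)) * (?L t * ?L t)"
          unfolding g_def by (simp only: power2_eq_square mult_ac)
      qed
      moreover have "?L 0 = 0" by (simp add: s0)
      ultimately show ?thesis
        using DERIV_mult[OF DERIV_mult[OF d1 d3] DERIV_mult[OF d2 d2]] by simp
    qed
    moreover have "{\<sigma> :: 'n \<Rightarrow> 'n. bij \<sigma>} = insert id ?\<Pi>" by auto
    ultimately have "((\<lambda>t. \<Sum>\<rho>\<in>{\<sigma> :: 'n \<Rightarrow> 'n. bij \<sigma>}. g (\<sigma> t \<circ> \<rho>)) has_field_derivative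
        (\<Sum>\<rho>\<in>{\<sigma> :: 'n \<Rightarrow> 'n. bij \<sigma>}. if \<rho> = id then cr_velocity s v k0 * P else 0)) (at 0)"
      by (intro DERIV_sum) auto
    then have der: "((\<lambda>t. \<Sum>\<rho>\<in>{\<sigma> :: 'n \<Rightarrow> 'n. bij \<sigma>}. g (\<sigma> t \<circ> \<rho>)) has_field_derivative cr_velocity s v k0 * P) (at 0)"
      by simp
    have "eventually (\<lambda>t. F (orbit (diag_pencil (\<sigma> t))) = (\<Sum>\<rho>\<in>{\<sigma> :: 'n \<Rightarrow> 'n. bij \<sigma>}. g (\<sigma> t \<circ> \<rho>))) (nhds 0)"
      using curve_germ_eventually_inj[OF c s] by eventually_elim (rule F(2)[OF pencil_roots_diag])
    from DERIV_cong_ev[OF refl this refl] der show ?thesis by (rule iffD2)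
  qed
  moreover have "cr_velocity s v k0 * P \<noteq> 0" using P k0 by simp
  ultimately show ?thesis using that[of F "cr_velocity s v k0 * P"] F(1) by blast
qed

section \<open>Families of vectors\<close>

lemma vec_span_range_family:
  assumes "finite I" "x \<in> vec.span (u ` I)"
  obtains c where "x = (\<Sum>i\<in>I. c i *s u i)"
  using assms(2)
proof (induction arbitrary: thesis rule: vec.span_induct_alt)
  case base
  show ?case by (rule base[of "\<lambda>_. 0"]) simp
next
  case (step a y x)
  obtain c where c: "x = (\<Sum>i\<in>I. c i *s u i)" using step.IH by blast
  obtain j where j: "j \<in> I" "y = u j" using step.hyps by blast
  have "(\<Sum>i\<in>I. (c i + (if i = j then a else 0)) *s u i) = (\<Sum>i\<in>I. c i *s u i) + (\<Sum>i\<in>I. (if i = j then a *s u i else 0))"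
    by (simp add: sum.distrib vec.scale_left_distrib if_distrib[of "\<lambda>a. a *s _"] cong: if_cong)
  also have "\<dots> = a *s y + x" using c j assms(1) by simp
  finally show ?case using step.prems by metis
qed

lemma vec_sum_family_in_span: "(\<Sum>i\<in>I. c i *s u i) \<in> vec.span (u ` I)"
  by (intro vec.span_sum vec.span_scale vec.span_base) auto

lemma vec_independent_family:
  assumes I: "finite I"
    and zero: "\<And>c. (\<Sum>i\<in>I. c i *s u i) = 0 \<Longrightarrow> \<forall>i\<in>I. c i = (0::'a::field)"
  shows "inj_on u I \<and> vec.independent (u ` I)"
proof -
  have inj: "inj_on u I"
  proof (rule inj_onI, rule ccontr)
    fix i j assume ij: "i \<in> I" "j \<in> I" "u i = u j" "i \<noteq> j"
    have "(\<Sum>k\<in>I. (if k = i then 1 else if k = j then -1 else 0) *s u k) =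
        (\<Sum>k\<in>I. (if k = i then u i else 0) + (if k = j then - u j else 0))"
      using ij by (intro sum.cong) auto
    also have "\<dots> = 0" using ij I by (simp add: sum.distrib)
    finally show False using zero[of "\<lambda>k. if k = i then 1 else if k = j then -1 else 0"] ij by auto
  qed
  have "vec.independent (u ` I)"
  proof (subst vec.independent_explicit_finite_subsets, intro allI impI ballI)
    fix A c v assume A: "A \<subseteq> u ` I" "finite A" "(\<Sum>v\<in>A. c v *s v) = 0" "v \<in> A"
    have "(\<Sum>i\<in>I. (if u i \<in> A then c (u i) else 0) *s u i) = (\<Sum>w\<in>u ` I. (if w \<in> A then c w else 0) *s w)"
      using inj by (simp add: sum.reindex)
    also have "\<dots> = (\<Sum>w\<in>A. c w *s w)"
      using A I by (intro sum.mono_neutral_cong_right) auto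
    finally have "(\<Sum>i\<in>I. (if u i \<in> A then c (u i) else 0) *s u i) = 0" using A(3) by (rule trans)
    from zero[OF this] have "\<forall>i\<in>I. (if u i \<in> A then c (u i) else 0) = 0" .
    moreover obtain i where "i \<in> I" "v = u i" using A by blast
    ultimately show "c v = 0" using A(4) by auto
  qed
  with inj show ?thesis by blast
qed

section \<open>Coordinates in which the two quadrics are diagonal\<close>

lemma dim_at_most_coordinates:
  fixes S :: "(complex ^ 'k::finite) set"
  assumes S: "vec.subspace S" and 0: "\<And>v. v \<in> S \<Longrightarrow> \<forall>i\<in>J. v $ i = 0 \<Longrightarrow> v = 0"
  shows "vec.dim S \<le> card J"
proof -
  let ?f = "\<lambda>v :: complex ^ 'k. \<chi> i. if i \<in> J then v $ i else 0"
  have lin: "clinear ?f" by (auto simp: clinear_iff vec_eq_iff)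
  have inj: "inj_on ?f S"
  proof (subst vec.linear_inj_on_iff_eq_0[OF lin S], intro ballI impI)
    fix v assume "v \<in> S" "?f v = 0"
    moreover from this have "\<forall>i\<in>J. v $ i = 0" by (auto simp: vec_eq_iff split: if_splits)
    ultimately show "v = 0" using 0 by blast
  qed
  have sp: "vec.span S = S" using S by simp
  have "vec.dim (?f ` S) = vec.dim S"
    by (rule vec.dim_image_eq[OF lin]) (simp only: sp inj)
  moreover have "?f ` S \<subseteq> vec.span ((\<lambda>i. axis i 1) ` J)"
  proof
    fix w assume "w \<in> ?f ` S"
    then obtain v where "w = ?f v" by blast
    also have "\<dots> = (\<Sum>i\<in>J. v $ i *s axis i 1)"
    proof (subst vec_eq_iff, intro allI)
      fix k
      have "(\<Sum>i\<in>J. v $ i *s axis i 1) $ k = (\<Sum>i\<in>J. if i = k then v $ k else 0)"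
        unfolding sum_component by (intro sum.cong) (auto simp: axis_def)
      then show "?f v $ k = (\<Sum>i\<in>J. v $ i *s axis i 1) $ k" by simp
    qed
    finally show "w \<in> vec.span ((\<lambda>i. axis i 1) ` J)"
      using vec_sum_family_in_span[of "\<lambda>i. v $ i" "\<lambda>i. axis i 1" J] by simp
  qed
  then have "vec.dim (?f ` S) \<le> card ((\<lambda>i. axis i (1::complex)) ` J :: (complex ^ 'k) set)"
    by (rule vec.dim_le_card) simp
  moreover have "\<dots> \<le> card J" by (rule card_image_le) simp
  ultimately show ?thesis by simp
qed

text \<open>Clearing denominators gives a polynomial \<open>p\<close> of degree at most the number of poles with too many
zeros. So it vanishes, and at \<open>s k\<close> only the \<open>k\<close>-th summand of \<open>p\<close> survives.\<close>

lemma partial_fractions_independent: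
  fixes s :: "'n::finite \<Rightarrow> complex" and lam :: "'k::finite \<Rightarrow> complex"
  assumes s: "inj s" and lam: "inj lam" and ne: "\<And>i k. lam i \<noteq> s k"
    and card: "CARD('n) < CARD('k)"
    and eq: "\<And>i. (\<Sum>k\<in>UNIV. a k / (lam i - s k)) = b"
  shows "a k = 0"
proof -
  define p where "p = (\<Sum>k\<in>UNIV. smult (a k) (\<Prod>l\<in>UNIV - {k}. [:- s l, 1:])) - smult b (root_poly s)"
  have "degree p \<le> CARD('n)"
    unfolding p_def
  proof (intro degree_diff_le degree_sum_le finite)
    fix k show "degree (smult (a k) (\<Prod>l\<in>UNIV - {k}. [:- s l, 1:])) \<le> CARD('n)"
      by (rule order.trans[OF degree_smult_le]) (simp add: degree_prod_linear card_Diff_singleton)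
    show "degree (smult b (root_poly s)) \<le> CARD('n)"
      by (rule order.trans[OF degree_smult_le]) (simp add: degree_prod_linear)
  qed
  have split: "poly (root_poly s) x = (x - s k) * poly (\<Prod>l\<in>UNIV - {k}. [:- s l, 1:]) x" for x k
    by (subst prod.remove[of UNIV k]) (auto simp: left_diff_distrib)
  have "poly p (lam i) = 0" for i
  proof -
    have "a k * poly (\<Prod>l\<in>UNIV - {k}. [:- s l, 1:]) (lam i) = a k / (lam i - s k) * poly (root_poly s) (lam i)" for k
      unfolding split[of _ k] using ne[of i k] by simp
    then have "poly p (lam i) = (\<Sum>k\<in>UNIV. a k / (lam i - s k)) * poly (root_poly s) (lam i) - b * poly (root_poly s) (lam i)"
      unfolding p_def by (simp add: poly_sum sum_distrib_right)
    then show ?thesis unfolding eq by simp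
  qed
  then have sub: "range lam \<subseteq> {x. poly p x = 0}" by auto
  have "p = 0"
  proof (rule ccontr)
    assume ne: "p \<noteq> 0"
    have "CARD('k) = card (range lam)" using lam by (simp add: card_image)
    also have "\<dots> \<le> card {x. poly p x = 0}" using sub poly_roots_finite[OF ne] by (rule card_mono[rotated])
    also have "\<dots> \<le> degree p" by (rule card_poly_roots_bound[OF ne])
    finally show False using \<open>degree p \<le> CARD('n)\<close> card by simp
  qed
  have zero: "poly (\<Prod>l\<in>UNIV - {j}. [:- s l, 1:]) (s k) = 0" if "j \<noteq> k" for j
    using that by (auto simp: poly_prod prod_zero_iff)
  have "poly p (s k) = (\<Sum>j\<in>UNIV. if j = k then a k * poly (\<Prod>l\<in>UNIV - {k}. [:- s l, 1:]) (s k) else 0)"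
  proof -
    have "poly p (s k) = (\<Sum>j\<in>UNIV. a j * poly (\<Prod>l\<in>UNIV - {j}. [:- s l, 1:]) (s k))"
      unfolding p_def using split[of "s k" k] by (simp add: poly_sum)
    also have "\<dots> = (\<Sum>j\<in>UNIV. if j = k then a k * poly (\<Prod>l\<in>UNIV - {k}. [:- s l, 1:]) (s k) else 0)"
      using zero by (intro sum.cong) auto
    finally show ?thesis .
  qed
  then have "a k * poly (\<Prod>l\<in>UNIV - {k}. [:- s l, 1:]) (s k) = 0" using \<open>p = 0\<close> by simp
  moreover have "poly (\<Prod>l\<in>UNIV - {k}. [:- s l, 1:]) (s k) \<noteq> 0"
    using s by (auto simp: poly_prod prod_zero_iff inj_eq)
  ultimately show ?thesis by simp
qed

text \<open>In this locale points are given by their coordinates in a basis that diagonalises both quadrics.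
There \<open>B1\<close> and \<open>B2\<close> are the two polar forms.\<close>

locale diagonal_coordinates =
  fixes lam :: "'n::finite + 3 \<Rightarrow> complex"
  assumes inj_lam: "inj lam"
begin

abbreviation B1 :: "complex ^ ('n + 3) \<Rightarrow> complex ^ ('n + 3) \<Rightarrow> complex" where
  "B1 y y' \<equiv> \<Sum>i\<in>UNIV. lam i * y $ i * y' $ i"

abbreviation B2 :: "complex ^ ('n + 3) \<Rightarrow> complex ^ ('n + 3) \<Rightarrow> complex" where
  "B2 y y' \<equiv> \<Sum>i\<in>UNIV. y $ i * y' $ i"

definition orth :: "complex ^ ('n + 3) \<Rightarrow> (complex ^ ('n + 3)) set" where
  "orth z = {y. B1 z y = 0 \<and> B2 z y = 0}"

definition root_vec :: "complex ^ ('n + 3) \<Rightarrow> complex \<Rightarrow> complex ^ ('n + 3)" where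
  "root_vec z s = (\<chi> i. z $ i / (lam i - s))"

text \<open>Up to sign this is the determinant of \<open>\<phi>1 - s \<phi>2\<close> bordered by the point, divided by the determinant of
\<open>\<phi>1 - s \<phi>2\<close>. Its zeros are the roots of the second fundamental form at the point.\<close>

definition secular :: "complex ^ ('n + 3) \<Rightarrow> complex \<Rightarrow> complex" where
  "secular z s = (\<Sum>i\<in>UNIV. (z $ i)\<^sup>2 / (lam i - s))"

text \<open>The derivative of \<open>secular z\<close> at \<open>s\<close>, and also the value of the second form at \<open>root_vec z s\<close>.\<close>

definition secular' :: "complex ^ ('n + 3) \<Rightarrow> complex \<Rightarrow> complex" where
  "secular' z s = (\<Sum>i\<in>UNIV. (z $ i)\<^sup>2 / (lam i - s)\<^sup>2)"

definition secular_roots :: "complex ^ ('n + 3) \<Rightarrow> ('n \<Rightarrow> complex) \<Rightarrow> bool" where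
  "secular_roots z s \<longleftrightarrow> (\<forall>i. z $ i \<noteq> 0) \<and> B1 z z = 0 \<and> B2 z z = 0 \<and> inj s \<and>
     (\<forall>k i. lam i \<noteq> s k) \<and> (\<forall>k. secular z (s k) = 0)"

lemma card_index: "CARD('n + 3) = CARD('n) + 3"
  by simp

lemma B_add: "B1 (y + y') w = B1 y w + B1 y' w" "B2 (y + y') w = B2 y w + B2 y' w"
  by (simp_all add: algebra_simps sum.distrib)

lemma B_scale: "B1 (c *s y) w = c * B1 y w" "B2 (c *s y) w = c * B2 y w"
  by (simp_all add: algebra_simps sum_distrib_left)

lemma B_sum: "B1 (\<Sum>k\<in>A. c k *s f k) w = (\<Sum>k\<in>A. c k * B1 (f k) w)"
  "B2 (\<Sum>k\<in>A. c k *s f k) w = (\<Sum>k\<in>A. c k * B2 (f k) w)"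
proof -
  have "(\<Sum>i\<in>UNIV. lam i * (\<Sum>k\<in>A. c k *s f k) $ i * w $ i) = (\<Sum>i\<in>UNIV. \<Sum>k\<in>A. c k * (lam i * f k $ i * w $ i))"
    "(\<Sum>i\<in>UNIV. (\<Sum>k\<in>A. c k *s f k) $ i * w $ i) = (\<Sum>i\<in>UNIV. \<Sum>k\<in>A. c k * (f k $ i * w $ i))"
    by (simp_all add: sum_distrib_left sum_distrib_right mult_ac)
  then show "B1 (\<Sum>k\<in>A. c k *s f k) w = (\<Sum>k\<in>A. c k * B1 (f k) w)"
    "B2 (\<Sum>k\<in>A. c k *s f k) w = (\<Sum>k\<in>A. c k * B2 (f k) w)"
    by (simp_all add: sum_distrib_left sum.swap[of _ A])
qed

lemma B_commute: "B1 y w = B1 w y" "B2 y w = B2 w y"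
  by (simp_all add: mult_ac)

lemma subspace_orth: "vec.subspace (orth z)"
proof (rule vec.subspaceI)
  fix x y c assume "x \<in> orth z" "y \<in> orth z"
  then show "x + y \<in> orth z" "c *s x \<in> orth z"
    unfolding orth_def mem_Collect_eq B_commute[of z] B_add B_scale by simp_all
qed (simp add: orth_def)

text \<open>Two coordinates of a vector in the orthogonal space are determined by the others, because the two
linear equations have different ratios of coefficients.\<close>

lemma dim_orth_le:
  assumes "\<And>i. z $ i \<noteq> 0"
  shows "vec.dim (orth z) \<le> CARD('n) + 1"
proof -
  obtain S :: "('n + 3) set" where "card S = 2"
    using obtain_subset_with_card_n[of 2 "UNIV :: ('n + 3) set"] card_index by auto
  then obtain p q where pq: "S = {p, q}" "p \<noteq> q" by (meson card_2_iff)
  have "v = 0" if v: "v \<in> orth z" and 0: "\<forall>i\<in>- S. v $ i = 0" for v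
  proof -
    have sum: "(\<Sum>i\<in>UNIV. g i * v $ i) = g p * v $ p + g q * v $ q" for g :: "'n + 3 \<Rightarrow> complex"
    proof -
      have "(\<Sum>i\<in>UNIV. g i * v $ i) = (\<Sum>i\<in>S. g i * v $ i)"
        using 0 by (intro sum.mono_neutral_right) auto
      then show ?thesis using pq by simp
    qed
    have 1: "z $ p * v $ p + z $ q * v $ q = 0" and 2: "lam p * z $ p * v $ p + lam q * z $ q * v $ q = 0"
      using v sum[of "\<lambda>i. z $ i"] sum[of "\<lambda>i. lam i * z $ i"] by (auto simp: orth_def)
    have "(lam p - lam q) * (z $ p * v $ p) = (lam p * z $ p * v $ p + lam q * z $ q * v $ q) - lam q * (z $ p * v $ p + z $ q * v $ q)"
      "(lam q - lam p) * (z $ q * v $ q) = (lam p * z $ p * v $ p + lam q * z $ q * v $ q) - lam p * (z $ p * v $ p + z $ q * v $ q)"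
      by (simp_all add: algebra_simps)
    then have "(lam p - lam q) * (z $ p * v $ p) = 0" "(lam q - lam p) * (z $ q * v $ q) = 0"
      unfolding 1 2 by simp_all
    then have "v $ p = 0" "v $ q = 0" using assms pq inj_lam by (auto simp: inj_eq)
    then show ?thesis using 0 pq by (auto simp: vec_eq_iff)
  qed
  then have "vec.dim (orth z) \<le> card (- S)" by (rule dim_at_most_coordinates[OF subspace_orth])
  also have "card (- S) = CARD('n) + 1" using \<open>card S = 2\<close> by (simp add: Compl_eq_Diff_UNIV card_Diff_subset card_index)
  finally show ?thesis .
qed

text \<open>Write \<open>lam i = (lam i - s) + s\<close>.\<close>

lemma secular_shift:
  assumes "\<And>i. lam i \<noteq> s"
  shows "(\<Sum>i\<in>UNIV. lam i * g i / (lam i - s)) = (\<Sum>i\<in>UNIV. g i) + s * (\<Sum>i\<in>UNIV. g i / (lam i - s))"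
proof -
  have "lam i * g i / (lam i - s) = g i + s * (g i / (lam i - s))" for i
    using assms[of i] by (simp add: field_simps)
  then show ?thesis by (simp add: sum.distrib sum_distrib_left)
qed

context
  fixes z s assumes rs: "secular_roots z s"
begin

lemma root_ne: "lam i \<noteq> s k" and coord_ne: "z $ i \<noteq> 0" and secular_root: "secular z (s k) = 0"
  and on_quadrics: "B1 z z = 0" "B2 z z = 0" and inj_roots: "inj s"
  using rs by (auto simp: secular_roots_def)

lemma B_point_root_vec: "B2 z (root_vec z (s k)) = 0" "B1 z (root_vec z (s k)) = 0"
proof -
  show 2: "B2 z (root_vec z (s k)) = 0"
    using secular_root[of k] by (simp add: root_vec_def secular_def power2_eq_square)
  show "B1 z (root_vec z (s k)) = 0"
    using secular_shift[of "s k" "\<lambda>i. (z $ i)\<^sup>2"] root_ne secular_root[of k] on_quadrics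
    by (simp add: root_vec_def secular_def power2_eq_square mult.assoc)
qed

lemma root_vec_in_orth: "root_vec z (s k) \<in> orth z"
  using B_point_root_vec by (simp add: orth_def)

lemma point_in_orth: "z \<in> orth z"
  using on_quadrics by (simp add: orth_def)

lemma B2_root_vec:
  "B2 (root_vec z (s k)) (root_vec z (s l)) = (if k = l then secular' z (s k) else 0)"
proof (cases "k = l")
  case False
  then have ne: "s k - s l \<noteq> 0" using inj_roots by (simp add: inj_eq)
  have "(s k - s l) * ((z $ i / (lam i - s k)) * (z $ i / (lam i - s l))) =
      (z $ i)\<^sup>2 / (lam i - s k) - (z $ i)\<^sup>2 / (lam i - s l)" for i
    using root_ne[of i k] root_ne[of i l] by (simp add: field_simps power2_eq_square)
  then have "(s k - s l) * B2 (root_vec z (s k)) (root_vec z (s l)) = secular z (s k) - secular z (s l)"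
    by (simp add: root_vec_def secular_def sum_distrib_left sum_subtractf)
  then show ?thesis using False ne secular_root by simp
qed (simp add: root_vec_def secular'_def power2_eq_square)

lemma B1_root_vec:
  "B1 (root_vec z (s k)) (root_vec z (s l)) = (if k = l then s k * secular' z (s k) else 0)"
proof -
  have "B1 (root_vec z (s k)) (root_vec z (s l)) =
      (\<Sum>i\<in>UNIV. lam i * (z $ i * (z $ i / (lam i - s l))) / (lam i - s k))"
    by (simp add: root_vec_def mult_ac)
  also have "\<dots> = B2 z (root_vec z (s l)) + s k * B2 (root_vec z (s k)) (root_vec z (s l))"
    using root_ne by (subst secular_shift) (simp_all add: root_vec_def mult.commute)
  finally show ?thesis unfolding B_point_root_vec B2_root_vec by simp
qed

lemma root_vecs_independent:
  assumes "(\<Sum>k\<in>UNIV. a k *s root_vec z (s k)) = b *s z"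
  shows "a k = 0" "b = 0"
proof -
  have eq: "(\<Sum>k\<in>UNIV. a k / (lam i - s k)) = b" for i
  proof -
    have "(\<Sum>k\<in>UNIV. a k / (lam i - s k)) * z $ i = (\<Sum>k\<in>UNIV. a k *s root_vec z (s k)) $ i"
      by (simp add: root_vec_def sum_distrib_right)
    then show ?thesis using assms coord_ne[of i] by simp
  qed
  have card: "CARD('n) < CARD('n + 3)" by simp
  show a: "a k = 0" for k
    by (rule partial_fractions_independent[OF inj_roots inj_lam root_ne card eq])
  show "b = 0" using eq[of undefined] by (simp add: a)
qed

text \<open>By independence of partial fractions, the \<open>n + 1\<close> vectors on the right are independent; the
orthogonal space has at most this dimension.\<close>

lemma orth_expansion:
  assumes "y \<in> orth z"
  obtains b a where "y = b *s z + (\<Sum>k\<in>UNIV. a k *s root_vec z (s k))"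
proof -
  define u where "u = (\<lambda>j :: 'n option. case j of None \<Rightarrow> z | Some k \<Rightarrow> root_vec z (s k))"
  have split: "(\<Sum>j\<in>UNIV. c j *s u j) = c None *s z + (\<Sum>k\<in>UNIV. c (Some k) *s root_vec z (s k))" for c
    by (simp add: UNIV_option_conv sum.reindex u_def)
  have "inj_on u UNIV \<and> vec.independent (range u)"
  proof (rule vec_independent_family)
    fix c assume "(\<Sum>j\<in>UNIV. c j *s u j) = 0"
    then have "(\<Sum>k\<in>UNIV. c (Some k) *s root_vec z (s k)) = (- c None) *s z"
      unfolding split by (simp add: add_eq_0_iff)
    from root_vecs_independent[OF this] show "\<forall>j\<in>UNIV. c j = 0"
      by (metis neg_equal_0_iff_equal option.exhaust)
  qed simp
  then have u: "inj u" "vec.independent (range u)" by auto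
  have "card (range u) = CARD('n) + 1" using u(1) by (simp add: card_image card_UNIV_option)
  moreover have "range u \<subseteq> orth z"
    using point_in_orth root_vec_in_orth by (auto simp: u_def split: option.splits)
  ultimately have "orth z \<subseteq> vec.span (range u)"
    using dim_orth_le[OF coord_ne] u(2) by (intro vec.card_ge_dim_independent) auto
  then obtain c where "y = (\<Sum>j\<in>UNIV. c j *s u j)"
    using vec_span_range_family[of UNIV y u] assms by auto
  then show ?thesis using that[of "c None" "\<lambda>k. c (Some k)"] unfolding split by blast
qed

end

end

section \<open>Tangent frames\<close>

lemma clinear_combination: "clinear (combination w)"
  by (simp add: clinear_iff combination_def vec.scale_left_distrib sum.distrib vec.scale_sum_right)

lemma bij_combination:
  assumes w: "is_basis w"
  shows "bij (combination w)"
proof (rule bijI)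
  have ker: "z = 0" if 0: "combination w z = 0" for z
  proof -
    have inj: "inj w" and ind: "vec.independent (range w)" using w by (auto simp: is_basis_def)
    have "(\<Sum>v\<in>range w. z $ inv w v *s v) = 0"
      using 0 inj by (simp add: sum.reindex combination_def)
    from vec.independentD[OF ind _ subset_refl this] have "z $ inv w (w k) = 0" for k
      by simp
    then show ?thesis using inj by (simp add: vec_eq_iff)
  qed
  show "inj (combination w)"
  proof (rule injI)
    fix y y' assume "combination w y = combination w y'"
    then have "combination w (y - y') = 0" by (simp add: clinear_diff[OF clinear_combination])
    from ker[OF this] show "y = y'" by simp
  qed
  show "surj (combination w)"
  proof (rule surjI[of _ "\<lambda>v. SOME z. combination w z = v"])
    fix v
    have "v \<in> vec.span (range w)" using w by (simp add: is_basis_def)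
    then obtain c where "v = (\<Sum>i\<in>UNIV. c i *s w i)" using vec_span_range_family[OF finite] by blast
    then have "combination w (\<chi> i. c i) = v" by (simp add: combination_def)
    then show "combination w (SOME z. combination w z = v) = v" by (rule someI)
  qed
qed

lemma is_basis_linear_image:
  fixes T :: "complex ^ 'k::finite \<Rightarrow> complex ^ 'k"
  assumes T: "clinear T" "bij T"
  shows "combination (\<lambda>k. T (axis k 1)) z = T z" "is_basis (\<lambda>k. T (axis k 1))"
proof -
  show eq: "combination (\<lambda>k. T (axis k 1)) z = T z" for z
    using T by (subst (2) vec_axis_expansion) (simp add: combination_def clinear_sum clinear_scale)
  have "inj (\<lambda>k. T (axis k 1)) \<and> vec.independent (range (\<lambda>k. T (axis k 1)))"
  proof (rule vec_independent_family)
    fix c :: "'k \<Rightarrow> complex" assume "(\<Sum>k\<in>UNIV. c k *s T (axis k 1)) = 0"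
    then have "T (\<chi> k. c k) = 0" using eq[of "\<chi> k. c k"] by (simp add: combination_def)
    then have "(\<chi> k. c k) = 0" using T by (metis clinear_zero bij_is_inj injD)
    then show "\<forall>k\<in>UNIV. c k = 0" by (simp add: vec_eq_iff)
  qed simp
  moreover have "v \<in> vec.span (range (\<lambda>k. T (axis k 1)))" for v
  proof -
    have "v = T (inv T v)" using T by (simp add: bij_is_surj surj_f_inv_f)
    also have "\<dots> = (\<Sum>k\<in>UNIV. inv T v $ k *s T (axis k 1))"
      by (subst eq[symmetric]) (simp add: combination_def)
    finally show ?thesis using vec_sum_family_in_span[of "\<lambda>k. inv T v $ k" "\<lambda>k. T (axis k 1)" UNIV] by simp
  qed
  ultimately show "is_basis (\<lambda>k. T (axis k 1))" by (auto simp: is_basis_def)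
qed

lemma vec_span_single: "vec.span {x} = {c *s x | c. True}"
  by (auto simp: vec.span_singleton)

text \<open>A frame identifies coordinate space with the orthogonal space modulo the line of \<open>x\<close>.\<close>

lemma tangent_frame_decomposition:
  assumes fr: "tangent_frame X (vec.span {x}) \<iota>" and x: "x \<noteq> 0"
  shows "v \<in> orthogonal_space X (vec.span {x}) \<longleftrightarrow> (\<exists>y b. v = \<iota> y + b *s x)"
    and "\<iota> y + b *s x = \<iota> y' + b' *s x \<Longrightarrow> y = y'"
proof -
  have lin: "clinear \<iota>" and inj: "inj \<iota>" and int: "range \<iota> \<inter> vec.span {x} = {0}"
    and sum: "{w + a | w a. w \<in> range \<iota> \<and> a \<in> vec.span {x}} = orthogonal_space X (vec.span {x})"
    using fr by (auto simp: tangent_frame_def complement_in_def)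
  show "v \<in> orthogonal_space X (vec.span {x}) \<longleftrightarrow> (\<exists>y b. v = \<iota> y + b *s x)"
    unfolding sum[symmetric] unfolding vec_span_single by blast
  assume "\<iota> y + b *s x = \<iota> y' + b' *s x"
  then have "\<iota> (y - y') = (b' - b) *s x"
    by (simp add: clinear_diff[OF lin] vec.scale_left_diff_distrib algebra_simps)
  then have "\<iota> (y - y') \<in> range \<iota> \<inter> vec.span {x}" unfolding vec_span_single by blast
  then have "\<iota> (y - y') = \<iota> 0" unfolding int by (simp add: clinear_zero[OF lin])
  then show "y = y'" using inj by (simp add: inj_eq)
qed

text \<open>The map \<open>T\<close> is the comparison of two coordinate systems on the quotient of the orthogonal space by the
line of \<open>x\<close>.\<close>

lemma tangent_frames_related:
  assumes fr: "tangent_frame X (vec.span {x}) \<iota>" and fr': "tangent_frame X (vec.span {x}) \<iota>'" and x: "x \<noteq> 0"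
  obtains T where "clinear T" "bij T" "\<And>c. \<exists>b. \<iota>' c = \<iota> (T c) + b *s x"
proof -
  note dec = tangent_frame_decomposition[OF fr x] and dec' = tangent_frame_decomposition[OF fr' x]
  have lin: "clinear \<iota>" and lin': "clinear \<iota>'" using fr fr' by (auto simp: tangent_frame_def)
  have "\<exists>y b. \<iota>' c = \<iota> y + b *s x" for c
  proof -
    have "\<iota>' c = \<iota>' c + 0 *s x" by simp
    then show ?thesis using dec(1) dec'(1) by blast
  qed
  then obtain T where T: "\<And>c. \<exists>b. \<iota>' c = \<iota> (T c) + b *s x" by metis
  have unique: "T c = y" if "\<iota>' c = \<iota> y + b *s x" for c y b
    using T[of c] that dec(2) by metis
  have linT: "clinear T"
    unfolding clinear_iff
  proof (intro conjI allI)
    fix c d a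
    obtain p q where p: "\<iota>' c = \<iota> (T c) + p *s x" and q: "\<iota>' d = \<iota> (T d) + q *s x" using T by blast
    have "\<iota>' (c + d) = \<iota> (T c + T d) + (p + q) *s x"
      unfolding clinear_add[OF lin'] clinear_add[OF lin] p q by (simp add: vec.scale_left_distrib)
    then show "T (c + d) = T c + T d" by (rule unique)
    have "\<iota>' (a *s c) = \<iota> (a *s T c) + (a * p) *s x"
      unfolding clinear_scale[OF lin'] clinear_scale[OF lin] p by (simp add: vec.scale_right_distrib)
    then show "T (a *s c) = a *s T c" by (rule unique)
  qed
  have "inj T"
  proof (rule injI)
    fix c d assume eq: "T c = T d"
    obtain p q where p: "\<iota>' c = \<iota> (T c) + p *s x" and q: "\<iota>' d = \<iota> (T d) + q *s x" using T by blast
    have "\<iota>' c + 0 *s x = \<iota>' d + (p - q) *s x"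
      unfolding p q eq by (simp add: vec.scale_left_diff_distrib)
    then show "c = d" by (rule dec'(2))
  qed
  moreover have "surj T"
    by (rule vec.linear_inj_imp_surj[OF linT \<open>inj T\<close>])
  ultimately show ?thesis using that linT T by (simp add: bij_def)
qed

locale diagonal_intersection = diagonal_coordinates lam for lam :: "'n::finite + 3 \<Rightarrow> complex" +
  fixes X :: "('n + 3) point set" and \<phi>1 \<phi>2 :: "('n + 3) form" and e :: "'n + 3 \<Rightarrow> complex ^ ('n + 3)"
  assumes nonsingular: "nonsingular_intersection X" and diagonal: "diagonalization X \<phi>1 \<phi>2 e lam"
begin

abbreviation E :: "complex ^ ('n + 3) \<Rightarrow> complex ^ ('n + 3)" where
  "E \<equiv> combination e"

lemma linear_E: "clinear E" by (rule clinear_combination)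

lemma bij_E: "bij E"
  using diagonal by (simp add: diagonalization_def bij_combination)

lemma E_eq_0_iff: "E z = 0 \<longleftrightarrow> z = 0"
  using clinear_zero[OF linear_E] bij_E by (metis bij_is_inj injD)

lemma forms_vanishing: "forms_vanishing X = form.span {\<phi>1, \<phi>2}"
  using diagonal by (simp add: diagonalization_def good_pair_def)

lemma quadratic: "quadratic_form \<phi>1" "quadratic_form \<phi>2"
  using forms_vanishing form.span_base[of _ "{\<phi>1, \<phi>2}"] by (auto simp: forms_vanishing_def)

lemma forms_E: "\<phi>1 (E z) = B1 z z" "\<phi>2 (E z) = B2 z z"
  using diagonal by (simp_all add: diagonalization_def power2_eq_square mult.assoc)

lemma polar_E: "polar \<phi>1 (E y) (E z) = B1 y z" "polar \<phi>2 (E y) (E z) = B2 y z"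
proof -
  have "\<phi>1 \<circ> E = diag_form lam" "\<phi>2 \<circ> E = diag_form (\<lambda>_. 1)"
    by (simp_all add: fun_eq_iff forms_E diag_form_def power2_eq_square mult.assoc)
  then show "polar \<phi>1 (E y) (E z) = B1 y z" "polar \<phi>2 (E y) (E z) = B2 y z"
    using polar_compose[OF linear_E, of \<phi>1 y z] polar_compose[OF linear_E, of \<phi>2 y z]
    by (simp_all add: polar_diag_form)
qed

lemma point_in_X_iff:
  assumes "z \<noteq> 0"
  shows "vec.span {E z} \<in> X \<longleftrightarrow> B1 z z = 0 \<and> B2 z z = 0"
proof
  assume "vec.span {E z} \<in> X"
  moreover have "\<phi>1 \<in> forms_vanishing X" "\<phi>2 \<in> forms_vanishing X"
    unfolding forms_vanishing by (auto intro: form.span_base)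
  ultimately have "\<phi>1 (E z) = 0 \<and> \<phi>2 (E z) = 0"
    by (auto simp: forms_vanishing_def vec.span_base)
  then show "B1 z z = 0 \<and> B2 z z = 0" by (simp add: forms_E)
next
  assume 0: "B1 z z = 0 \<and> B2 z z = 0"
  obtain q1 q2 where q: "quadratic_form q1" "quadratic_form q2" "X = zero_locus q1 q2"
    using nonsingular by (auto simp: nonsingular_intersection_def)
  have hom: "q (c *s y) = c\<^sup>2 * q y" if "quadratic_form q" for q :: "('n + 3) form" and c y
    using that by (metis polar_self polar_scale_left polar_scale_right power2_eq_square mult.assoc)
  have "q1 \<in> forms_vanishing X" "q2 \<in> forms_vanishing X"
    using q by (auto simp: forms_vanishing_def zero_locus_def vec_span_single hom)
  moreover have "q (E z) = 0" if "q \<in> form.span {\<phi>1, \<phi>2}" for q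
    using that 0 unfolding form_span_pair by (auto simp: forms_E)
  ultimately have "q1 (E z) = 0" "q2 (E z) = 0" unfolding forms_vanishing by blast+
  then show "vec.span {E z} \<in> X"
    unfolding q(3) zero_locus_def using assms E_eq_0_iff by blast
qed

lemma orthogonal_space_E: "orthogonal_space X (vec.span {E z}) = E ` orth z"
proof -
  have "v \<in> orthogonal_space X (vec.span {E z}) \<longleftrightarrow> polar \<phi>1 (E z) v = 0 \<and> polar \<phi>2 (E z) v = 0" for v
  proof
    assume "v \<in> orthogonal_space X (vec.span {E z})"
    moreover have "\<phi>1 \<in> forms_vanishing X" "\<phi>2 \<in> forms_vanishing X"
      unfolding forms_vanishing by (auto intro: form.span_base)
    ultimately show "polar \<phi>1 (E z) v = 0 \<and> polar \<phi>2 (E z) v = 0"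
      by (auto simp: orthogonal_space_def vec.span_base)
  next
    assume "polar \<phi>1 (E z) v = 0 \<and> polar \<phi>2 (E z) v = 0"
    then show "v \<in> orthogonal_space X (vec.span {E z})"
      unfolding orthogonal_space_def forms_vanishing form_span_pair vec_span_single
      by (auto simp: polar_plus polar_scale polar_scale_left quadratic)
  qed
  then have "E y \<in> orthogonal_space X (vec.span {E z}) \<longleftrightarrow> y \<in> orth z" for y
    by (simp add: polar_E orth_def)
  moreover have "\<exists>y. v = E y" for v using bij_E by (metis bij_pointE)
  ultimately show ?thesis by (metis (no_types) image_iff set_eqI)
qed

lemma second_fundamental_form_span: "second_fundamental_form X \<iota> = form.span {\<phi>1 \<circ> \<iota>, \<phi>2 \<circ> \<iota>}"
  by (simp add: second_fundamental_form_def forms_vanishing pullback_span)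

text \<open>The point lies in the kernel of the restricted form, so that the form descends to the quotient.\<close>

lemma isotropic_shift:
  assumes "quadratic_form \<phi>" "polar \<phi> x x = 0" "polar \<phi> x w = 0"
  shows "\<phi> (w + b *s x) = \<phi> w"
proof -
  have "\<phi> (w + b *s x) = polar \<phi> (w + b *s x) (w + b *s x)" by (simp add: polar_self assms)
  also have "\<dots> = polar \<phi> w w"
    using assms polar_commute[of \<phi> w x]
    by (simp add: polar_add_left polar_add_right polar_scale_left polar_scale_right)
  finally show ?thesis by (simp add: polar_self assms)
qed

lemma forms_of_related_frames:
  assumes fr: "tangent_frame X (vec.span {E z}) \<iota>" and fr': "tangent_frame X (vec.span {E z}) \<iota>'" and z: "z \<noteq> 0"
    and T: "\<And>c. \<exists>b. \<iota>' c = \<iota> (T c) + b *s E z"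
  shows "\<phi>1 \<circ> \<iota>' = \<phi>1 \<circ> \<iota> \<circ> T" "\<phi>2 \<circ> \<iota>' = \<phi>2 \<circ> \<iota> \<circ> T"
proof -
  have Ez: "E z \<noteq> 0" using z by (simp add: E_eq_0_iff)
  have lin: "clinear \<iota>" using fr by (simp add: tangent_frame_def)
  have pol: "polar \<phi>1 (E z) (\<iota> y + b *s E z) = 0 \<and> polar \<phi>2 (E z) (\<iota> y + b *s E z) = 0" for y b
  proof -
    have "\<iota> y + b *s E z \<in> E ` orth z"
      using tangent_frame_decomposition(1)[OF fr Ez] orthogonal_space_E by blast
    then show ?thesis by (auto simp: polar_E orth_def)
  qed
  have "polar \<phi>1 (E z) (E z) = 0" "polar \<phi>2 (E z) (E z) = 0"
    using pol[of 0 1] by (simp_all add: clinear_zero[OF lin])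
  moreover have "polar \<phi>1 (E z) (\<iota> y) = 0" "polar \<phi>2 (E z) (\<iota> y) = 0" for y
    using pol[of y 0] by simp_all
  ultimately have shift: "\<phi>1 (\<iota> y + b *s E z) = \<phi>1 (\<iota> y)" "\<phi>2 (\<iota> y + b *s E z) = \<phi>2 (\<iota> y)" for y b
    by (simp_all add: isotropic_shift quadratic)
  have "\<phi>1 (\<iota>' c) = \<phi>1 (\<iota> (T c)) \<and> \<phi>2 (\<iota>' c) = \<phi>2 (\<iota> (T c))" for c
  proof -
    obtain b where "\<iota>' c = \<iota> (T c) + b *s E z" using T by blast
    then show ?thesis by (simp only: shift)
  qed
  then show "\<phi>1 \<circ> \<iota>' = \<phi>1 \<circ> \<iota> \<circ> T" "\<phi>2 \<circ> \<iota>' = \<phi>2 \<circ> \<iota> \<circ> T"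
    by (simp_all add: fun_eq_iff)
qed

text \<open>The moduli map is defined by a chosen frame, but any two frames give pencils in the same orbit.\<close>

lemma moduli_map_frame:
  assumes fr: "tangent_frame X (vec.span {E z}) \<iota>" and z: "z \<noteq> 0"
  shows "moduli_map X (vec.span {E z}) = orbit (second_fundamental_form X \<iota>)"
proof -
  let ?\<iota> = "SOME \<iota>. tangent_frame X (vec.span {E z}) \<iota>"
  have fr': "tangent_frame X (vec.span {E z}) ?\<iota>" by (rule someI[of "\<lambda>\<iota>. tangent_frame X (vec.span {E z}) \<iota>", OF fr])
  have Ez: "E z \<noteq> 0" using z by (simp add: E_eq_0_iff)
  obtain T where T: "clinear T" "bij T" "\<And>c. \<exists>b. ?\<iota> c = \<iota> (T c) + b *s E z"
    by (rule tangent_frames_related[OF fr fr' Ez]) (rule that)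
  have "second_fundamental_form X ?\<iota> = pullback T (second_fundamental_form X \<iota>)"
    unfolding second_fundamental_form_span forms_of_related_frames[OF fr fr' z T(3)] pullback_span ..
  then show ?thesis unfolding moduli_map_def using orbit_pullback[OF T(1,2)] by simp
qed

text \<open>The frame of kernel vectors; it is normalised if \<open>\<nu> k\<close> is a square root of \<open>\<phi>2\<close> on the \<open>k\<close>-th one.\<close>

definition std_frame :: "complex ^ ('n + 3) \<Rightarrow> ('n \<Rightarrow> complex) \<Rightarrow> ('n \<Rightarrow> complex) \<Rightarrow> complex ^ 'n \<Rightarrow> complex ^ ('n + 3)" where
  "std_frame z s \<nu> c = E (\<Sum>k\<in>UNIV. (c $ k / \<nu> k) *s root_vec z (s k))"

lemma tangent_frame_std:
  assumes rs: "secular_roots z s" and \<nu>: "\<And>k. \<nu> k \<noteq> 0"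
  shows "tangent_frame X (vec.span {E z}) (std_frame z s \<nu>)"
proof -
  have lin: "clinear (std_frame z s \<nu>)"
    unfolding clinear_iff std_frame_def
    by (auto simp: add_divide_distrib vec.scale_left_distrib sum.distrib clinear_add[OF linear_E]
        clinear_scale[OF linear_E, symmetric] vec.scale_sum_right)
  have zero: "c = 0 \<and> b = 0" if "std_frame z s \<nu> c = b *s E z" for c b
  proof -
    have "E (\<Sum>k\<in>UNIV. (c $ k / \<nu> k) *s root_vec z (s k)) = E (b *s z)"
      using that unfolding std_frame_def clinear_scale[OF linear_E] .
    then have "(\<Sum>k\<in>UNIV. (c $ k / \<nu> k) *s root_vec z (s k)) = b *s z"
      using bij_E by (simp add: bij_is_inj inj_eq)
    from root_vecs_independent[OF rs this] show ?thesis using \<nu> by (simp add: vec_eq_iff)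
  qed
  have "inj (std_frame z s \<nu>)"
  proof (rule injI)
    fix c d assume "std_frame z s \<nu> c = std_frame z s \<nu> d"
    then have "std_frame z s \<nu> (c - d) = 0 *s E z" by (simp add: clinear_diff[OF lin])
    from zero[OF this] show "c = d" by simp
  qed
  moreover have "vec.subspace (range (std_frame z s \<nu>))"
  proof (rule vec.subspaceI)
    show "0 \<in> range (std_frame z s \<nu>)" by (metis clinear_zero[OF lin] rangeI)
    fix u v a assume "u \<in> range (std_frame z s \<nu>)" "v \<in> range (std_frame z s \<nu>)"
    then obtain c d where "u = std_frame z s \<nu> c" "v = std_frame z s \<nu> d" by blast
    then have "u + v = std_frame z s \<nu> (c + d)" "a *s u = std_frame z s \<nu> (a *s c)"
      by (simp_all add: clinear_add[OF lin] clinear_scale[OF lin])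
    then show "u + v \<in> range (std_frame z s \<nu>)" "a *s u \<in> range (std_frame z s \<nu>)" by blast+
  qed
  moreover have "range (std_frame z s \<nu>) \<inter> vec.span {E z} = {0}"
  proof
    show "range (std_frame z s \<nu>) \<inter> vec.span {E z} \<subseteq> {0}"
      unfolding vec_span_single using zero by auto
    show "{0} \<subseteq> range (std_frame z s \<nu>) \<inter> vec.span {E z}"
      using clinear_zero[OF lin] by (metis IntI empty_subsetI insert_subset rangeI vec.span_zero)
  qed
  moreover have "{w + a | w a. w \<in> range (std_frame z s \<nu>) \<and> a \<in> vec.span {E z}} = E ` orth z"
  proof
    show "{w + a | w a. w \<in> range (std_frame z s \<nu>) \<and> a \<in> vec.span {E z}} \<subseteq> E ` orth z"
    proof
      fix v assume "v \<in> {w + a | w a. w \<in> range (std_frame z s \<nu>) \<and> a \<in> vec.span {E z}}"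
      then obtain c b where "v = std_frame z s \<nu> c + b *s E z" unfolding vec_span_single by blast
      also have "\<dots> = E ((\<Sum>k\<in>UNIV. (c $ k / \<nu> k) *s root_vec z (s k)) + b *s z)"
        by (simp add: std_frame_def clinear_add[OF linear_E] clinear_scale[OF linear_E])
      finally show "v \<in> E ` orth z"
        using root_vec_in_orth[OF rs] point_in_orth[OF rs] subspace_orth[of z]
        by (auto intro!: imageI vec.subspace_add vec.subspace_scale vec.subspace_sum)
    qed
    show "E ` orth z \<subseteq> {w + a | w a. w \<in> range (std_frame z s \<nu>) \<and> a \<in> vec.span {E z}}"
    proof
      fix v assume "v \<in> E ` orth z"
      then obtain y where y: "y \<in> orth z" "v = E y" by blast
      obtain b a where ab: "y = b *s z + (\<Sum>k\<in>UNIV. a k *s root_vec z (s k))"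
        using orth_expansion[OF rs y(1)] .
      have "v = std_frame z s \<nu> (\<chi> k. a k * \<nu> k) + b *s E z"
        unfolding y(2) ab std_frame_def using \<nu>
        by (simp add: clinear_add[OF linear_E] clinear_scale[OF linear_E] add.commute)
      then show "v \<in> {w + a | w a. w \<in> range (std_frame z s \<nu>) \<and> a \<in> vec.span {E z}}"
        unfolding vec_span_single by blast
    qed
  qed
  ultimately show ?thesis
    using lin by (simp add: tangent_frame_def complement_in_def orthogonal_space_E)
qed

lemma forms_std_frame:
  assumes rs: "secular_roots z s" and \<nu>: "\<And>k. \<nu> k \<noteq> 0" "\<And>k. (\<nu> k)\<^sup>2 = secular' z (s k)"
  shows "\<phi>1 \<circ> std_frame z s \<nu> = diag_form s" "\<phi>2 \<circ> std_frame z s \<nu> = diag_form (\<lambda>_. 1)"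
proof -
  let ?w = "\<lambda>k. root_vec z (s k)"
  have "B1 (\<Sum>k\<in>UNIV. a k *s ?w k) (\<Sum>k\<in>UNIV. a k *s ?w k) = (\<Sum>k\<in>UNIV. a k * (a k * (s k * secular' z (s k))))"
    "B2 (\<Sum>k\<in>UNIV. a k *s ?w k) (\<Sum>k\<in>UNIV. a k *s ?w k) = (\<Sum>k\<in>UNIV. a k * (a k * secular' z (s k)))" for a
    unfolding B_sum B_commute[of "?w _" "\<Sum>k\<in>UNIV. a k *s ?w k"] B_sum B1_root_vec[OF rs] B2_root_vec[OF rs]
    by (simp_all add: if_distrib cong: if_cong)
  note B = this
  have "\<phi>1 (std_frame z s \<nu> c) = diag_form s c \<and> \<phi>2 (std_frame z s \<nu> c) = diag_form (\<lambda>_. 1) c" for c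
    unfolding std_frame_def forms_E B diag_form_def using \<nu>(1)
    by (simp add: power2_eq_square \<nu>(2)[symmetric] mult_ac)
  then show "\<phi>1 \<circ> std_frame z s \<nu> = diag_form s" "\<phi>2 \<circ> std_frame z s \<nu> = diag_form (\<lambda>_. 1)"
    by (simp_all add: fun_eq_iff)
qed

lemma moduli_map_secular_roots:
  assumes n: "CARD('n) \<ge> 2" and rs: "secular_roots z s" and ne: "\<And>k. secular' z (s k) \<noteq> 0"
  shows "vec.span {E z} \<in> X_open X" "moduli_map X (vec.span {E z}) = orbit (diag_pencil s)"
proof -
  define \<nu> where "\<nu> = (\<lambda>k. csqrt (secular' z (s k)))"
  have \<nu>: "\<nu> k \<noteq> 0" "(\<nu> k)\<^sup>2 = secular' z (s k)" for k using ne by (simp_all add: \<nu>_def)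
  have z: "z \<noteq> 0" using coord_ne[OF rs] by (metis zero_index)
  have fr: "tangent_frame X (vec.span {E z}) (std_frame z s \<nu>)"
    by (rule tangent_frame_std[OF rs]) (rule \<nu>)
  have "\<phi>1 \<circ> std_frame z s \<nu> = diag_form s" "\<phi>2 \<circ> std_frame z s \<nu> = diag_form (\<lambda>_. 1)"
    by (rule forms_std_frame[OF rs]; rule \<nu>)+
  then have sff: "second_fundamental_form X (std_frame z s \<nu>) = diag_pencil s"
    by (simp only: second_fundamental_form_span)
  show "moduli_map X (vec.span {E z}) = orbit (diag_pencil s)"
    using moduli_map_frame[OF fr z] by (simp add: sff)
  have "nonsingular_pencil (second_fundamental_form X (std_frame z s \<nu>))"
    unfolding sff using has_roots_nonsingular[OF has_roots_diag[OF inj_roots[OF rs]] n] .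
  then show "vec.span {E z} \<in> X_open X"
    using fr on_quadrics[OF rs] point_in_X_iff[OF z] by (auto simp: X_open_def)
qed

text \<open>A linear form vanishing on the common kernel of the two linear forms \<open>B1 z\<close> and \<open>B2 z\<close> is a
combination of them.\<close>

lemma affine_of_orthogonal:
  assumes z: "\<And>i. z $ i \<noteq> 0" and u: "\<And>y. y \<in> orth z \<Longrightarrow> (\<Sum>i\<in>UNIV. u i * y $ i) = 0"
  obtains p q where "\<And>i. u i = z $ i * (p + q * lam i)"
proof -
  obtain S :: "('n + 3) set" where "card S = 2"
    using obtain_subset_with_card_n[of 2 "UNIV :: ('n + 3) set"] card_index by auto
  then obtain i j where ij: "S = {i, j}" "i \<noteq> j" by (meson card_2_iff)
  define c where "c = (\<lambda>k. u k / z $ k)"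
  have lij: "lam j - lam i \<noteq> 0" using ij inj_lam by (auto simp: inj_eq)
  have c: "c k * (lam j - lam i) + c j * (lam i - lam k) + c i * (lam k - lam j) = 0" for k
  proof -
    \<comment> \<open>The three products \<open>z\<^sub>l y\<^sub>l\<close> are the minors that solve the equations \<open>\<Sum> z\<^sub>l y\<^sub>l = 0\<close> and
    \<open>\<Sum> lam\<^sub>l z\<^sub>l y\<^sub>l = 0\<close>.\<close>
    define y :: "complex ^ ('n + 3)" where "y = ((lam j - lam i) / z $ k) *s axis k 1 +
       ((lam i - lam k) / z $ j) *s axis j 1 + ((lam k - lam j) / z $ i) *s axis i 1"
    have sum: "(\<Sum>l\<in>UNIV. g l * y $ l) = g k * ((lam j - lam i) / z $ k) +
       g j * ((lam i - lam k) / z $ j) + g i * ((lam k - lam j) / z $ i)" for g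
    proof -
      have "(\<Sum>l\<in>UNIV. g l * (a * axis m 1 $ l)) = g m * a" for a m
      proof -
        have "(\<Sum>l\<in>UNIV. g l * (a * axis m 1 $ l)) = (\<Sum>l\<in>UNIV. if l = m then g m * a else 0)"
          by (intro sum.cong) (auto simp: axis_def)
        then show ?thesis by simp
      qed
      then show ?thesis
        by (simp only: y_def vector_add_component vector_smult_component distrib_left sum.distrib)
    qed
    have cancel: "z $ m * (a / z $ m) = a" "lam m * z $ m * (a / z $ m) = lam m * a" for m a
      using z[of m] by simp_all
    have "y \<in> orth z"
      unfolding orth_def mem_Collect_eq sum cancel by (simp add: algebra_simps)
    from u[OF this] show ?thesis unfolding sum c_def by (simp add: mult_ac)
  qed
  define q where "q = (c j - c i) / (lam j - lam i)"
  have "c k = (c i - q * lam i) + q * lam k" for k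
  proof -
    have "c k * (lam j - lam i) = c i * (lam j - lam i) + (c j - c i) * (lam k - lam i)"
      using c[of k] by (simp add: algebra_simps)
    also have "c j - c i = q * (lam j - lam i)" using lij by (simp add: q_def)
    finally have "c k * (lam j - lam i) = ((c i - q * lam i) + q * lam k) * (lam j - lam i)"
      by (simp add: algebra_simps)
    then show ?thesis using lij by simp
  qed
  then have "u k = z $ k * ((c i - q * lam i) + q * lam k)" for k
    using z by (metis c_def nonzero_mult_div_cancel_left times_divide_eq_right)
  then show ?thesis by (rule that)
qed

text \<open>Let \<open>y\<close> be orthogonal to the point and in the kernel of \<open>\<phi>1 - s \<phi>2\<close> restricted to the orthogonal space.
Then \<open>(lam i - s) y\<^sub>i = z\<^sub>i (p + q lam i)\<close>. Subtracting a multiple of the point from \<open>y\<close> makes this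
\<open>(lam i - s) y\<^sub>i = C z\<^sub>i\<close>, and orthogonality to the point becomes the secular equation. A zero of
\<open>secular'\<close> would give a kernel vector that is orthogonal to the whole orthogonal space for \<open>\<phi>2\<close>, against
nondegeneracy.\<close>

lemma secular_roots_of_nonsingular:
  assumes n: "CARD('n) \<ge> 2" and fr: "tangent_frame X (vec.span {E z}) \<iota>" and z: "\<And>i. z $ i \<noteq> 0"
    and ns: "nonsingular_pencil (second_fundamental_form X \<iota>)" and nd: "nondegenerate (\<phi>2 \<circ> \<iota>)"
  obtains s where "has_roots (\<phi>1 \<circ> \<iota>) (\<phi>2 \<circ> \<iota>) s" "secular_roots z s" "\<And>k. secular' z (s k) \<noteq> 0"
proof -
  obtain s where hr: "has_roots (\<phi>1 \<circ> \<iota>) (\<phi>2 \<circ> \<iota>) s"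
    using nonsingular_has_roots[OF ns[unfolded second_fundamental_form_span] nd] .
  have z0: "z \<noteq> 0" using z by (metis zero_index)
  have Ez: "E z \<noteq> 0" using z0 by (simp add: E_eq_0_iff)
  have lin: "clinear \<iota>" and int: "range \<iota> \<inter> vec.span {E z} = {0}" and inj: "inj \<iota>"
    using fr by (auto simp: tangent_frame_def complement_in_def)
  note dec = tangent_frame_decomposition[OF fr Ez, unfolded orthogonal_space_E]
  define Y where "Y c = inv E (\<iota> c)" for c
  have EY: "E (Y c) = \<iota> c" for c using bij_E by (simp add: Y_def bij_is_surj surj_f_inv_f)
  have Y: "Y c \<in> orth z" for c
  proof -
    have "\<iota> c + 0 *s E z \<in> E ` orth z" using dec(1) by blast
    then have "E (Y c) \<in> E ` orth z" by (simp add: EY)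
    then show ?thesis by (simp add: inj_image_mem_iff[OF bij_is_inj[OF bij_E]])
  qed
  have orthY: "\<exists>c b. y = Y c + b *s z" if y: "y \<in> orth z" for y
  proof -
    obtain c b where "E y = \<iota> c + b *s E z" using dec(1)[of "E y"] y by blast
    then have "E y = E (Y c + b *s z)" by (simp add: EY clinear_add[OF linear_E] clinear_scale[OF linear_E])
    then have "y = Y c + b *s z" by (rule injD[OF bij_is_inj[OF bij_E]])
    then show ?thesis by blast
  qed
  have zz: "z \<in> orth z"
  proof -
    have "E z = \<iota> 0 + 1 *s E z" by (simp add: clinear_zero[OF lin])
    then have "E z \<in> E ` orth z" using dec(1) by blast
    then show ?thesis by (simp add: inj_image_mem_iff[OF bij_is_inj[OF bij_E]])
  qed
  have Yz: "Y c = b *s z \<Longrightarrow> c = 0" for c b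
  proof -
    assume "Y c = b *s z"
    then have "\<iota> c = b *s E z" by (metis EY clinear_scale[OF linear_E])
    then have "\<iota> c \<in> range \<iota> \<inter> vec.span {E z}" unfolding vec_span_single by blast
    then show "c = 0" unfolding int using inj clinear_zero[OF lin] by (metis injD singletonD)
  qed
  have pol: "polar (\<phi>1 \<circ> \<iota>) c d = B1 (Y c) (Y d)" "polar (\<phi>2 \<circ> \<iota>) c d = B2 (Y c) (Y d)" for c d
    by (simp_all add: polar_compose[OF lin] polar_E flip: EY)
  have root: "(\<forall>i. lam i \<noteq> s k) \<and> secular z (s k) = 0" for k
  proof -
    have "\<not> nondegenerate ((\<phi>1 \<circ> \<iota>) - form_scale (s k) (\<phi>2 \<circ> \<iota>))" using hr by (simp add: has_roots_def)
    then obtain c where c: "c \<noteq> 0" "\<And>d. B1 (Y c) (Y d) - s k * B2 (Y c) (Y d) = 0"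
      by (auto simp: nondegenerate_def polar_minus polar_scale pol)
    have kernel: "(\<Sum>i\<in>UNIV. ((lam i - s k) * Y c $ i) * y $ i) = 0" if y: "y \<in> orth z" for y
    proof -
      obtain d b where db: "y = Y d + b *s z" using orthY[OF y] by blast
      have eq: "(\<Sum>i\<in>UNIV. ((lam i - s k) * Y c $ i) * w $ i) = B1 (Y c) w - s k * B2 (Y c) w" for w
        by (simp add: algebra_simps sum_subtractf sum_distrib_left)
      have "B1 (Y c) z = 0" "B2 (Y c) z = 0" using Y[of c] by (simp_all add: orth_def mult_ac)
      then show ?thesis
        unfolding eq db B_commute[of "Y c" "Y d + b *s z"] B_add B_scale
        using c(2)[of d] by (simp add: mult_ac)
    qed
    obtain p q where pq: "\<And>i. (lam i - s k) * Y c $ i = z $ i * (p + q * lam i)"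
      using affine_of_orthogonal[OF z kernel] by metis
    define y where "y = Y c - q *s z"
    define C where "C = p + q * s k"
    have y: "(lam i - s k) * y $ i = C * z $ i" for i
      using pq[of i] by (simp add: y_def C_def algebra_simps)
    have y_ne: "y \<noteq> 0"
    proof
      assume "y = 0"
      then have "Y c = q *s z" by (simp add: y_def)
      then show False using Yz c(1) by blast
    qed
    have By: "B2 z y = 0"
    proof -
      have "y \<in> orth z" unfolding y_def using Y zz subspace_orth by (intro vec.subspace_diff vec.subspace_scale)
      then show ?thesis by (simp add: orth_def)
    qed
    \<comment> \<open>At a root equal to \<open>lam i\<close> only the \<open>i\<close>-th coordinate of \<open>y\<close> could survive, but it is
    killed by orthogonality to the point, as \<open>z $ i \<noteq> 0\<close>.\<close>
    have ne: "lam i \<noteq> s k" for i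
    proof
      assume i: "lam i = s k"
      then have "C = 0" using y[of i] z[of i] by simp
      have off: "y $ j = 0" if "j \<noteq> i" for j
        using y[of j] that i injD[OF inj_lam, of j i] by (auto simp: \<open>C = 0\<close>)
      have "B2 z y = (\<Sum>j\<in>UNIV. if j = i then z $ i * y $ i else 0)"
        using off by (intro sum.cong) auto
      then have "y $ i = 0" using By z by simp
      then have "y = 0" using off by (metis vec_eq_iff zero_index)
      then show False using y_ne by contradiction
    qed
    have yi: "y $ i = C * (z $ i / (lam i - s k))" for i
      using y[of i] ne[of i] by (simp add: field_simps)
    have "C \<noteq> 0" using y_ne yi by (auto simp: vec_eq_iff)
    moreover have "B2 z y = C * secular z (s k)"
      unfolding yi secular_def by (simp add: sum_distrib_left power2_eq_square mult_ac)
    ultimately show ?thesis using By ne by simp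
  qed
  have rs: "secular_roots z s"
    using z zz root hr by (simp add: secular_roots_def orth_def has_roots_def)
  have "secular' z (s k) \<noteq> 0" for k
  proof
    assume 0: "secular' z (s k) = 0"
    let ?w = "root_vec z (s k)"
    obtain c b where cb: "?w = Y c + b *s z" using orthY[OF root_vec_in_orth[OF rs]] by blast
    have perp: "B2 ?w y = 0" if y: "y \<in> orth z" for y
    proof -
      obtain b a where y': "y = b *s z + (\<Sum>l\<in>UNIV. a l *s root_vec z (s l))" using orth_expansion[OF rs y] .
      have "B2 y ?w = 0"
        unfolding y' B_add B_scale B_sum B2_root_vec[OF rs] B_point_root_vec[OF rs]
        using 0 by (simp add: if_distrib cong: if_cong)
      then show ?thesis by (simp add: mult_ac)
    qed
    have "polar (\<phi>2 \<circ> \<iota>) c d = 0" for d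
    proof -
      have "B2 z (Y d) = 0" using Y[of d] by (simp add: orth_def)
      then have "B2 ?w (Y d) = B2 (Y c) (Y d)" unfolding cb B_add B_scale by simp
      then show ?thesis using perp[OF Y[of d]] by (simp add: pol)
    qed
    then have "c = 0" using nd unfolding nondegenerate_def by blast
    then have "Y c = 0 *s z" using EY[of 0] by (simp add: clinear_zero[OF lin] E_eq_0_iff)
    then have "(\<Sum>l\<in>UNIV. (if l = k then 1 else 0) *s root_vec z (s l)) = b *s z"
      using cb by (simp add: if_distrib[of "\<lambda>a. a *s _"] cong: if_cong)
    from root_vecs_independent(1)[OF rs this, of k] show False by simp
  qed
  with hr rs show ?thesis by (rule that)
qed

end

section \<open>Moving the roots\<close>

text \<open>Put \<open>f t u = \<Sum> y t i / (lam i - u)\<close>. The difference quotient \<open>Q t u\<close> of \<open>f t\<close> between \<open>s\<close> and \<open>u\<close> is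
close to \<open>N\<close> near \<open>(0, s)\<close>. There a zero of \<open>f t\<close> is a fixed point of \<open>u \<mapsto> s - f t s / Q t u\<close>, which maps
a small disc to itself and so has a fixed point by Brouwer's theorem. The same formula gives the
convergence of the fixed points to \<open>s\<close> and their velocity. Only differentiability at \<open>0\<close> is used.\<close>

lemma secular_root_curve:
  fixes y :: "complex \<Rightarrow> 'k::finite \<Rightarrow> complex" and lam :: "'k \<Rightarrow> complex"
  assumes dy: "\<And>i. ((\<lambda>t. y t i) has_field_derivative y' i) (at 0)"
    and ne: "\<And>i. lam i \<noteq> s"
    and root: "(\<Sum>i\<in>UNIV. y 0 i / (lam i - s)) = 0"
    and N: "N = (\<Sum>i\<in>UNIV. y 0 i / (lam i - s)\<^sup>2)" "N \<noteq> 0"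
  obtains \<sigma> where "\<sigma> 0 = s" "eventually (\<lambda>t. (\<Sum>i\<in>UNIV. y t i / (lam i - \<sigma> t)) = 0) (nhds 0)"
    "(\<sigma> has_field_derivative - (\<Sum>i\<in>UNIV. y' i / (lam i - s)) / N) (at 0)"
proof -
  define f where "f t u = (\<Sum>i\<in>UNIV. y t i / (lam i - u))" for t u
  define Q where "Q t u = (\<Sum>i\<in>UNIV. y t i / ((lam i - u) * (lam i - s)))" for t u
  have fQ: "f t u = f t s + (u - s) * Q t u" if "\<forall>i. lam i \<noteq> u" for t u
  proof -
    have "y t i / (lam i - u) = y t i / (lam i - s) + (u - s) * (y t i / ((lam i - u) * (lam i - s)))" for i
    proof -
      have "lam i - u \<noteq> 0" "lam i - s \<noteq> 0" using that ne by auto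
      then show ?thesis by (simp add: divide_simps) (simp add: algebra_simps)
    qed
    then show ?thesis by (simp add: f_def Q_def sum.distrib sum_distrib_left)
  qed
  have fs: "f 0 s = 0" using root by (simp add: f_def)
  have Qs: "Q 0 s = N" by (simp add: Q_def N power2_eq_square)
  have df: "((\<lambda>t. f t s) has_field_derivative (\<Sum>i\<in>UNIV. y' i / (lam i - s))) (at 0)"
    unfolding f_def by (intro DERIV_sum DERIV_cdivide dy)
  have "isCont (\<lambda>p. y (fst p) i) (0 :: complex, s)" for i
    using isCont_o2[of "(0 :: complex, s)" fst "\<lambda>t. y t i"] DERIV_isCont[OF dy] by simp
  then have contQ: "isCont (\<lambda>p. Q (fst p) (snd p)) (0, s)"
    unfolding Q_def using ne by (intro continuous_intros) auto
  then have limQ: "((\<lambda>p. Q (fst p) (snd p)) \<longlongrightarrow> N) (nhds (0, s))"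
    unfolding isCont_def by (simp add: tendsto_nhds_iff Qs)
  have "eventually (\<lambda>p. dist (Q (fst p) (snd p)) N < norm N / 2) (nhds 0 \<times>\<^sub>F nhds s)"
    using tendstoD[OF limQ, of "norm N / 2"] N by (simp add: nhds_prod)
  then obtain P1 P2 where P1: "eventually P1 (nhds (0::complex))" and P2: "eventually P2 (nhds s)"
    and P: "\<And>t u. P1 t \<Longrightarrow> P2 u \<Longrightarrow> dist (Q t u) N < norm N / 2"
    unfolding eventually_prod_filter by auto
  have "eventually (\<lambda>u. \<forall>i. lam i \<noteq> u) (nhds s)"
  proof (rule eventually_all_finite)
    fix i
    have "eventually (\<lambda>u. u \<noteq> lam i) (nhds s)" using ne[of i] by (intro t1_space_nhds) auto
    then show "eventually (\<lambda>u. lam i \<noteq> u) (nhds s)" by eventually_elim auto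
  qed
  with P2 have "eventually (\<lambda>u. P2 u \<and> (\<forall>i. lam i \<noteq> u)) (nhds s)" by (rule eventually_conj)
  then obtain \<delta> where \<delta>: "\<delta> > 0" "\<And>u. dist u s < \<delta> \<Longrightarrow> P2 u \<and> (\<forall>i. lam i \<noteq> u)"
    unfolding eventually_nhds_metric by blast
  define \<epsilon> where "\<epsilon> = \<delta> / 2"
  have \<epsilon>: "\<epsilon> > 0" "\<And>u. u \<in> cball s \<epsilon> \<Longrightarrow> P2 u \<and> (\<forall>i. lam i \<noteq> u)"
    using \<delta> by (auto simp: \<epsilon>_def dist_commute)
  have Qbound: "norm (Q t u) \<ge> norm N / 2" if "P1 t" "u \<in> cball s \<epsilon>" for t u
  proof -
    have "dist (Q t u) N < norm N / 2" using P that \<epsilon>(2) by blast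
    moreover have "norm N \<le> norm (Q t u) + dist (Q t u) N"
      by (metis dist_commute dist_norm norm_triangle_sub)
    ultimately show ?thesis by simp
  qed
  have root_exists: "\<exists>u\<in>cball s \<epsilon>. f t u = 0" if t: "P1 t" and small: "norm (f t s) \<le> \<epsilon> * (norm N / 2)" for t
  proof -
    let ?g = "\<lambda>u. s - f t s / Q t u"
    have nz: "Q t u \<noteq> 0" if "u \<in> cball s \<epsilon>" for u using Qbound[OF t that] N by auto
    have "continuous_on (cball s \<epsilon>) (Q t)"
      unfolding Q_def using \<epsilon>(2) ne by (intro continuous_intros) auto
    then have "continuous_on (cball s \<epsilon>) ?g" using nz by (intro continuous_intros) auto
    moreover have "?g u \<in> cball s \<epsilon>" if "u \<in> cball s \<epsilon>" for u
    proof -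
      have "norm (f t s / Q t u) = norm (f t s) / norm (Q t u)" by (rule norm_divide)
      also have "\<dots> \<le> \<epsilon> * (norm N / 2) / (norm N / 2)"
        using small Qbound[OF t that] \<epsilon>(1) N(2) by (intro frac_le) auto
      also have "\<dots> = \<epsilon>" using N by simp
      finally show ?thesis by (simp add: dist_norm)
    qed
    ultimately obtain u where u: "u \<in> cball s \<epsilon>" "?g u = u"
      using brouwer_ball[OF \<epsilon>(1), of s ?g] by blast
    have "u - s = - (f t s / Q t u)" using u(2) by (simp add: algebra_simps)
    then have "(u - s) * Q t u = - f t s" using nz[OF u(1)] by simp
    then have "f t u = 0" using fQ \<epsilon>(2)[OF u(1)] by simp
    then show ?thesis using u(1) by blast
  qed
  define \<sigma> where "\<sigma> t = (SOME u. u \<in> cball s \<epsilon> \<and> f t u = 0)" for t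
  have "eventually (\<lambda>t. norm (f t s) < \<epsilon> * (norm N / 2)) (nhds 0)"
  proof -
    have "((\<lambda>t. f t s) \<longlongrightarrow> 0) (nhds 0)"
      using DERIV_isCont[OF df] unfolding isCont_def by (simp add: tendsto_nhds_iff fs)
    from tendstoD[OF this, of "\<epsilon> * (norm N / 2)"] show ?thesis using \<epsilon>(1) N by simp
  qed
  with P1 have ev: "eventually (\<lambda>t. P1 t \<and> \<sigma> t \<in> cball s \<epsilon> \<and> f t (\<sigma> t) = 0) (nhds 0)"
  proof eventually_elim
    case (elim t)
    then have "\<exists>u. u \<in> cball s \<epsilon> \<and> f t u = 0" using root_exists[of t] by auto
    from someI_ex[OF this] elim show ?case by (simp add: \<sigma>_def)
  qed
  have dist\<sigma>: "norm (\<sigma> t - s) \<le> norm (f t s) * (2 / norm N)" and \<sigma>Q: "\<sigma> t - s = - (f t s / Q t (\<sigma> t))"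
    if "P1 t \<and> \<sigma> t \<in> cball s \<epsilon> \<and> f t (\<sigma> t) = 0" for t
  proof -
    have b: "norm (Q t (\<sigma> t)) \<ge> norm N / 2" using Qbound that by blast
    have nz: "Q t (\<sigma> t) \<noteq> 0" using b N by auto
    have "(\<sigma> t - s) * Q t (\<sigma> t) = - f t s"
      using fQ[of "\<sigma> t" t] that \<epsilon>(2) by (simp add: eq_neg_iff_add_eq_0 add.commute)
    then show eq: "\<sigma> t - s = - (f t s / Q t (\<sigma> t))" 
      unfolding minus_divide_left nonzero_eq_divide_eq[OF nz] .
    have "norm (\<sigma> t - s) = norm (f t s) / norm (Q t (\<sigma> t))" unfolding eq by (simp add: norm_divide)
    also have "\<dots> \<le> norm (f t s) / (norm N / 2)" using b nz N(2) by (intro divide_left_mono) auto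
    finally show "norm (\<sigma> t - s) \<le> norm (f t s) * (2 / norm N)" by simp
  qed
  have \<sigma>0: "\<sigma> 0 = s"
  proof -
    have "norm (\<sigma> 0 - s) \<le> norm (f 0 s) * (2 / norm N)" by (rule dist\<sigma>) (rule eventually_nhds_x_imp_x[OF ev])
    then show ?thesis by (simp add: fs)
  qed
  have lim\<sigma>: "(\<sigma> \<longlongrightarrow> s) (at 0)"
  proof -
    have "((\<lambda>t. norm (f t s) * (2 / norm N)) \<longlongrightarrow> norm (f 0 s) * (2 / norm N)) (at 0)"
      using DERIV_isCont[OF df] unfolding isCont_def by (intro tendsto_intros)
    then have "((\<lambda>t. norm (f t s) * (2 / norm N)) \<longlongrightarrow> 0) (at 0)" by (simp add: fs)
    moreover have "eventually (\<lambda>t. norm (\<sigma> t - s) \<le> norm (f t s) * (2 / norm N)) (at 0)"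
      using ev by (intro eventually_mono[OF eventually_nhds_conv_at[THEN iffD1, THEN conjunct1, OF ev]]) (rule dist\<sigma>)
    ultimately have "((\<lambda>t. \<sigma> t - s) \<longlongrightarrow> 0) (at 0)" by (rule Lim_null_comparison[rotated])
    then show ?thesis by (simp add: LIM_zero_iff)
  qed
  have "((\<lambda>t. (t, \<sigma> t)) \<longlongrightarrow> (0, s)) (at 0)" by (intro tendsto_Pair lim\<sigma> tendsto_ident_at)
  then have limQ\<sigma>: "((\<lambda>t. Q t (\<sigma> t)) \<longlongrightarrow> N) (at 0)"
    using filterlim_compose[OF limQ] by fastforce
  have "((\<lambda>t. (f t s - f 0 s) / (t - 0)) \<longlongrightarrow> (\<Sum>i\<in>UNIV. y' i / (lam i - s))) (at 0)"
    using df unfolding has_field_derivative_iff .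
  then have "((\<lambda>t. - (f t s / t) / Q t (\<sigma> t)) \<longlongrightarrow> - (\<Sum>i\<in>UNIV. y' i / (lam i - s)) / N) (at 0)"
    using limQ\<sigma> N by (intro tendsto_intros) (simp_all add: fs)
  moreover have "eventually (\<lambda>t. - (f t s / t) / Q t (\<sigma> t) = (\<sigma> t - \<sigma> 0) / (t - 0)) (at 0)"
    using eventually_nhds_conv_at[THEN iffD1, THEN conjunct1, OF ev]
    by eventually_elim (simp add: \<sigma>0 \<sigma>Q mult.commute)
  ultimately have "((\<lambda>t. (\<sigma> t - \<sigma> 0) / (t - 0)) \<longlongrightarrow> - (\<Sum>i\<in>UNIV. y' i / (lam i - s)) / N) (at 0)"
    by (rule Lim_transform_eventually)
  then have "(\<sigma> has_field_derivative - (\<Sum>i\<in>UNIV. y' i / (lam i - s)) / N) (at 0)"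
    unfolding has_field_derivative_iff .
  moreover have "eventually (\<lambda>t. (\<Sum>i\<in>UNIV. y t i / (lam i - \<sigma> t)) = 0) (nhds 0)"
    using ev by eventually_elim (simp add: f_def)
  ultimately show ?thesis using \<sigma>0 that by blast
qed

context diagonal_coordinates
begin

text \<open>The velocity comes from differentiating the secular equation: the derivative in the direction of \<open>\<eta>\<close> is
\<open>2 * B2 \<eta> (root_vec z (s k)) = 2 * d k * secular' z (s k)\<close>, and the derivative in \<open>s\<close> is \<open>secular' z (s k)\<close>.\<close>

lemma secular_roots_curve:
  assumes rs: "secular_roots z s" and simple: "\<And>k. secular' z (s k) \<noteq> 0"
    and \<zeta>0: "\<zeta> 0 = z" and d\<zeta>: "\<And>i. ((\<lambda>t. \<zeta> t $ i) has_field_derivative \<eta> $ i) (at 0)"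
    and onX: "eventually (\<lambda>t. B1 (\<zeta> t) (\<zeta> t) = 0 \<and> B2 (\<zeta> t) (\<zeta> t) = 0) (nhds (0::complex))"
    and \<eta>: "\<eta> = b *s z + (\<Sum>k\<in>UNIV. d k *s root_vec z (s k))"
  obtains \<sigma> where "curve_germ s (\<lambda>k. - 2 * d k) \<sigma>"
    "eventually (\<lambda>t. secular_roots (\<zeta> t) (\<sigma> t) \<and> (\<forall>k. secular' (\<zeta> t) (\<sigma> t k) \<noteq> 0)) (nhds 0)"
proof -
  have dy: "((\<lambda>t. (\<zeta> t $ i)\<^sup>2) has_field_derivative 2 * (z $ i * \<eta> $ i)) (at 0)" for i
    using DERIV_power[OF d\<zeta>[of i], of 2] by (simp add: \<zeta>0 mult_ac)
  define P where "P k \<sigma> \<longleftrightarrow> \<sigma> 0 = s k \<and> eventually (\<lambda>t. (\<Sum>i\<in>UNIV. (\<zeta> t $ i)\<^sup>2 / (lam i - \<sigma> t)) = 0) (nhds 0) \<and>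
      (\<sigma> has_field_derivative - 2 * d k) (at 0)" for k \<sigma>
  have "\<exists>\<sigma>. P k \<sigma>" for k
  proof -
    obtain \<sigma> where \<sigma>: "\<sigma> 0 = s k" "eventually (\<lambda>t. (\<Sum>i\<in>UNIV. (\<zeta> t $ i)\<^sup>2 / (lam i - \<sigma> t)) = 0) (nhds 0)"
      "(\<sigma> has_field_derivative - (\<Sum>i\<in>UNIV. 2 * (z $ i * \<eta> $ i) / (lam i - s k)) / secular' z (s k)) (at 0)"
    proof (rule secular_root_curve[of "\<lambda>t i. (\<zeta> t $ i)\<^sup>2", OF dy root_ne[OF rs, of _ k]])
      show "(\<Sum>i\<in>UNIV. (\<zeta> 0 $ i)\<^sup>2 / (lam i - s k)) = 0"
        using secular_root[OF rs, of k] by (simp add: secular_def \<zeta>0)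
      show "secular' z (s k) = (\<Sum>i\<in>UNIV. (\<zeta> 0 $ i)\<^sup>2 / (lam i - s k)\<^sup>2)"
        by (simp add: secular'_def \<zeta>0)
    qed (use simple in blast)+
    have "(\<Sum>i\<in>UNIV. 2 * (z $ i * \<eta> $ i) / (lam i - s k)) = 2 * B2 \<eta> (root_vec z (s k))"
      by (simp add: root_vec_def sum_distrib_left mult_ac)
    also have "B2 \<eta> (root_vec z (s k)) = d k * secular' z (s k)"
      unfolding \<eta> B_add B_scale B_sum B2_root_vec[OF rs] B_point_root_vec[OF rs]
      by (simp add: if_distrib cong: if_cong)
    finally have "P k \<sigma>" using \<sigma> simple[of k] by (simp add: P_def)
    then show ?thesis by blast
  qed
  then have P: "P k (SOME \<sigma>. P k \<sigma>)" for k by (rule someI_ex)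
  define \<sigma>' where "\<sigma>' k = (SOME \<sigma>. P k \<sigma>)" for k
  have \<sigma>': "\<And>k. \<sigma>' k 0 = s k"
    "\<And>k. eventually (\<lambda>t. (\<Sum>i\<in>UNIV. (\<zeta> t $ i)\<^sup>2 / (lam i - \<sigma>' k t)) = 0) (nhds 0)"
    "\<And>k. (\<sigma>' k has_field_derivative - 2 * d k) (at 0)"
    using P unfolding P_def \<sigma>'_def by blast+
  define \<sigma> where "\<sigma> = (\<lambda>t k. \<sigma>' k t)"
  have c: "curve_germ s (\<lambda>k. - 2 * d k) \<sigma>"
    using \<sigma>' by (simp add: curve_germ_def \<sigma>_def fun_eq_iff)
  have cont\<sigma>: "isCont (\<lambda>t. \<sigma> t k) 0" for k using DERIV_isCont[OF \<sigma>'(3)] by (simp add: \<sigma>_def)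
  have cont\<zeta>: "isCont (\<lambda>t. \<zeta> t $ i) 0" for i by (rule DERIV_isCont[OF d\<zeta>])
  have \<sigma>0: "\<sigma> 0 k = s k" for k by (simp add: \<sigma>_def \<sigma>')
  have "eventually (\<lambda>t. \<forall>i. \<zeta> t $ i \<noteq> 0) (nhds 0)"
    using cont\<zeta> coord_ne[OF rs] by (intro eventually_all_finite eventually_nhds_nonzero_cont) (auto simp: \<zeta>0)
  moreover have "eventually (\<lambda>t. inj (\<sigma> t)) (nhds 0)"
    by (rule curve_germ_eventually_inj[OF c inj_roots[OF rs]])
  moreover have "eventually (\<lambda>t. \<forall>k i. lam i - \<sigma> t k \<noteq> 0) (nhds 0)"
    using cont\<sigma> root_ne[OF rs]
    by (intro eventually_all_finite eventually_nhds_nonzero_cont continuous_intros) (auto simp: \<sigma>0)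
  moreover have "eventually (\<lambda>t. \<forall>k. secular (\<zeta> t) (\<sigma> t k) = 0) (nhds 0)"
    using \<sigma>'(2) by (intro eventually_all_finite) (simp add: secular_def \<sigma>_def)
  moreover have "eventually (\<lambda>t. \<forall>k. secular' (\<zeta> t) (\<sigma> t k) \<noteq> 0) (nhds 0)"
  proof (intro eventually_all_finite eventually_nhds_nonzero_cont)
    fix k
    show "isCont (\<lambda>t. secular' (\<zeta> t) (\<sigma> t k)) 0"
      unfolding secular'_def using root_ne[OF rs]
      by (intro continuous_sum continuous_divide continuous_power continuous_diff continuous_const cont\<sigma> cont\<zeta>)
        (auto simp: \<sigma>0)
    show "secular' (\<zeta> 0) (\<sigma> 0 k) \<noteq> 0" using simple by (simp add: \<zeta>0 \<sigma>0)
  qed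
  ultimately have "eventually (\<lambda>t. secular_roots (\<zeta> t) (\<sigma> t) \<and> (\<forall>k. secular' (\<zeta> t) (\<sigma> t k) \<noteq> 0)) (nhds 0)"
    using onX by eventually_elim (simp add: secular_roots_def)
  with c show ?thesis by (rule that)
qed

end

context diagonal_intersection
begin

lemma inv_E_component: "inv E w $ i = (\<Sum>j\<in>UNIV. w $ j * inv E (axis j 1) $ i)"
proof -
  have "inv E w = (\<Sum>j\<in>UNIV. w $ j *s inv E (axis j 1))"
    using clinear_inv[OF linear_E bij_E]
    by (subst vec_axis_expansion) (simp add: clinear_sum clinear_scale)
  then show ?thesis by simp
qed

lemma E_inv: "E (inv E w) = w" "inv E (E z) = z"
  using bij_E by (simp_all add: bij_is_surj surj_f_inv_f bij_is_inj inv_f_f)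

lemma moduli_along_tangent_curve:
  assumes n: "CARD('n) \<ge> 2" and rs: "secular_roots z s" and simple: "\<And>k. secular' z (s k) \<noteq> 0"
    and \<gamma>: "tangent_curve X (E z) (E \<eta>) \<gamma>"
    and \<eta>: "\<eta> = b *s z + (\<Sum>k\<in>UNIV. d k *s root_vec z (s k))"
  obtains \<sigma> where "curve_germ s (\<lambda>k. - 2 * d k) \<sigma>"
    "eventually (\<lambda>t. moduli_map X (vec.span {\<gamma> t}) = orbit (diag_pencil (\<sigma> t))) (nhds 0)"
proof -
  define \<zeta> where "\<zeta> t = inv E (\<gamma> t)" for t
  have E\<zeta>: "\<gamma> t = E (\<zeta> t)" for t by (simp add: \<zeta>_def E_inv)
  have \<gamma>0: "\<gamma> 0 = E z" and d\<gamma>: "\<And>i. ((\<lambda>t. \<gamma> t $ i) has_field_derivative E \<eta> $ i) (at 0)"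
    and X\<gamma>: "\<exists>r>0. \<forall>t\<in>ball 0 r. vec.span {\<gamma> t} \<in> X_open X"
    using \<gamma> by (auto simp: tangent_curve_def)
  have \<zeta>0: "\<zeta> 0 = z" by (simp add: \<zeta>_def \<gamma>0 E_inv)
  have d\<zeta>: "((\<lambda>t. \<zeta> t $ i) has_field_derivative \<eta> $ i) (at 0)" for i
  proof -
    have "((\<lambda>t. \<Sum>j\<in>UNIV. \<gamma> t $ j * inv E (axis j 1) $ i) has_field_derivative
        (\<Sum>j\<in>UNIV. E \<eta> $ j * inv E (axis j 1) $ i)) (at 0)"
      by (intro DERIV_sum DERIV_cmult_right d\<gamma>)
    then show ?thesis unfolding \<zeta>_def inv_E_component[symmetric] by (simp add: E_inv)
  qed
  have "eventually (\<lambda>t. vec.span {\<gamma> t} \<in> X) (nhds 0)"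
  proof -
    obtain r where "r > 0" "\<forall>t\<in>ball 0 r. vec.span {\<gamma> t} \<in> X_open X" using X\<gamma> by blast
    then show ?thesis unfolding eventually_nhds_metric
      by (intro exI[of _ r]) (auto simp: X_open_def dist_commute)
  qed
  moreover have "eventually (\<lambda>t. \<zeta> t $ undefined \<noteq> 0) (nhds 0)"
    using DERIV_isCont[OF d\<zeta>] coord_ne[OF rs] by (intro eventually_nhds_nonzero_cont) (auto simp: \<zeta>0)
  ultimately have onX: "eventually (\<lambda>t. B1 (\<zeta> t) (\<zeta> t) = 0 \<and> B2 (\<zeta> t) (\<zeta> t) = 0) (nhds 0)"
  proof eventually_elim
    case (elim t)
    then have "\<zeta> t \<noteq> 0" by auto
    then show ?case using elim(1) point_in_X_iff unfolding E\<zeta> by blast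
  qed
  obtain \<sigma> where \<sigma>: "curve_germ s (\<lambda>k. - 2 * d k) \<sigma>"
    "eventually (\<lambda>t. secular_roots (\<zeta> t) (\<sigma> t) \<and> (\<forall>k. secular' (\<zeta> t) (\<sigma> t k) \<noteq> 0)) (nhds 0)"
    by (rule secular_roots_curve[OF rs simple \<zeta>0 d\<zeta> onX \<eta>]) (rule that)
  from \<sigma>(2) have "eventually (\<lambda>t. moduli_map X (vec.span {\<gamma> t}) = orbit (diag_pencil (\<sigma> t))) (nhds 0)"
    unfolding E\<zeta> by eventually_elim (rule moduli_map_secular_roots(2)[OF n], auto)
  with \<sigma>(1) show ?thesis by (rule that)
qed

text \<open>In terms of the squares of the coordinates, the equations of the two quadrics are linear. So the
squares can move along a straight line, and the curve is a coordinatewise square root of it.\<close>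

lemma tangent_curve_exists:
  assumes n: "CARD('n) \<ge> 2" and rs: "secular_roots z s" and simple: "\<And>k. secular' z (s k) \<noteq> 0"
    and \<eta>: "\<eta> = b *s z + (\<Sum>k\<in>UNIV. d k *s root_vec z (s k))"
  obtains \<gamma> where "tangent_curve X (E z) (E \<eta>) \<gamma>"
proof -
  define \<zeta> :: "complex \<Rightarrow> complex ^ ('n + 3)"
    where "\<zeta> t = (\<chi> i. z $ i * csqrt (1 + 2 * (\<eta> $ i / z $ i) * t))" for t
  have "\<eta> \<in> orth z"
    unfolding \<eta> using point_in_orth[OF rs] root_vec_in_orth[OF rs] subspace_orth[of z]
    by (intro vec.subspace_add vec.subspace_scale vec.subspace_sum) auto
  then have orth: "(\<Sum>i\<in>UNIV. lam i * z $ i * \<eta> $ i) = 0" "(\<Sum>i\<in>UNIV. z $ i * \<eta> $ i) = 0"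
    by (auto simp: orth_def)
  have sq: "\<zeta> t $ i * \<zeta> t $ i = z $ i * z $ i + 2 * t * (z $ i * \<eta> $ i)" for t i
  proof -
    have "\<zeta> t $ i * \<zeta> t $ i = (z $ i)\<^sup>2 * (csqrt (1 + 2 * (\<eta> $ i / z $ i) * t))\<^sup>2"
      by (simp add: \<zeta>_def power2_eq_square mult_ac)
    also have "\<dots> = (z $ i)\<^sup>2 * (1 + 2 * (\<eta> $ i / z $ i) * t)" by (simp only: power2_csqrt)
    also have "\<dots> = z $ i * z $ i + 2 * t * (z $ i * \<eta> $ i)"
      using coord_ne[OF rs, of i] by (simp add: power2_eq_square field_simps)
    finally show ?thesis .
  qed
  have onX: "B1 (\<zeta> t) (\<zeta> t) = 0 \<and> B2 (\<zeta> t) (\<zeta> t) = 0" for t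
  proof -
    have "B1 (\<zeta> t) (\<zeta> t) = B1 z z + 2 * t * (\<Sum>i\<in>UNIV. lam i * z $ i * \<eta> $ i)"
      by (simp add: mult.assoc sq distrib_left sum.distrib sum_distrib_left mult.left_commute)
    moreover have "B2 (\<zeta> t) (\<zeta> t) = B2 z z + 2 * t * (\<Sum>i\<in>UNIV. z $ i * \<eta> $ i)"
      by (simp add: sq sum.distrib sum_distrib_left)
    ultimately show ?thesis by (simp add: orth on_quadrics[OF rs])
  qed
  have \<zeta>0: "\<zeta> 0 = z" by (simp add: \<zeta>_def vec_eq_iff)
  have d\<zeta>: "((\<lambda>t. \<zeta> t $ i) has_field_derivative \<eta> $ i) (at 0)" for i
  proof -
    have "((\<lambda>t. 1 + 2 * (\<eta> $ i / z $ i) * t) has_field_derivative 2 * (\<eta> $ i / z $ i)) (at 0)"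
      using coord_ne[OF rs, of i] by (auto intro!: derivative_eq_intros)
    then have "((\<lambda>t. csqrt (1 + 2 * (\<eta> $ i / z $ i) * t)) has_field_derivative
        2 * (\<eta> $ i / z $ i) / (2 * csqrt (1 + 2 * (\<eta> $ i / z $ i) * 0))) (at 0)"
      by (rule has_field_derivative_csqrt') simp
    from DERIV_cmult[OF this, of "z $ i"]
    show ?thesis using coord_ne[OF rs, of i] by (simp add: \<zeta>_def)
  qed
  have ev: "eventually (\<lambda>t. vec.span {E (\<zeta> t)} \<in> X_open X) (nhds 0)"
  proof -
    have "eventually (\<lambda>t. B1 (\<zeta> t) (\<zeta> t) = 0 \<and> B2 (\<zeta> t) (\<zeta> t) = 0) (nhds 0)"
      by (intro always_eventually allI onX)
    then obtain \<sigma> where "curve_germ s (\<lambda>k. - 2 * d k) \<sigma>"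
      and "eventually (\<lambda>t. secular_roots (\<zeta> t) (\<sigma> t) \<and> (\<forall>k. secular' (\<zeta> t) (\<sigma> t k) \<noteq> 0)) (nhds 0)"
      by (rule secular_roots_curve[OF rs simple \<zeta>0 d\<zeta> _ \<eta>]) (rule that)
    from this(2) show ?thesis by eventually_elim (rule moduli_map_secular_roots(1)[OF n], auto)
  qed
  have "eventually (\<lambda>t. \<forall>i. 1 + 2 * (\<eta> $ i / z $ i) * t \<in> - \<real>\<^sub>\<le>\<^sub>0) (nhds (0::complex))"
  proof (rule eventually_all_finite)
    fix i
    have "isCont (\<lambda>t. 1 + 2 * (\<eta> $ i / z $ i) * t) (0::complex)" by (intro continuous_intros)
    moreover have "open (- \<real>\<^sub>\<le>\<^sub>0 :: complex set)" by (intro open_Compl closed_nonpos_Reals_complex)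
    moreover from calculation(1) have "((\<lambda>t. 1 + 2 * (\<eta> $ i / z $ i) * t) \<longlongrightarrow> 1) (nhds (0::complex))"
      unfolding isCont_def by (simp add: tendsto_nhds_iff)
    ultimately show "eventually (\<lambda>t. 1 + 2 * (\<eta> $ i / z $ i) * t \<in> - \<real>\<^sub>\<le>\<^sub>0) (nhds (0::complex))"
      by (auto dest: topological_tendstoD)
  qed
  with ev have "eventually (\<lambda>t. vec.span {E (\<zeta> t)} \<in> X_open X \<and> (\<forall>i. 1 + 2 * (\<eta> $ i / z $ i) * t \<in> - \<real>\<^sub>\<le>\<^sub>0)) (nhds 0)"
    by (rule eventually_conj)
  then obtain r where r: "r > 0" "\<And>t. t \<in> ball 0 r \<Longrightarrow> vec.span {E (\<zeta> t)} \<in> X_open X"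
    "\<And>t i. t \<in> ball 0 r \<Longrightarrow> 1 + 2 * (\<eta> $ i / z $ i) * t \<notin> \<real>\<^sub>\<le>\<^sub>0"
    unfolding eventually_nhds_metric by (auto simp: dist_commute)
  have E_comp: "E w $ i = (\<Sum>j\<in>UNIV. w $ j * e j $ i)" for w i
    by (simp add: combination_def)
  have "(\<lambda>t. E (\<zeta> t) $ i) holomorphic_on ball 0 r" for i
    unfolding E_comp \<zeta>_def using r(3) by (auto intro!: holomorphic_intros)
  moreover have "((\<lambda>t. E (\<zeta> t) $ i) has_field_derivative E \<eta> $ i) (at 0)" for i
    unfolding E_comp by (intro DERIV_sum DERIV_cmult_right d\<zeta>)
  ultimately have "tangent_curve X (E z) (E \<eta>) (\<lambda>t. E (\<zeta> t))"
    unfolding tangent_curve_def using \<zeta>0 r(1,2) by (intro conjI exI[of _ r]) auto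
  then show ?thesis by (rule that)
qed

lemma moduli_differential_zero_iff:
  assumes n: "CARD('n) \<ge> 3" and rs: "secular_roots z s" and simple: "\<And>k. secular' z (s k) \<noteq> 0"
    and rigid: "moebius_rigid s"
    and \<eta>: "\<eta> = b *s z + (\<Sum>k\<in>UNIV. d k *s root_vec z (s k))"
  shows "has_moduli_differential X (E z) (E \<eta>) (\<lambda>_. 0) \<longleftrightarrow> (\<exists>a b c. \<forall>k. d k = a + b * s k + c * (s k)\<^sup>2)"
proof
  have n2: "CARD('n) \<ge> 2" using n by simp
  note inj = inj_roots[OF rs]
  note m = moduli_map_secular_roots(2)[OF n2 rs simple]
  {
    assume "\<exists>a b c. \<forall>k. d k = a + b * s k + c * (s k)\<^sup>2"
    then obtain a b' c where abc: "\<And>k. d k = a + b' * s k + c * (s k)\<^sup>2" by blast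
    show "has_moduli_differential X (E z) (E \<eta>) (\<lambda>_. 0)"
      unfolding has_moduli_differential_def
    proof (intro ballI allI impI)
      fix F \<gamma> assume F: "F \<in> regular_germs (moduli_map X (vec.span {E z}))" and \<gamma>: "tangent_curve X (E z) (E \<eta>) \<gamma>"
      obtain \<sigma> where \<sigma>: "curve_germ s (\<lambda>k. - 2 * d k) \<sigma>"
        "eventually (\<lambda>t. moduli_map X (vec.span {\<gamma> t}) = orbit (diag_pencil (\<sigma> t))) (nhds 0)"
        by (rule moduli_along_tangent_curve[OF n2 rs simple \<gamma> \<eta>]) (rule that)
      have "(\<lambda>k. - 2 * d k) = (\<lambda>k. - 2 * a + (- 2 * b') * s k + (- 2 * c) * (s k)\<^sup>2)"
        by (simp add: abc fun_eq_iff algebra_simps)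
      from \<sigma>(1)[unfolded this] have "((\<lambda>t. F (orbit (diag_pencil (\<sigma> t)))) has_field_derivative 0) (at 0)"
        by (rule regular_germ_derivative_moebius[OF n2 inj F[unfolded m]])
      moreover have "eventually (\<lambda>t. F (moduli_map X (vec.span {\<gamma> t})) = F (orbit (diag_pencil (\<sigma> t)))) (nhds 0)"
        using \<sigma>(2) by eventually_elim simp
      ultimately show "((\<lambda>t. F (moduli_map X (vec.span {\<gamma> t}))) has_field_derivative 0) (at 0)"
        by (subst DERIV_cong_ev[OF refl _ refl])
    qed
  }
  assume zero: "has_moduli_differential X (E z) (E \<eta>) (\<lambda>_. 0)"
  show "\<exists>a b c. \<forall>k. d k = a + b * s k + c * (s k)\<^sup>2"
  proof (rule ccontr)
    assume no: "\<not> ?thesis"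
    have v: "\<not> (\<forall>k. - 2 * d k = a + b * s k + c * (s k)\<^sup>2)" for a b c
    proof
      assume eq: "\<forall>k. - 2 * d k = a + b * s k + c * (s k)\<^sup>2"
      have "d k = (- a / 2) + (- b / 2) * s k + (- c / 2) * (s k)\<^sup>2" for k
      proof -
        have "d k = - (- 2 * d k) / 2" by simp
        also have "\<dots> = (- a / 2) + (- b / 2) * s k + (- c / 2) * (s k)\<^sup>2"
          unfolding eq[rule_format] by (simp add: add_divide_distrib)
        finally show ?thesis .
      qed
      then show False using no by blast
    qed
    obtain F D where F: "\<And>m. m \<in> moduli_PQ \<Longrightarrow> F \<in> regular_germs m" and D: "D \<noteq> 0"
      and dF: "\<And>\<sigma>. curve_germ s (\<lambda>k. - 2 * d k) \<sigma> \<Longrightarrow> ((\<lambda>t. F (orbit (diag_pencil (\<sigma> t)))) has_field_derivative D) (at 0)"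
      by (rule regular_function_detecting_velocity[OF n inj rigid v]) (rule that)
    obtain \<gamma> where \<gamma>: "tangent_curve X (E z) (E \<eta>) \<gamma>"
      by (rule tangent_curve_exists[OF n2 rs simple \<eta>]) (rule that)
    obtain \<sigma> where \<sigma>: "curve_germ s (\<lambda>k. - 2 * d k) \<sigma>"
      "eventually (\<lambda>t. moduli_map X (vec.span {\<gamma> t}) = orbit (diag_pencil (\<sigma> t))) (nhds 0)"
      by (rule moduli_along_tangent_curve[OF n2 rs simple \<gamma> \<eta>]) (rule that)
    have "orbit (diag_pencil s) \<in> moduli_PQ"
      using has_roots_nonsingular[OF has_roots_diag[OF inj] n2] by (auto simp: moduli_PQ_def)
    then have "F \<in> regular_germs (moduli_map X (vec.span {E z}))" unfolding m by (rule F)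
    then have "((\<lambda>t. F (moduli_map X (vec.span {\<gamma> t}))) has_field_derivative 0) (at 0)"
      using zero \<gamma> by (simp add: has_moduli_differential_def)
    moreover have ev: "eventually (\<lambda>t. F (moduli_map X (vec.span {\<gamma> t})) = F (orbit (diag_pencil (\<sigma> t)))) (nhds 0)"
      using \<sigma>(2) by eventually_elim simp
    ultimately have "((\<lambda>t. F (orbit (diag_pencil (\<sigma> t)))) has_field_derivative 0) (at 0)"
      using DERIV_cong_ev[OF refl ev refl] by blast
    then show False using dF[OF \<sigma>(1)] D DERIV_unique by blast
  qed
qed

end

section \<open>The kernel is poised\<close>

text \<open>The three vectors are independent because a nonzero quadratic polynomial cannot vanish at three
distinct roots.\<close>

lemma span_of_quadratics:
  fixes f :: "complex ^ 'n::finite \<Rightarrow> complex ^ 'm::finite" and s \<nu> :: "'n \<Rightarrow> complex"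
  assumes f: "clinear f" "inj f" and s: "inj s" and \<nu>: "\<And>k. \<nu> k \<noteq> 0" and n: "CARD('n) \<ge> 3"
  defines "u \<equiv> \<lambda>j::nat. \<chi> k. s k ^ j * \<nu> k"
  shows "f ` {c. \<exists>a b d. \<forall>k. c $ k / \<nu> k = a + b * s k + d * (s k)\<^sup>2} = vec.span {f (u 0), f (u 1), f (u 2)}"
    and "vec.dim (vec.span {f (u 0), f (u 1), f (u 2)}) = 3"
proof -
  let ?I = "{0, 1, 2 :: nat}"
  have I: "(\<lambda>j. f (u j)) ` ?I = {f (u 0), f (u 1), f (u 2)}" by simp
  have comb: "(\<Sum>j\<in>?I. c j *s f (u j)) = f (\<chi> k. \<nu> k * (c 0 + c 1 * s k + c 2 * (s k)\<^sup>2))" for c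
  proof -
    have "(\<chi> k. \<nu> k * (c 0 + c 1 * s k + c 2 * (s k)\<^sup>2)) = c 0 *s u 0 + (c 1 *s u 1 + c 2 *s u 2)"
      by (simp add: u_def vec_eq_iff algebra_simps)
    then show ?thesis by (simp add: clinear_add[OF f(1)] clinear_scale[OF f(1)])
  qed
  show "f ` {c. \<exists>a b d. \<forall>k. c $ k / \<nu> k = a + b * s k + d * (s k)\<^sup>2} = vec.span {f (u 0), f (u 1), f (u 2)}"
  proof
    show "f ` {c. \<exists>a b d. \<forall>k. c $ k / \<nu> k = a + b * s k + d * (s k)\<^sup>2} \<subseteq> vec.span {f (u 0), f (u 1), f (u 2)}"
    proof
      fix y assume "y \<in> f ` {c. \<exists>a b d. \<forall>k. c $ k / \<nu> k = a + b * s k + d * (s k)\<^sup>2}"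
      then obtain c a b d where y: "y = f c" and c: "\<And>k. c $ k / \<nu> k = a + b * s k + d * (s k)\<^sup>2" by blast
      have "c = (\<chi> k. \<nu> k * (a + b * s k + d * (s k)\<^sup>2))"
        using \<nu> by (simp add: vec_eq_iff flip: c)
      moreover define coef where "coef = (\<lambda>j :: nat. case j of 0 \<Rightarrow> a | Suc 0 \<Rightarrow> b | _ \<Rightarrow> d)"
      ultimately have y_sum: "y = (\<Sum>j\<in>?I. coef j *s f (u j))"
        unfolding comb y by (simp add: numeral_2_eq_2)
      show "y \<in> vec.span {f (u 0), f (u 1), f (u 2)}"
        using vec_sum_family_in_span[of coef "\<lambda>j. f (u j)" ?I] unfolding I y_sum .
    qed
    show "vec.span {f (u 0), f (u 1), f (u 2)} \<subseteq> f ` {c. \<exists>a b d. \<forall>k. c $ k / \<nu> k = a + b * s k + d * (s k)\<^sup>2}"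
    proof
      fix y assume "y \<in> vec.span {f (u 0), f (u 1), f (u 2)}"
      then obtain c where "y = (\<Sum>j\<in>?I. c j *s f (u j))"
        using vec_span_range_family[of ?I y "\<lambda>j. f (u j)"] unfolding I by auto
      then have y: "y = f (\<chi> k. \<nu> k * (c 0 + c 1 * s k + c 2 * (s k)\<^sup>2))" unfolding comb .
      have "(\<chi> k. \<nu> k * (c 0 + c 1 * s k + c 2 * (s k)\<^sup>2)) \<in> {c. \<exists>a b d. \<forall>k. c $ k / \<nu> k = a + b * s k + d * (s k)\<^sup>2}"
        unfolding mem_Collect_eq
        by (rule exI[of _ "c 0"], rule exI[of _ "c 1"], rule exI[of _ "c 2"]) (simp add: \<nu>)
      then show "y \<in> f ` {c. \<exists>a b d. \<forall>k. c $ k / \<nu> k = a + b * s k + d * (s k)\<^sup>2}" unfolding y by (rule imageI)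
    qed
  qed
  have "inj_on (\<lambda>j. f (u j)) ?I \<and> vec.independent ((\<lambda>j. f (u j)) ` ?I)"
  proof (rule vec_independent_family)
    fix c :: "nat \<Rightarrow> complex" assume "(\<Sum>j\<in>?I. c j *s f (u j)) = 0"
    then have "f (\<chi> k. \<nu> k * (c 0 + c 1 * s k + c 2 * (s k)\<^sup>2)) = f 0"
      unfolding comb by (simp add: clinear_zero[OF f(1)])
    then have "(\<chi> k. \<nu> k * (c 0 + c 1 * s k + c 2 * (s k)\<^sup>2)) = 0" using f(2) by (simp add: inj_eq)
    then have "c 0 + c 1 * s k + c 2 * (s k)\<^sup>2 = 0" for k using \<nu> by (simp add: vec_eq_iff)
    then have sub: "range s \<subseteq> {x. poly [:c 0, c 1, c 2:] x = 0}"
      by (auto simp: power2_eq_square algebra_simps)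
    have "[:c 0, c 1, c 2:] = 0"
    proof (rule ccontr)
      assume ne: "[:c 0, c 1, c 2:] \<noteq> 0"
      have "CARD('n) = card (range s)" using s by (simp add: card_image)
      also have "\<dots> \<le> card {x. poly [:c 0, c 1, c 2:] x = 0}" using sub poly_roots_finite[OF ne] by (rule card_mono[rotated])
      also have "\<dots> \<le> degree [:c 0, c 1, c 2:]" by (rule card_poly_roots_bound[OF ne])
      also have "\<dots> \<le> 2" by simp
      finally show False using n by simp
    qed
    then show "\<forall>j\<in>?I. c j = 0" by simp
  qed simp
  then have inj: "inj_on (\<lambda>j. f (u j)) ?I" and ind: "vec.independent {f (u 0), f (u 1), f (u 2)}"
    unfolding I by auto
  have "card {f (u 0), f (u 1), f (u 2)} = 3"
    using card_image[OF inj] unfolding I by simp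
  then show "vec.dim (vec.span {f (u 0), f (u 1), f (u 2)}) = 3"
    using vec.dim_eq_card_independent[OF ind] by simp
qed

theorem theorem5p9:
  fixes X :: "('n::finite + 3) point set"
    and \<phi>1 \<phi>2 :: "('n + 3) form"
    and e :: "'n + 3 \<Rightarrow> complex ^ ('n + 3)"
    and lam :: "'n + 3 \<Rightarrow> complex"
    and x :: "complex ^ ('n + 3)"
    and \<iota> :: "complex ^ 'n \<Rightarrow> complex ^ ('n + 3)"
  assumes "CARD('n) \<ge> 3"
    and "nonsingular_intersection X"
    and "diagonalization X \<phi>1 \<phi>2 e lam"
    and "x \<noteq> 0"
    and "vec.span {x} \<in> X_reg X \<phi>1 \<phi>2 e"
    and "tangent_frame X (vec.span {x}) \<iota>"
  shows "vec.subspace (ker_moduli_differential X x (range \<iota>))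
       \<and> vec.dim (ker_moduli_differential X x (range \<iota>)) = 3
       \<and> poised (second_fundamental_form X \<iota>) (\<iota> -` ker_moduli_differential X x (range \<iota>))"
proof -
  note n = assms(1) and fr = assms(6)
  have n2: "CARD('n) \<ge> 2" using n by simp
  interpret diagonal_intersection lam X \<phi>1 \<phi>2 e
    using assms(2,3) by unfold_locales (auto simp: diagonalization_def)
  obtain z' \<iota>' where z': "vec.span {x} = vec.span {E z'}" "\<And>i. z' $ i \<noteq> 0"
    and fr': "tangent_frame X (vec.span {x}) \<iota>'"
    and ns': "nonsingular_pencil (second_fundamental_form X \<iota>')"
    and triv': "only_trivial_automorphism (second_fundamental_form X \<iota>')"
    and nd': "nondegenerate (\<phi>1 \<circ> \<iota>')" "nondegenerate (\<phi>2 \<circ> \<iota>')"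
    using assms(5) unfolding X_reg_def by blast
  define z where "z = inv E x"
  have xz: "x = E z" by (simp add: z_def E_inv)
  have "x \<in> vec.span {E z'}" using z'(1) vec.span_base[of x "{x}"] by simp
  then obtain c where c: "x = c *s E z'" unfolding vec_span_single by blast
  have "z = inv E (E (c *s z'))" unfolding z_def c clinear_scale[OF linear_E] ..
  then have "z = c *s z'" unfolding E_inv .
  moreover have "c \<noteq> 0" using c assms(4) by auto
  ultimately have z: "z $ i \<noteq> 0" for i using z'(2) by simp
  have z0: "z \<noteq> 0" using assms(4) clinear_zero[OF linear_E] by (auto simp: xz)
  note fr = fr[unfolded xz] and fr' = fr'[unfolded xz]
  obtain s where hr: "has_roots (\<phi>1 \<circ> \<iota>') (\<phi>2 \<circ> \<iota>') s" and rs: "secular_roots z s"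
    and simple: "\<And>k. secular' z (s k) \<noteq> 0"
    by (rule secular_roots_of_nonsingular[OF n2 fr' z ns' nd'(2)]) (rule that)
  note injs = inj_roots[OF rs]
  have rigid: "moebius_rigid s"
    unfolding moebius_rigid_def
    using only_trivial_automorphism_roots[OF triv'[unfolded second_fundamental_form_span] hr n2] by blast
  have s0: "s k \<noteq> 0" for k
  proof
    assume "s k = 0"
    moreover have "\<not> nondegenerate ((\<phi>1 \<circ> \<iota>') - form_scale (s k) (\<phi>2 \<circ> \<iota>'))" using hr by (simp add: has_roots_def)
    moreover have "(\<phi>1 \<circ> \<iota>') - form_scale 0 (\<phi>2 \<circ> \<iota>') = \<phi>1 \<circ> \<iota>'" by (simp add: fun_eq_iff)
    ultimately show False using nd'(1) by simp
  qed
  define \<nu> where "\<nu> = (\<lambda>k. csqrt (secular' z (s k)))"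
  have \<nu>: "\<nu> k \<noteq> 0" "(\<nu> k)\<^sup>2 = secular' z (s k)" for k using simple by (simp_all add: \<nu>_def)
  define std where "std = std_frame z s \<nu>"
  have fr_std: "tangent_frame X (vec.span {E z}) std"
    unfolding std_def by (rule tangent_frame_std[OF rs]) (rule \<nu>)
  have diag: "\<phi>1 \<circ> std = diag_form s" "\<phi>2 \<circ> std = diag_form (\<lambda>_. 1)"
    unfolding std_def by (rule forms_std_frame[OF rs]; rule \<nu>)+
  have Ez: "E z \<noteq> 0" using z0 by (simp add: E_eq_0_iff)
  obtain T where T: "clinear T" "bij T" "\<And>c. \<exists>b. std c = \<iota> (T c) + b *s E z"
    by (rule tangent_frames_related[OF fr fr_std Ez]) (rule that)
  have diagT: "\<phi>1 \<circ> \<iota> \<circ> T = diag_form s" "\<phi>2 \<circ> \<iota> \<circ> T = diag_form (\<lambda>_. 1)"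
    using forms_of_related_frames[OF fr fr_std z0 T(3)] diag by simp_all
  have lin: "clinear \<iota>" and inj\<iota>: "inj \<iota>" using fr by (auto simp: tangent_frame_def)
  let ?K = "ker_moduli_differential X x (range \<iota>)"
  let ?Q = "{c :: complex ^ 'n. \<exists>a b d. \<forall>k. c $ k / \<nu> k = a + b * s k + d * (s k)\<^sup>2}"
  \<comment> \<open>By construction of \<open>T\<close>, the coordinates \<open>c\<close> refer to the normalised kernel vectors, so the
  coefficient of \<open>root_vec z (s k)\<close> is \<open>c $ k / \<nu> k\<close>.\<close>
  have ker: "\<iota> (T c) \<in> ?K \<longleftrightarrow> c \<in> ?Q" for c
  proof -
    obtain b where b: "std c = \<iota> (T c) + b *s E z" using T(3) by blast
    define \<eta> where "\<eta> = (- b) *s z + (\<Sum>k\<in>UNIV. (c $ k / \<nu> k) *s root_vec z (s k))"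
    have "\<iota> (T c) = (- b) *s E z + std c" unfolding b by simp
    also have "\<dots> = E \<eta>"
      unfolding \<eta>_def std_def std_frame_def clinear_add[OF linear_E] clinear_scale[OF linear_E] ..
    finally have "\<iota> (T c) = E \<eta>" .
    then show ?thesis
      using moduli_differential_zero_iff[OF n rs simple rigid \<eta>_def]
      by (simp add: ker_moduli_differential_def xz flip: \<open>\<iota> (T c) = E \<eta>\<close>)
  qed
  have surjT: "\<exists>c. y = T c" for y using T(2) by (metis bij_pointE)
  have K: "?K = (\<iota> \<circ> T) ` ?Q"
  proof
    show "?K \<subseteq> (\<iota> \<circ> T) ` ?Q"
    proof
      fix v assume v: "v \<in> ?K"
      then obtain y where y: "v = \<iota> y" by (auto simp: ker_moduli_differential_def)
      obtain c where "y = T c" using surjT by blast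
      then have c: "v = \<iota> (T c)" using y by simp
      have "c \<in> ?Q" using v ker unfolding c by blast
      moreover have "v = (\<iota> \<circ> T) c" using c by simp
      ultimately show "v \<in> (\<iota> \<circ> T) ` ?Q" by (rule rev_image_eqI)
    qed
    show "(\<iota> \<circ> T) ` ?Q \<subseteq> ?K" by (rule image_subsetI) (simp only: comp_apply ker)
  qed
  have P: "\<iota> -` ?K = T ` ?Q"
    unfolding K image_comp[symmetric] using inj\<iota> by (rule inj_vimage_image_eq)
  define u :: "nat \<Rightarrow> complex ^ 'n" where "u j = (\<chi> k. s k ^ j * \<nu> k)" for j
  have linT: "clinear (\<iota> \<circ> T)" "inj (\<iota> \<circ> T)"
    using clinear_compose[OF T(1) lin] T(2) inj\<iota> by (auto simp: bij_def inj_compose)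
  have injT: "inj T" using T(2) by (simp add: bij_is_inj)
  have K_span: "?K = vec.span {(\<iota> \<circ> T) (u 0), (\<iota> \<circ> T) (u 1), (\<iota> \<circ> T) (u 2)}" and K_dim: "vec.dim ?K = 3"
    using span_of_quadratics[OF linT injs \<nu>(1) n] unfolding K u_def by simp_all
  have P_span: "\<iota> -` ?K = vec.span {T (u 0), T (u 1), T (u 2)}" and P_dim: "vec.dim (\<iota> -` ?K) = 3"
    using span_of_quadratics[OF T(1) injT injs \<nu>(1) n] unfolding P u_def by simp_all
  define w where "w k = T (axis k 1)" for k
  have w: "combination w y = T y" "is_basis w" for y
    unfolding w_def[abs_def] by (rule is_basis_linear_image[OF T(1,2)])+
  \<comment> \<open>The map \<open>\<alpha>\<close>, which multiplies the \<open>k\<close>-th basis vector \<open>w k\<close> by \<open>s k\<close>.\<close>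
  define A where "A y = T (\<chi> i. s i * inv T y $ i)" for y
  have A: "A (combination w y) = combination w (\<chi> i. s i * y $ i)" for y
    unfolding A_def w(1) using injT by simp
  have su: "(\<chi> i. s i * u j $ i) = u (Suc j)" for j by (simp add: u_def vec_eq_iff)
  have Au: "A (combination w (u j)) = combination w (u (Suc j))" for j unfolding A su ..
  have good: "good_pair (second_fundamental_form X \<iota>) (\<phi>1 \<circ> \<iota>) (\<phi>2 \<circ> \<iota>)"
  proof -
    have restore: "\<phi> \<circ> \<iota> = \<phi> \<circ> \<iota> \<circ> T \<circ> inv T" for \<phi> :: "('n + 3) form"
      using T(2) by (simp add: fun_eq_iff bij_is_surj surj_f_inv_f)
    have invT: "clinear (inv T)" "bij (inv T)" using T by (simp_all add: clinear_inv bij_imp_bij_inv)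
    have hr: "has_roots (\<phi>1 \<circ> \<iota>) (\<phi>2 \<circ> \<iota>) s"
      using has_roots_compose[OF has_roots_diag[OF injs] invT] unfolding diagT[symmetric] restore[symmetric] .
    have "nondegenerate (diag_form s \<circ> inv T)"
      using s0 by (intro nondegenerate_compose[OF _ invT]) (simp add: nondegenerate_diag_form)
    then have "nondegenerate (\<phi>1 \<circ> \<iota>)" unfolding diagT[symmetric] restore[symmetric] .
    moreover have "nondegenerate (\<phi>2 \<circ> \<iota>)" using hr by (simp add: has_roots_def)
    moreover have "\<phi>1 \<circ> \<iota> \<noteq> \<phi>2 \<circ> \<iota> \<and> form.independent {\<phi>1 \<circ> \<iota>, \<phi>2 \<circ> \<iota>}"
      using has_roots_independent[OF hr n2] unfolding independent_pair_iff .
    ultimately show ?thesis by (simp add: good_pair_def second_fundamental_form_span)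
  qed
  have "vec.subspace (\<iota> -` ?K)" unfolding P_span by (rule vec.subspace_span)
  moreover have "(\<phi>1 \<circ> \<iota>) (combination w y) = (\<Sum>i\<in>UNIV. s i * (y $ i)\<^sup>2)" for y
    using fun_cong[OF diagT(1), of y] by (simp add: w diag_form_def)
  moreover have "(\<phi>2 \<circ> \<iota>) (combination w y) = (\<Sum>i\<in>UNIV. (y $ i)\<^sup>2)" for y
    using fun_cong[OF diagT(2), of y] by (simp add: w diag_form_def)
  moreover have "\<iota> -` ?K = vec.span {combination w (u 0), A (combination w (u 0)), A (A (combination w (u 0)))}"
    unfolding Au unfolding P_span w(1) by (simp add: numeral_2_eq_2)
  moreover have "u 0 $ i \<noteq> 0" for i using \<nu>(1) by (simp add: u_def)
  ultimately have "poised (second_fundamental_form X \<iota>) (\<iota> -` ?K)"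
    unfolding poised_def using P_dim good w(2) injs A by blast
  moreover have "vec.subspace ?K" unfolding K_span by (rule vec.subspace_span)
  ultimately show ?thesis using K_dim by blast
qed

end
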